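(* Let $n>m\ge 2$ and $t\ge 1$ be integers, $K$ a field, $S=K[x_1,\ldots,x_n]$, $S'=K[x_1,\ldots,x_{n-1}]$. Let $J=J_{n,m}\subset S$, $J'=(J:x_n)\cap S'$ and $I=I_{n-1,m}\subset S'$. For $1\le k\le t$ put $d_k:=\operatorname{depth}(S'/I^{t+1-k}J'^{k-1})$ and $s_k:=\operatorname{sdepth}(S'/I^{t+1-k}J'^{k-1})$. Then: (1) $\operatorname{depth}(S/(J^t,x_n^t))\geq \min\{\varphi(n-1,m,t),d_2,\ldots,d_t\}$. (2) $\operatorname{sdepth}(S/(J^t,x_n^t))\geq \min\{\varphi(n-1,m,t),s_2,\ldots,s_t\}$. (3) $\operatorname{depth}(S/J^t)\leq \operatorname{depth}(S/(J^t,x_n^t))+1$. (4) If $\operatorname{depth}(S/(J^t:x_n^t))>\operatorname{depth}(S/J^t)$, then $\operatorname{depth}(S/J^t)\geq \operatorname{depth}(S/(J^t,x_n^t))$. Similarly, if $\operatorname{sdepth}(S/(J^t:x_n^t))>\operatorname{sdepth}(S/J^t)$, then $\operatorname{sdepth}(S/J^t)\geq \operatorname{sdepth}(S/(J^t,x_n^t))$.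
   Context: $J_{n,m}=(x_ix_{i+1}\cdots x_{i+m-1} : 1\le i\le n)\subset S$, where indices are read modulo $n$ in $\{1,\ldots,n\}$ ($m$-path ideal of the cycle graph on $n$ vertices). $I_{n-1,m}=(x_ix_{i+1}\cdots x_{i+m-1} : 1\le i\le n-m)\subset S'$ ($m$-path ideal of the path graph on $n-1$ vertices). The zeroth power of an ideal is the whole ring. $(J^t,x_n^t)$ denotes the ideal $J^t+(x_n^t)$. For integers $1\le m\le n$ and $t\ge 1$, $$\varphi(n,m,t):= \begin{cases} n -t+2 - \left\lfloor \frac{n-t+2}{m+1} \right\rfloor - \left\lceil \frac{n-t+2}{m+1} \right\rceil, & t \leq n+1-m, \\ m-1,& t > n+1-m. \end{cases}$$ $\operatorname{depth}$ is the depth of a finitely generated graded module with respect to the graded maximal ideal generated by the variables of the polynomial ring. For a monomial ideal $L\subsetneq R$ in a polynomial ring $R=K[x_1,\ldots,x_N]$, a Stanley decomposition of $M=R/L$ is a decomposition $\mathcal D: M=\bigoplus_{i=1}^r m_iK[Z_i]$ as a direct sum of $\mathbb Z^N$-graded $K$-vector spaces, where the $m_i\in R$ are monomials, $Z_i\subset\{x_1,\ldots,x_N\}$, and $m_iK[Z_i]$ denotes the $K$-span in $R/L$ of the classes of $m_iw$, $w$ a monomial in $Z_i$, these classes being linearly independent. Put $\operatorname{sdepth}(\mathcal D)=\min_i|Z_i|$; the Stanley depth $\operatorname{sdepth}(M)$ is the maximum of $\operatorname{sdepth}(\mathcal D)$ over all Stanley decompositions $\mathcal D$ of $M$. For $S/\cdot$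 (resp. $S'/\cdot$) it is computed over $S$ (resp. $S'$). *)

theory Defs
  imports
    "HOL-Library.Poly_Mapping"
    "HOL-Library.Extended_Nat"
    "HOL-Algebra.Algebra"
begin

section \<open>Polynomial rings\<close>

text \<open>
  A monomial is a finitely supported exponent vector, and polynomials are finitely supported
  functions from monomials to the field; the product on \<^typ>\<open>('a::monoid_add) \<Rightarrow>\<^sub>0 'k::semiring_0\<close> is
  convolution. All variables \<open>x\<^sub>i\<close> with \<open>i\<close> a natural number live in one type, and
  \<open>K[x\<^sub>i : i \<in> V]\<close> is cut out of it as a carrier. Hence \<open>S' = K[x\<^sub>1, \<dots>, x\<^sub>n\<^sub>-\<^sub>1]\<close> is literally a subset
  of \<open>S = K[x\<^sub>1, \<dots>, x\<^sub>n]\<close>.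
\<close>

type_synonym monom = "nat \<Rightarrow>\<^sub>0 nat"
type_synonym 'k mpoly = "monom \<Rightarrow>\<^sub>0 'k"

definition mpolys :: "nat set \<Rightarrow> 'k::field mpoly set"
  where "mpolys V = {p. \<forall>u \<in> Poly_Mapping.keys p. Poly_Mapping.keys u \<subseteq> V}"

definition mpoly_ring :: "nat set \<Rightarrow> 'k::field mpoly ring"
  where "mpoly_ring V = \<lparr>carrier = mpolys V, monoid.mult = (*), monoid.one = 1, ring.zero = 0, ring.add = (+)\<rparr>"

definition of_monom :: "monom \<Rightarrow> 'k::field mpoly"
  where "of_monom u = Poly_Mapping.single u 1"

definition mvar :: "nat \<Rightarrow> 'k::field mpoly"
  where "mvar i = of_monom (Poly_Mapping.single i 1)"

section \<open>Ideals\<close>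

text \<open>
  Sums, products and generated ideals are those of HOL-Algebra. The \<open>t\<close>-th power
  of an ideal \<open>I\<close> of \<open>R\<close> is \<open>I [^]\<^bsub>ideals_set R\<^esub> t\<close>; the unit of \<^term>\<open>ideals_set R\<close> is the
  whole ring, so this is \<open>R\<close> for \<open>t = 0\<close>.
\<close>

definition ideal_colon :: "('a, 'b) ring_scheme \<Rightarrow> 'a set \<Rightarrow> 'a \<Rightarrow> 'a set"
  where "ideal_colon R L f = {g \<in> carrier R. g \<otimes>\<^bsub>R\<^esub> f \<in> L}"

text \<open>The index \<open>i + j\<close> reduced modulo \<open>n\<close> to a representative in \<open>{1, \<dots>, n}\<close>
  is \<open>(i + j - 1) mod n + 1\<close>.\<close>

definition cycle_path_ideal :: "nat \<Rightarrow> nat \<Rightarrow> 'k::field mpoly set"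
  where "cycle_path_ideal n m =
    genideal (mpoly_ring {1..n}) {\<Prod>j<m. mvar ((i + j - 1) mod n + 1) | i. 1 \<le> i \<and> i \<le> n}"

text \<open>For the path on \<open>n\<close> vertices the \<open>m\<close>-paths start at \<open>1, \<dots>, n + 1 - m\<close>.\<close>

definition line_path_ideal :: "nat \<Rightarrow> nat \<Rightarrow> 'k::field mpoly set"
  where "line_path_ideal n m =
    genideal (mpoly_ring {1..n}) {\<Prod>j<m. mvar (i + j) | i. 1 \<le> i \<and> i \<le> n + 1 - m}"

section \<open>Depth\<close>

definition quot_module :: "('a, 'b) ring_scheme \<Rightarrow> 'a set \<Rightarrow> ('a, 'a set) module"
  where "quot_module R L = ring.extend (R Quot L)
    (module.fields (\<lambda>r C. \<Union>c\<in>C. L +>\<^bsub>R\<^esub> (r \<otimes>\<^bsub>R\<^esub> c)))"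

text \<open>The submodule \<open>(f\<^sub>1, \<dots>, f\<^sub>r) M\<close>.\<close>

primrec list_smult :: "('a, 'b, 'c) module_scheme \<Rightarrow> 'a list \<Rightarrow> 'b set"
  where
    "list_smult M [] = {\<zero>\<^bsub>M\<^esub>}"
  | "list_smult M (f # fs) = {f \<odot>\<^bsub>M\<^esub> x \<oplus>\<^bsub>M\<^esub> y | x y. x \<in> carrier M \<and> y \<in> list_smult M fs}"

text \<open>\<open>f\<^sub>1, \<dots>, f\<^sub>r\<close> is \<open>M\<close>-regular if each \<open>f\<^sub>i\<close> is a nonzerodivisor on
  \<open>M / (f\<^sub>1, \<dots>, f\<^sub>i\<^sub>-\<^sub>1) M\<close> and \<open>M \<noteq> (f\<^sub>1, \<dots>, f\<^sub>r) M\<close>.\<close>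

definition regular_sequence :: "('a, 'b, 'c) module_scheme \<Rightarrow> 'a list \<Rightarrow> bool"
  where "regular_sequence M fs \<longleftrightarrow>
    (\<forall>i<length fs. \<forall>x\<in>carrier M.
       fs ! i \<odot>\<^bsub>M\<^esub> x \<in> list_smult M (take i fs) \<longrightarrow> x \<in> list_smult M (take i fs)) \<and>
    list_smult M fs \<noteq> carrier M"

definition module_depth :: "'a set \<Rightarrow> ('a, 'b, 'c) module_scheme \<Rightarrow> enat"
  where "module_depth \<mm> M = (SUP fs \<in> {fs. set fs \<subseteq> \<mm> \<and> regular_sequence M fs}. enat (length fs))"

definition depth_quot :: "nat set \<Rightarrow> 'k::field mpoly set \<Rightarrow> enat"
  where "depth_quot V L =
    module_depth (genideal (mpoly_ring V) (mvar ` V)) (quot_module (mpoly_ring V) L)"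

section \<open>Stanley depth\<close>

text \<open>The image of \<open>u K[Z]\<close> in \<open>R/L\<close>, where \<open>R = K[x\<^sub>i : i \<in> V]\<close>.\<close>

definition stanley_space :: "nat set \<Rightarrow> 'k::field mpoly set \<Rightarrow> monom \<times> nat set \<Rightarrow> 'k mpoly set set"
  where "stanley_space V L = (\<lambda>(u, Z). {L +>\<^bsub>mpoly_ring V\<^esub> (of_monom u * q) | q. q \<in> mpolys Z})"

text \<open>
  The condition on \<open>q\<close> below says that the classes of \<open>u w\<close>, for \<open>w\<close> a monomial in \<open>Z\<close>, are linearly
  independent in \<open>R/L\<close> (\<open>q\<close> collects the coefficients of a linear combination). The last condition
  is that \<open>R/L\<close> is the direct sum of the spaces. They are spanned by classes of
  monomials, so the decomposition respects the multigrading of \<open>R/L\<close> for a monomial ideal \<open>L\<close>.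
  A pair \<open>(u, Z)\<close> cannot occur twice in a direct sum, as its space is nonzero; therefore
  a finite set of pairs may be used in place of a finite family.
\<close>

definition stanley_decomp :: "nat set \<Rightarrow> 'k::field mpoly set \<Rightarrow> (monom \<times> nat set) set \<Rightarrow> bool"
  where "stanley_decomp V L D \<longleftrightarrow>
    finite D \<and>
    (\<forall>(u, Z)\<in>D. Poly_Mapping.keys u \<subseteq> V \<and> Z \<subseteq> V \<and>
       (\<forall>q\<in>mpolys Z. of_monom u * q \<in> L \<longrightarrow> q = 0)) \<and>
    (\<forall>C\<in>carrier (mpoly_ring V Quot L).
       \<exists>!s. s \<in> (\<Pi>\<^sub>E d\<in>D. stanley_space V L d) \<and> C = finsum (mpoly_ring V Quot L) s D)"

text \<open>For finite \<open>V\<close> and proper \<open>L\<close> all values are at most \<open>card V\<close>, so the supremum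
  is a maximum and the infimum is a minimum.\<close>

definition sdepth_quot :: "nat set \<Rightarrow> 'k::field mpoly set \<Rightarrow> enat"
  where "sdepth_quot V L =
    (SUP D \<in> {D. stanley_decomp V L D}. INF (u, Z) \<in> D. enat (card Z))"

section \<open>The numerical bound\<close>

definition phi :: "nat \<Rightarrow> nat \<Rightarrow> nat \<Rightarrow> int"
  where "phi n m t =
    (if int t \<le> int n + 1 - int m
     then int n - int t + 2
       - \<lfloor>(real n - real t + 2) / (real m + 1)\<rfloor> - \<lceil>(real n - real t + 2) / (real m + 1)\<rceil>
     else int m - 1)"

text \<open>By the next lemma, nothing is lost in passing to \<^term>\<open>nat (phi n m t)\<close>.\<close>

lemma phi_nonneg:
  assumes "1 \<le> m" "m \<le> n"
  shows "0 \<le> phi n m t"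
proof (cases "int t \<le> int n + 1 - int m")
  case True
  define a where "a = int n - int t + 2"
  define y where "y = real_of_int a / (real m + 1)"
  have a: "a \<ge> int m + 1" using True a_def by simp
  have y2: "y \<le> real_of_int a / 2"
    unfolding y_def using a assms by (intro divide_left_mono) auto
  have "\<lfloor>y\<rfloor> + \<lceil>y\<rceil> \<le> a"
  proof -
    have "\<lfloor>y\<rfloor> \<le> \<lfloor>real_of_int a / 2\<rfloor>" using y2 by (rule floor_mono)
    moreover have "\<lceil>y\<rceil> \<le> \<lceil>real_of_int a / 2\<rceil>" using y2 by (rule ceiling_mono)
    moreover have "\<lfloor>real_of_int a / 2\<rfloor> + \<lceil>real_of_int a / 2\<rceil> = a"
    proof (cases "even a")
      case True
      then obtain b where "a = 2 * b" by (elim evenE)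
      then show ?thesis by simp
    next
      case False
      then obtain b where b: "a = 2 * b + 1" by (elim oddE)
      have "\<lfloor>real_of_int a / 2\<rfloor> = b" using b by (intro floor_unique) auto
      moreover have "\<lceil>real_of_int a / 2\<rceil> = b + 1" using b by (intro ceiling_unique) auto
      ultimately show ?thesis using b by simp
    qed
    ultimately show ?thesis by linarith
  qed
  then show ?thesis using True by (simp add: phi_def y_def a_def)
qed (use assms in \<open>simp add: phi_def\<close>)

section \<open>Basic facts\<close>

lemma zero_in_mpolys: "0 \<in> mpolys V"
  by (simp add: mpolys_def)

lemma one_in_mpolys: "1 \<in> mpolys V"
  by (simp add: mpolys_def)

lemma add_in_mpolys:
  assumes "p \<in> mpolys V" "q \<in> mpolys V" shows "p + q \<in> mpolys V"
proof -
  have "Poly_Mapping.keys (p + q) \<subseteq> Poly_Mapping.keys p \<union> Poly_Mapping.keys q"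
    by (rule Poly_Mapping.keys_add)
  then show ?thesis using assms by (auto simp only: mpolys_def mem_Collect_eq)
qed

lemma uminus_in_mpolys: "p \<in> mpolys V \<Longrightarrow> - p \<in> mpolys V"
  unfolding mpolys_def by (simp add: in_keys_iff)

lemma mult_in_mpolys:
  assumes "p \<in> mpolys V" "q \<in> mpolys V" shows "p * q \<in> mpolys V"
proof -
  have "Poly_Mapping.keys u \<subseteq> V" if "u \<in> Poly_Mapping.keys (p * q)" for u
  proof -
    have "u \<in> {a + b | a b. a \<in> Poly_Mapping.keys p \<and> b \<in> Poly_Mapping.keys q}"
      using that keys_mult[of p q] by (rule rev_subsetD)
    then obtain a b where u: "u = a + b"
      and a: "a \<in> Poly_Mapping.keys p" and b: "b \<in> Poly_Mapping.keys q"
      by (elim CollectE exE conjE)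
    have "Poly_Mapping.keys u \<subseteq> Poly_Mapping.keys a \<union> Poly_Mapping.keys b"
      unfolding u by (rule Poly_Mapping.keys_add)
    also have "\<dots> \<subseteq> V"
      using a b assms unfolding mpolys_def by simp
    finally show ?thesis .
  qed
  then show ?thesis by (simp add: mpolys_def)
qed

lemma of_monom_in_mpolys: "Poly_Mapping.keys u \<subseteq> V \<Longrightarrow> of_monom u \<in> mpolys V"
  by (simp add: mpolys_def of_monom_def)

lemma mpoly_ring_simps [simp]:
  "carrier (mpoly_ring V) = mpolys V"
  "monoid.mult (mpoly_ring V) = (*)"
  "monoid.one (mpoly_ring V) = 1"
  "ring.zero (mpoly_ring V) = 0"
  "ring.add (mpoly_ring V) = (+)"
  by (simp_all add: mpoly_ring_def)

lemma cring_mpoly_ring: "cring (mpoly_ring V :: 'k::field mpoly ring)"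
proof (rule cringI)
  show "abelian_group (mpoly_ring V :: 'k mpoly ring)"
  proof (rule abelian_groupI)
    fix x :: "'k mpoly" assume "x \<in> carrier (mpoly_ring V)"
    then show "\<exists>y\<in>carrier (mpoly_ring V). y \<oplus>\<^bsub>mpoly_ring V\<^esub> x = \<zero>\<^bsub>mpoly_ring V\<^esub>"
      by (intro bexI[of _ "- x"]) (auto intro: uminus_in_mpolys)
  qed (simp_all add: add_in_mpolys zero_in_mpolys add.assoc add.commute)
  show "comm_monoid (mpoly_ring V :: 'k mpoly ring)"
    by (rule comm_monoidI) (simp_all add: mult_in_mpolys one_in_mpolys mult.assoc mult.commute)
qed (simp add: distrib_right)

lemma quot_module_simps [simp]:
  "carrier (quot_module R L) = carrier (R Quot L)"
  "ring.add (quot_module R L) = ring.add (R Quot L)"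
  "ring.zero (quot_module R L) = ring.zero (R Quot L)"
  "smult (quot_module R L) = (\<lambda>r C. \<Union>c\<in>C. L +>\<^bsub>R\<^esub> (r \<otimes>\<^bsub>R\<^esub> c))"
  by (simp_all add: quot_module_def ring.extend_def module.fields_def)

lemma (in ideal) quot_module_smult_coset:
  assumes "cring R" "r \<in> carrier R" "c \<in> carrier R"
  shows "r \<odot>\<^bsub>quot_module R I\<^esub> (I +> c) = I +> (r \<otimes> c)"
proof -
  have *: "I +> (r \<otimes> d) = I +> (r \<otimes> c)" if d: "d \<in> I +> c" for d
  proof -
    obtain i where i: "i \<in> I" "d = i \<oplus> c"
      using d unfolding a_r_coset_def' by blast
    have ic: "i \<in> carrier R" using i Icarr by blast
    have "r \<otimes> d = (r \<otimes> i) \<oplus> (r \<otimes> c)"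
      using i ic assms by (simp add: r_distr)
    then have "r \<otimes> d \<in> I +> (r \<otimes> c)"
      unfolding a_r_coset_def' using I_l_closed[OF i(1) assms(2)] by blast
    then show ?thesis
      using a_repr_independence[OF _ _ a_subgroup, of "r \<otimes> d" "r \<otimes> c"] assms by simp
  qed
  have "c \<in> I +> c" using assms(3) by (rule a_rcos_self)
  then show ?thesis unfolding quot_module_simps using * by (intro SUP_eq_const) blast+
qed

lemma (in ideal) quot_module_is_module:
  assumes "cring R"
  shows "Module.module R (quot_module R I)"
proof -
  interpret Q: ring "R Quot I" by (rule quotient_is_ring)
  have car: "\<exists>c\<in>carrier R. C = I +> c" if "C \<in> carrier (R Quot I)" for C
    using that by (auto simp: FactRing_simps)
  have ad: "(I +> c) \<oplus>\<^bsub>R Quot I\<^esub> (I +> d) = I +> (c \<oplus> d)"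
    if "c \<in> carrier R" "d \<in> carrier R" for c d
    using that by (simp add: FactRing_def a_rcos_sum)
  have mem: "I +> c \<in> carrier (R Quot I)" if "c \<in> carrier R" for c
    using that by (auto simp: FactRing_simps)
  note sm = quot_module_smult_coset[OF assms]
  show ?thesis
  proof (rule Module.moduleI[OF assms])
    show "abelian_group (quot_module R I)"
      by (rule abelian_groupI)
        (simp_all add: Q.a_ac Q.add.l_inv_ex)
  next
    fix a C assume a: "a \<in> carrier R" and "C \<in> carrier (quot_module R I)"
    then obtain c where c: "c \<in> carrier R" "C = I +> c" using car by auto
    show "a \<odot>\<^bsub>quot_module R I\<^esub> C \<in> carrier (quot_module R I)"
      using a c by (simp del: quot_module_simps(4) add: sm mem)
  next
    fix a b C assume ab: "a \<in> carrier R" "b \<in> carrier R" and "C \<in> carrier (quot_module R I)"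
    then obtain c where c: "c \<in> carrier R" "C = I +> c" using car by auto
    show "(a \<oplus> b) \<odot>\<^bsub>quot_module R I\<^esub> C =
        (a \<odot>\<^bsub>quot_module R I\<^esub> C) \<oplus>\<^bsub>quot_module R I\<^esub> (b \<odot>\<^bsub>quot_module R I\<^esub> C)"
      using ab c by (simp del: quot_module_simps(4) add: sm ad l_distr)
    show "(a \<otimes> b) \<odot>\<^bsub>quot_module R I\<^esub> C =
        a \<odot>\<^bsub>quot_module R I\<^esub> (b \<odot>\<^bsub>quot_module R I\<^esub> C)"
      using ab c by (simp del: quot_module_simps(4) add: sm m_assoc)
  next
    fix a C D assume a: "a \<in> carrier R"
      and "C \<in> carrier (quot_module R I)" "D \<in> carrier (quot_module R I)"
    then obtain c d where c: "c \<in> carrier R" "C = I +> c" "d \<in> carrier R" "D = I +> d"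
      using car by (metis quot_module_simps(1))
    show "a \<odot>\<^bsub>quot_module R I\<^esub> (C \<oplus>\<^bsub>quot_module R I\<^esub> D) =
        (a \<odot>\<^bsub>quot_module R I\<^esub> C) \<oplus>\<^bsub>quot_module R I\<^esub> (a \<odot>\<^bsub>quot_module R I\<^esub> D)"
      using a c by (simp del: quot_module_simps(4) add: sm ad r_distr)
  next
    fix C assume "C \<in> carrier (quot_module R I)"
    then obtain c where c: "c \<in> carrier R" "C = I +> c" using car by auto
    show "\<one> \<odot>\<^bsub>quot_module R I\<^esub> C = C"
      using c by (simp del: quot_module_simps(4) add: sm)
  qed
qed

end

theory Submission
  imports Defs
begin

text \<open>
  Write \<open>x = x\<^sub>n\<close>. Since \<open>J = (I, x J')\<close> and \<open>I \<subseteq> J'\<close>, the coefficient ideal of \<open>x\<^sup>j\<close> in \<open>J\<^sup>t\<close> is \<open>I\<^sup>t\<^sup>-\<^sup>j J'\<^sup>j\<close>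
  for \<open>j \<le> t\<close>, so that \<open>S/(J\<^sup>t, x\<^sup>t)\<close> is filtered by the \<open>S'/I\<^sup>t\<^sup>-\<^sup>j J'\<^sup>j\<close> with \<open>j < t\<close>. This yields the lower bounds
  (1) and (2) once \<open>\<phi>(n-1,m,t)\<close> is known to bound the two invariants of \<open>S'/I\<^sup>t\<close>. For (3), every coefficient
  ideal of an ideal that is homogeneous in \<open>x\<close> has depth at least that of the ideal minus one. Part (4) is the depth lemma
  for the colon by \<open>x\<^sup>t\<close>, respectively the union of two Stanley decompositions.

  Depth is handled without homological algebra: prime avoidance in the Noetherian ring \<open>K[V]\<close> gives elements regular
  on finitely many quotients at once, and the depth left after dividing by a regular element does not depend on
  that element. Stanley decompositions are partitions of the monomials outside the ideal.

  The bound for \<open>I\<^sup>t\<close> comes from the recursion \<open>D(L) \<ge> min (D(L : x)) (D(L, x))\<close>, valid for both invariants: taking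
  colons by the variables of the last path from left to right and then, in each truncated path, from right
  to left, only powers of shorter path ideals and the power \<open>t - 1\<close> remain.
\<close>

text \<open>In (3) the loss of one comes from the search for a regular element free of
  \<open>x\<close>: it exists while the depth is at least two, and division by it then acts on all
  coefficient ideals at once. In the recursion for \<open>I^t\<close>, setting to zero a variable
  \<open>x_p\<close> near the right end cuts the path down to the vertices before \<open>p\<close>
  and frees those after it, whereas colons build up a monomial, and the power drops only when that
  monomial is the whole last path. A cut made in the pass to the right leaves part of this monomial
  at the end of the shorter path; the pass to the left extends it to the last path there, and a cut
  in this second pass leaves it behind. Two cuts together remove at least \<open>m + 1\<close>
  vertices, of which all but two become free variables. This is the origin of \<open>m + 1\<close>
  and of the two quotients subtracted in \<open>phi\<close>. Colons may end in the unit ideal, whose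
  quotient would have depth zero under the definition and must therefore be let through.\<close>

definition set_closed :: "'a::comm_ring_1 set \<Rightarrow> bool"
  where "set_closed A \<longleftrightarrow> A \<noteq> {} \<and> (\<forall>a\<in>A. \<forall>b\<in>A. a + b \<in> A \<and> a * b \<in> A)"

section \<open>Ideals of a subring, described by their elements\<close>

locale subring_carrier =
  fixes R :: "'a::comm_ring_1 set"
  assumes one_mem: "1 \<in> R"
    and diff_mem: "\<And>a b. a \<in> R \<Longrightarrow> b \<in> R \<Longrightarrow> a - b \<in> R"
    and mult_mem: "\<And>a b. a \<in> R \<Longrightarrow> b \<in> R \<Longrightarrow> a * b \<in> R"
begin

lemma zero_mem: "0 \<in> R"
  using diff_mem[OF one_mem one_mem] by simp

lemma uminus_mem: "a \<in> R \<Longrightarrow> - a \<in> R"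
  using diff_mem[OF zero_mem] by force

lemma add_mem: "a \<in> R \<Longrightarrow> b \<in> R \<Longrightarrow> a + b \<in> R"
  using diff_mem[OF _ uminus_mem, of a b] by simp

lemmas mems = one_mem zero_mem diff_mem mult_mem uminus_mem add_mem

definition idl :: "'a set \<Rightarrow> bool"
  where "idl L \<longleftrightarrow> L \<subseteq> R \<and> 0 \<in> L \<and> (\<forall>a\<in>L. \<forall>b\<in>L. a + b \<in> L) \<and> (\<forall>r\<in>R. \<forall>a\<in>L. r * a \<in> L)"

definition adj :: "'a set \<Rightarrow> 'a \<Rightarrow> 'a set"
  where "adj L f = {a + f * r | a r. a \<in> L \<and> r \<in> R}"

definition colon :: "'a set \<Rightarrow> 'a \<Rightarrow> 'a set"
  where "colon L f = {g \<in> R. g * f \<in> L}"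

definition nzd :: "'a set \<Rightarrow> 'a \<Rightarrow> bool"
  where "nzd L f \<longleftrightarrow> (\<forall>z\<in>R. f * z \<in> L \<longrightarrow> z \<in> L)"

text \<open>No nonzero class modulo \<open>L\<close> is killed by all of \<open>A\<close>. For the
  ideal of variables this is the vanishing of a Hom module; unlike the choice of a regular element,
  it can be compared between different quotients.\<close>

definition torsion_free :: "'a set \<Rightarrow> 'a set \<Rightarrow> bool"
  where "torsion_free A L \<longleftrightarrow> (\<forall>z\<in>R. (\<forall>a\<in>A. a * z \<in> L) \<longrightarrow> z \<in> L)"

definition prime_idl :: "'a set \<Rightarrow> bool"
  where "prime_idl P \<longleftrightarrow> idl P \<and> (\<forall>a\<in>R. \<forall>b\<in>R. a * b \<in> P \<longrightarrow> a \<in> P \<or> b \<in> P)"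

lemma idl_sub: "idl L \<Longrightarrow> a \<in> L \<Longrightarrow> a \<in> R"
  by (auto simp: idl_def)
lemma idl_zero: "idl L \<Longrightarrow> 0 \<in> L"
  by (auto simp: idl_def)
lemma idl_add: "idl L \<Longrightarrow> a \<in> L \<Longrightarrow> b \<in> L \<Longrightarrow> a + b \<in> L"
  by (auto simp: idl_def)
lemma idl_mult: "idl L \<Longrightarrow> r \<in> R \<Longrightarrow> a \<in> L \<Longrightarrow> r * a \<in> L"
  by (auto simp: idl_def)
lemma idl_mult_right: "idl L \<Longrightarrow> r \<in> R \<Longrightarrow> a \<in> L \<Longrightarrow> a * r \<in> L"
  by (metis idl_mult mult.commute)
lemma idl_diff: "idl L \<Longrightarrow> a \<in> L \<Longrightarrow> b \<in> L \<Longrightarrow> a - b \<in> L"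
  using idl_add[of L a "-1 * b"] idl_mult[of L "-1" b] uminus_mem[OF one_mem] by simp

lemma idl_adj:
  assumes "idl L" "f \<in> R" shows "idl (adj L f)"
  unfolding idl_def
proof (intro conjI ballI)
  show "adj L f \<subseteq> R" using assms by (auto simp: adj_def intro!: add_mem mult_mem dest: idl_sub)
  show "0 \<in> adj L f" using idl_zero[OF assms(1)] zero_mem by (force simp: adj_def)
next
  fix p q assume "p \<in> adj L f" "q \<in> adj L f"
  then obtain a r b s where "p = a + f * r" "q = b + f * s" "a \<in> L" "b \<in> L" "r \<in> R" "s \<in> R"
    by (auto simp: adj_def)
  moreover from this have "p + q = (a + b) + f * (r + s)" by (simp add: algebra_simps)
  ultimately show "p + q \<in> adj L f" unfolding adj_def using assms idl_add add_mem by blast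
next
  fix c p assume "c \<in> R" "p \<in> adj L f"
  then obtain a r where "p = a + f * r" "a \<in> L" "r \<in> R"
    by (auto simp: adj_def)
  moreover from this have "c * p = c * a + f * (c * r)" by (simp add: algebra_simps)
  ultimately show "c * p \<in> adj L f" unfolding adj_def using assms \<open>c \<in> R\<close> idl_mult mult_mem by blast
qed

lemma adj_upper: "L \<subseteq> adj L f"
  using zero_mem by (force simp: adj_def)

lemma adj_mem: "idl L \<Longrightarrow> f \<in> R \<Longrightarrow> f \<in> adj L f"
  using idl_zero one_mem by (force simp: adj_def)

lemma adj_least: "idl L \<Longrightarrow> K \<subseteq> L \<Longrightarrow> f \<in> L \<Longrightarrow> adj K f \<subseteq> L"
  by (auto simp: adj_def intro!: idl_add intro: idl_mult_right)

lemma adj_commute: "adj (adj L f) g = adj (adj L g) f"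
proof -
  have "adj (adj L f) g \<subseteq> adj (adj L g) f" for f g
  proof
    fix p assume "p \<in> adj (adj L f) g"
    then obtain a r s where "p = (a + f * r) + g * s" "a \<in> L" "r \<in> R" "s \<in> R"
      by (auto simp: adj_def)
    moreover from this have "p = (a + g * s) + f * r" by (simp add: algebra_simps)
    ultimately show "p \<in> adj (adj L g) f" unfolding adj_def by blast
  qed
  then show ?thesis by blast
qed

lemma colon_mem: "z \<in> colon L f \<longleftrightarrow> z \<in> R \<and> z * f \<in> L"
  by (simp add: colon_def)

lemma idl_colon:
  assumes "idl L" "f \<in> R" shows "idl (colon L f)"
  using assms by (auto simp: idl_def colon_def distrib_right mult.assoc intro!: mems)

lemma torsion_free_of_nzd: "nzd L f \<Longrightarrow> f \<in> A \<Longrightarrow> torsion_free A L"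
  by (auto simp: nzd_def torsion_free_def)

end

section \<open>Noetherian subrings, maximal annihilators and prime avoidance\<close>

locale noetherian_subring = subring_carrier +
  assumes acc: "\<And>F. (\<And>i::nat. idl (F i)) \<Longrightarrow> \<exists>i. \<not> F i \<subset> F (Suc i)"
begin

lemma maximal_ideal_in:
  assumes "B \<in> C" "\<And>Y. Y \<in> C \<Longrightarrow> idl Y"
  shows "\<exists>Y\<in>C. B \<subseteq> Y \<and> (\<forall>Z\<in>C. Y \<subseteq> Z \<longrightarrow> Z = Y)"
proof (rule ccontr)
  assume *: "\<not> ?thesis"
  let ?C = "{Y \<in> C. B \<subseteq> Y}"
  have ex: "\<exists>Z. Z \<in> ?C \<and> Y \<subset> Z" if Y: "Y \<in> ?C" for Y
  proof -
    from Y have "Y \<in> C" "B \<subseteq> Y" by simp_all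
    with * obtain Z where "Z \<in> C" "Y \<subseteq> Z" "Z \<noteq> Y" by meson
    then show ?thesis using \<open>B \<subseteq> Y\<close> by (intro exI[of _ Z]) blast
  qed
  define nx where "nx Y = (SOME Z. Z \<in> ?C \<and> Y \<subset> Z)" for Y
  have nx: "nx Y \<in> ?C \<and> Y \<subset> nx Y" if "Y \<in> ?C" for Y
    unfolding nx_def using ex[OF that] by (rule someI_ex)
  define F where "F i = (nx ^^ i) B" for i
  have F: "F i \<in> ?C" for i
    by (induction i) (use assms nx in \<open>auto simp: F_def\<close>)
  have "F i \<subset> F (Suc i)" for i using nx[OF F[of i]] by (simp add: F_def)
  then show False using acc[of F] F assms(2) by blast
qed

text \<open>The maximal elements among the annihilators of nonzero classes modulo \<open>L\<close>,
  hence the maximal associated primes; their union is the set of zero divisors on the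
  quotient.\<close>

definition ass_max :: "'a set \<Rightarrow> 'a set set"
  where "ass_max L = {P. (\<exists>g\<in>R - L. P = colon L g) \<and> (\<forall>g\<in>R - L. P \<subseteq> colon L g \<longrightarrow> colon L g = P)}"

lemma ass_max_cover:
  assumes "idl L" "z \<in> R - L"
  shows "\<exists>P\<in>ass_max L. colon L z \<subseteq> P"
proof -
  have "\<exists>P\<in>colon L ` (R - L). colon L z \<subseteq> P \<and> (\<forall>Q\<in>colon L ` (R - L). P \<subseteq> Q \<longrightarrow> Q = P)"
    by (rule maximal_ideal_in) (use assms idl_colon in \<open>simp, blast\<close>)
  then obtain g where "g \<in> R - L" "colon L z \<subseteq> colon L g"
    "\<forall>Q\<in>colon L ` (R - L). colon L g \<subseteq> Q \<longrightarrow> Q = colon L g" by blast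
  then have "colon L g \<in> ass_max L" unfolding ass_max_def by simp blast
  with \<open>colon L z \<subseteq> colon L g\<close> show ?thesis by blast
qed

text \<open>If \<open>a * b\<close> kills the class of \<open>g\<close> but \<open>b\<close> does
  not, then \<open>b * g\<close> is a nonzero class whose annihilator contains \<open>P\<close>; by
  maximality it equals \<open>P\<close>, and it contains \<open>a\<close>.\<close>

lemma ass_max_prime:
  assumes L: "idl L" and P: "P \<in> ass_max L"
  shows "prime_idl P"
proof -
  obtain g where g: "g \<in> R - L" "P = colon L g"
    and max: "\<And>h. h \<in> R - L \<Longrightarrow> P \<subseteq> colon L h \<Longrightarrow> colon L h = P"
    using P by (auto simp: ass_max_def)
  have "a \<in> P" if ab: "a \<in> R" "b \<in> R" "a * b \<in> P" "b \<notin> P" for a b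
  proof -
    have bg: "b * g \<in> R - L" using ab g by (auto simp: colon_mem intro: mult_mem)
    have "P \<subseteq> colon L (b * g)"
      using g idl_mult[OF L \<open>b \<in> R\<close>] by (simp add: colon_mem mult.left_commute[of _ b] subset_iff)
    then have "colon L (b * g) = P" using max bg by blast
    moreover have "a \<in> colon L (b * g)" using ab g by (auto simp: colon_mem mult.assoc)
    ultimately show ?thesis by simp
  qed
  then show ?thesis using g idl_colon[OF L] by (auto simp: prime_idl_def)
qed

text \<open>Distinct maximal annihilators \<open>P i\<close> of \<open>g i\<close> are incomparable.
  The chain of ideals generated by \<open>L\<close> and \<open>g 0, ..., g (k - 1)\<close> stops, so
  \<open>g k\<close> lies in its own predecessor ideal for some \<open>k\<close>. A product of
  elements chosen from each \<open>P j\<close> with \<open>j < k\<close> outside the prime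
  \<open>P k\<close> kills that ideal, hence \<open>g k\<close>, and yet is not in
  \<open>P k\<close>.\<close>

lemma ass_max_finite:
  assumes L: "idl L"
  shows "finite (ass_max L)"
proof (rule ccontr)
  assume "infinite (ass_max L)"
  then obtain P :: "nat \<Rightarrow> 'a set" where inj: "inj P" and "range P \<subseteq> ass_max L"
    using infinite_countable_subset by blast
  then have P: "P i \<in> ass_max L" for i by (auto simp: image_subset_iff)
  have "\<exists>g\<in>R - L. P i = colon L g" for i using P[of i] by (simp add: ass_max_def)
  then obtain g where g: "\<And>i. g i \<in> R - L" "\<And>i. P i = colon L (g i)" by metis
  have notsub: "\<not> P i \<subseteq> P j" if "i \<noteq> j" for i j
  proof
    assume "P i \<subseteq> P j"
    then have "P j = P i" using P[of i] g[of j] by (auto simp: ass_max_def)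
    then show False using inj that by (auto dest: injD)
  qed
  define G where "G k = rec_nat L (\<lambda>i K. adj K (g i)) k" for k
  have G: "G 0 = L" "G (Suc k) = adj (G k) (g k)" for k by (auto simp: G_def)
  have idlG: "idl (G k)" for k
    by (induction k) (use L g in \<open>auto simp: G intro: idl_adj\<close>)
  obtain k where k: "\<not> G k \<subset> G (Suc k)" using acc[of G] idlG by blast
  then have gk: "g k \<in> G k"
    using adj_mem[OF idlG, of "g k" k] adj_upper[of "G k" "g k"] g(1)[of k] by (auto simp: G)
  have "\<exists>a\<in>R - P k. \<forall>h\<in>G j. a * h \<in> L" if "j \<le> k" for j
    using that
  proof (induction j)
    case 0
    have "1 \<in> R - P k" using g[of k] one_mem by (auto simp: colon_mem)
    then show ?case by (intro bexI[of _ 1]) (auto simp: G)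
  next
    case (Suc j)
    then obtain a where a: "a \<in> R - P k" "\<And>h. h \<in> G j \<Longrightarrow> a * h \<in> L" by auto
    obtain b where b: "b \<in> P j" "b \<notin> P k" using notsub[of j k] Suc.prems by auto
    have bR: "b \<in> R" "b * g j \<in> L" using b g by (auto simp: colon_mem)
    have "a * b \<notin> P k"
      using ass_max_prime[OF L P[of k]] a b bR by (auto simp: prime_idl_def)
    moreover have "a * b * h \<in> L" if "h \<in> G (Suc j)" for h
    proof -
      obtain c r where h: "h = c + g j * r" "c \<in> G j" "r \<in> R" using \<open>h \<in> G (Suc j)\<close> by (auto simp: G adj_def)
      have "a * b * h = b * (a * c) + (a * r) * (b * g j)" by (simp add: h algebra_simps)
      moreover have "b * (a * c) \<in> L" using idl_mult[OF L] a(2)[of c] h bR by blast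
      moreover have "(a * r) * (b * g j) \<in> L" using idl_mult[OF L mult_mem] a(1) h bR by blast
      ultimately show ?thesis using idl_add[OF L] by simp
    qed
    ultimately show ?case using a bR by (intro bexI[of _ "a * b"]) (auto intro: mult_mem)
  qed
  then obtain a where "a \<in> R - P k" "\<And>h. h \<in> G k \<Longrightarrow> a * h \<in> L" by blast
  then show False using gk g by (auto simp: colon_mem)
qed

text \<open>\<open>A\<close> is only assumed to be closed under sums and products, because the
  result is also applied to the ideal of variables of \<open>K[V]\<close> inside
  \<open>K[V, x]\<close>, where it is not an ideal.\<close>

lemma prime_avoidance:
  assumes "finite Ps" "\<And>P. P \<in> Ps \<Longrightarrow> prime_idl P" "A \<subseteq> R"
    "\<And>P. P \<in> Ps \<Longrightarrow> \<not> A \<subseteq> P" "set_closed A"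
  shows "\<exists>a\<in>A. \<forall>P\<in>Ps. a \<notin> P"
  using assms
proof (induction "card Ps" arbitrary: Ps rule: less_induct)
  case less
  have A: "a + b \<in> A" "a * b \<in> A" if "a \<in> A" "b \<in> A" for a b
    using less.prems that by (auto simp: set_closed_def)
  have IH: "\<exists>a\<in>A. \<forall>Q\<in>Ps - {P}. a \<notin> Q" if "P \<in> Ps" for P
    using that less.prems by (intro less.hyps card_Diff1_less) auto
  show ?case
  proof (cases "\<exists>P\<in>Ps. \<exists>Q\<in>Ps. P \<noteq> Q \<and> A \<inter> Q \<subseteq> P")
    case True
    then obtain P Q where PQ: "P \<in> Ps" "Q \<in> Ps" "P \<noteq> Q" "A \<inter> Q \<subseteq> P" by blast
    \<comment> \<open>An element of \<open>A\<close> that avoids all primes but \<open>Q\<close>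
      avoids \<open>P\<close>, hence also \<open>Q\<close>.\<close>
    then show ?thesis using IH[OF \<open>Q \<in> Ps\<close>] by blast
  next
    case False
    show ?thesis
    proof (cases "Ps = {}")
      case True
      then show ?thesis using less.prems by (auto simp: set_closed_def)
    next
      case nonempty: False
      then obtain P where P: "P \<in> Ps" by blast
      obtain a where a: "a \<in> A" "\<forall>Q\<in>Ps - {P}. a \<notin> Q" using IH[OF P] by blast
      have pr: "prime_idl P" using P less.prems by blast
      \<comment> \<open>A product of elements outside \<open>P\<close>, one from each other prime;
        added to \<open>a\<close>, it repairs the case \<open>a \<in> P\<close>.\<close>
      have "\<exists>b\<in>A. b \<notin> P \<and> (\<forall>Q\<in>Qs. b \<in> Q)" if "finite Qs" "Qs \<subseteq> Ps - {P}" for Qs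
        using that
      proof (induction Qs)
        case empty
        then show ?case using P less.prems by blast
      next
        case (insert Q Qs)
        then obtain b where b: "b \<in> A" "b \<notin> P" "\<forall>Q\<in>Qs. b \<in> Q" by auto
        have "\<not> A \<inter> Q \<subseteq> P"
        proof
          assume "A \<inter> Q \<subseteq> P"
          moreover have "Q \<in> Ps" "P \<noteq> Q" using insert.prems by auto
          ultimately show False using False P by meson
        qed
        then obtain c where c: "c \<in> A" "c \<in> Q" "c \<notin> P" by auto
        have "b \<in> R" "c \<in> R" using b c less.prems(3) by blast+
        then have "b * c \<notin> P" using pr b c by (auto simp: prime_idl_def)
        moreover have "b * c \<in> Q'" if "Q' \<in> insert Q Qs" for Q'
        proof -
          have "idl Q'" using that insert.prems less.prems by (auto simp: prime_idl_def)
          from that consider "Q' = Q" | "Q' \<in> Qs" by blast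
          then show ?thesis
            using idl_mult[OF \<open>idl Q'\<close> \<open>b \<in> R\<close>] idl_mult_right[OF \<open>idl Q'\<close> \<open>c \<in> R\<close>] b(3) c(2)
            by cases simp_all
        qed
        ultimately show ?case using A(2)[OF b(1) c(1)] by (intro bexI[of _ "b * c"]) simp_all
      qed
      from this[of "Ps - {P}"] obtain b
        where b: "b \<in> A" "b \<notin> P" "\<forall>Q\<in>Ps - {P}. b \<in> Q" using less.prems by auto
      show ?thesis
      proof (cases "a \<in> P")
        case False
        then show ?thesis using a by blast
      next
        case True
        have "a + b \<notin> Q" if "Q \<in> Ps" for Q
        proof -
          have "idl Q" using that less.prems by (auto simp: prime_idl_def)
          then show ?thesis
            using that a b True idl_diff[of Q "a + b" a] idl_diff[of Q "a + b" b] by (cases "Q = P") auto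
        qed
        then show ?thesis using A a b by blast
      qed
    qed
  qed
qed

text \<open>A member of \<open>ass_max L\<close> is the annihilator of a nonzero class, so it cannot
  contain \<open>A\<close> when \<open>torsion_free A L\<close> holds; avoiding the members for all
  \<open>L\<close> at once gives the common element.\<close>

lemma common_nzd:
  assumes Ls: "finite Ls" "\<And>L. L \<in> Ls \<Longrightarrow> idl L" "\<And>L. L \<in> Ls \<Longrightarrow> torsion_free A L"
    and A: "A \<subseteq> R" "set_closed A"
  shows "\<exists>a\<in>A. \<forall>L\<in>Ls. nzd L a"
proof -
  have "\<not> A \<subseteq> P" if "P \<in> ass_max L" "L \<in> Ls" for P L
  proof
    assume "A \<subseteq> P"
    from \<open>P \<in> ass_max L\<close> have "\<exists>g\<in>R - L. P = colon L g" unfolding ass_max_def by blast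
    then obtain g where g: "g \<in> R - L" "P = colon L g" by blast
    then have "\<forall>a\<in>A. a * g \<in> L" using \<open>A \<subseteq> P\<close> by (auto simp: colon_mem)
    then show False using Ls(3)[OF that(2)] g by (auto simp: torsion_free_def)
  qed
  then have "\<exists>a\<in>A. \<forall>P\<in>(\<Union>L\<in>Ls. ass_max L). a \<notin> P"
    by (intro prime_avoidance) (use Ls A ass_max_finite ass_max_prime in \<open>blast+\<close>)
  then obtain a where a: "a \<in> A" "\<And>L P. L \<in> Ls \<Longrightarrow> P \<in> ass_max L \<Longrightarrow> a \<notin> P" by blast
  have "z \<in> L" if z: "L \<in> Ls" "z \<in> R" "a * z \<in> L" for L z
  proof (rule ccontr)
    assume "z \<notin> L"
    then obtain P where "P \<in> ass_max L" "colon L z \<subseteq> P" using ass_max_cover[of L z] z Ls by blast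
    moreover have "a \<in> colon L z" using z a A by (auto simp: colon_mem)
    ultimately show False using a z by blast
  qed
  then show ?thesis using a by (auto simp: nzd_def)
qed

end

section \<open>Depth through regular sequences in a fixed ideal\<close>

locale noetherian_with_ideal = noetherian_subring +
  fixes M :: "'a set"
  assumes M: "idl M"
begin

lemma M_sub: "M \<subseteq> R" and M_closed: "set_closed M"
  using M by (auto simp: idl_def set_closed_def)

text \<open>The sequences are required to start from an ideal inside \<^term>\<open>M\<close>, so the quotient by all of
  their members never vanishes.\<close>

primrec depth_ge :: "nat \<Rightarrow> 'a set \<Rightarrow> bool"
  where
    "depth_ge 0 L \<longleftrightarrow> L \<subseteq> M"
  | "depth_ge (Suc r) L \<longleftrightarrow> (\<exists>f\<in>M. nzd L f \<and> depth_ge r (adj L f))"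

lemma depth_ge_torsion_free: "depth_ge (Suc r) L \<Longrightarrow> torsion_free M L"
  using torsion_free_of_nzd by auto

text \<open>Classes killed by \<open>M\<close> correspond in the two quotients: if all multiples of
  \<open>z\<close> by \<open>M\<close> lie in \<open>(L, g)\<close>, then
  \<open>f * z = g * w\<close> modulo \<open>L\<close> for some \<open>w\<close>, and
  \<open>w\<close> is killed by \<open>M\<close> modulo \<open>(L, f)\<close>. Both sides compute
  Ext^1(R/M, R/L).\<close>

lemma torsion_free_adj_swap:
  assumes L: "idl L" and f: "f \<in> M" "nzd L f" and g: "g \<in> M" "nzd L g"
    and tf: "torsion_free M (adj L f)"
  shows "torsion_free M (adj L g)"
  unfolding torsion_free_def
proof (intro ballI impI)
  fix z assume z: "z \<in> R" "\<forall>a\<in>M. a * z \<in> adj L g"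
  have fR: "f \<in> R" "g \<in> R" using f g M_sub by auto
  obtain l w where fz: "f * z = l + g * w" "l \<in> L" "w \<in> R" using z f by (auto simp: adj_def)
  have "a * w \<in> adj L f" if a: "a \<in> M" for a
  proof -
    have aR: "a \<in> R" using a M_sub by auto
    obtain k v where az: "a * z = k + g * v" "k \<in> L" "v \<in> R" using z a by (auto simp: adj_def)
    \<comment> \<open>After multiplication by \<open>g\<close> the product \<open>g * w\<close> can
      be replaced; \<open>g\<close> is then cancelled because it is regular modulo
      \<open>L\<close>.\<close>
    have "g * (a * w - f * v) = a * (f * z) - a * l - f * (a * z) + f * k"
      by (simp add: fz az algebra_simps)
    also have "\<dots> = f * k - a * l" by (simp add: algebra_simps)
    also have "\<dots> \<in> L" using L aR fR fz az by (auto intro!: idl_diff idl_mult)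
    finally have "a * w - f * v \<in> L" using g fz az aR fR by (auto simp: nzd_def mems)
    then show ?thesis unfolding adj_def using az
      by (intro CollectI exI[of _ "a * w - f * v"] exI[of _ v]) auto
  qed
  then have "w \<in> adj L f" using tf fz by (auto simp: torsion_free_def)
  then obtain k b where w: "w = k + f * b" "k \<in> L" "b \<in> R" by (auto simp: adj_def)
  have "f * (z - g * b) = l + g * k"
    using fz w by (simp add: algebra_simps)
  also have "\<dots> \<in> L" using L fR fz w by (auto intro!: idl_add idl_mult)
  finally have "z - g * b \<in> L" using f fR w z by (auto simp: nzd_def mems)
  then show "z \<in> adj L g" unfolding adj_def using w
    by (intro CollectI exI[of _ "z - g * b"] exI[of _ b]) auto
qed

text \<open>The half of the permutability of a regular sequence \<open>f, h\<close> that holds in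
  every ring; the other half, regularity of \<open>h\<close> on \<open>L\<close> itself, may
  fail.\<close>

lemma nzd_adj_swap:
  assumes L: "idl L" and f: "f \<in> R" "nzd L f" and h: "h \<in> R" "nzd (adj L f) h"
  shows "nzd (adj L h) f"
  unfolding nzd_def
proof (intro ballI impI)
  fix z assume z: "z \<in> R" "f * z \<in> adj L h"
  then obtain l w where fz: "f * z = l + h * w" "l \<in> L" "w \<in> R" by (auto simp: adj_def)
  have "h * w = - l + f * z" using fz by simp
  then have "h * w \<in> adj L f" unfolding adj_def using fz z L idl_diff[OF L idl_zero[OF L], of l] by force
  then have "w \<in> adj L f" using h fz by (auto simp: nzd_def)
  then obtain k b where w: "w = k + f * b" "k \<in> L" "b \<in> R" by (auto simp: adj_def)
  have "f * (z - h * b) = l + h * k"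
    using fz w by (simp add: algebra_simps)
  also have "\<dots> \<in> L" using L h fz w by (auto intro!: idl_add idl_mult)
  finally have "z - h * b \<in> L" using f h w z by (auto simp: nzd_def mems)
  then show "z \<in> adj L h" unfolding adj_def using w
    by (intro CollectI exI[of _ "z - h * b"] exI[of _ b]) auto
qed

text \<open>An \<open>h\<close> regular modulo \<open>L\<close>, \<open>(L, f)\<close> and
  \<open>(L, g)\<close> links the two sides. By induction the depth left after \<open>(L, f)\<close>
  may be measured with \<open>h\<close>; then \<open>f\<close> is exchanged for \<open>g\<close>
  modulo \<open>(L, h)\<close>, and the result is read as dividing \<open>(L, g)\<close> by
  \<open>h\<close>.\<close>

lemma depth_ge_adj_cong:
  assumes "idl L" "depth_ge r (adj L f)" "f \<in> M" "nzd L f" "g \<in> M" "nzd L g"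
  shows "depth_ge r (adj L g)"
  using assms
proof (induction r arbitrary: L f g)
  case 0
  have "L \<subseteq> M" using 0 subset_trans[OF adj_upper] by simp
  then show ?case using adj_least[OF M] 0 by simp
next
  case (Suc r)
  note L = \<open>idl L\<close>
  have fg: "f \<in> R" "g \<in> R" using Suc.prems M_sub by auto
  have tf: "torsion_free M (adj L f)" using Suc.prems(2) by (rule depth_ge_torsion_free)
  have tg: "torsion_free M (adj L g)"
    using torsion_free_adj_swap[OF L _ _ _ _ tf] Suc.prems by blast
  have tL: "torsion_free M L" using Suc.prems torsion_free_of_nzd by blast
  have "\<exists>h\<in>M. \<forall>K\<in>{L, adj L f, adj L g}. nzd K h"
    using tf tg tL L fg M_sub M_closed by (intro common_nzd) (auto intro: idl_adj)
  then obtain h where h: "h \<in> M" "nzd L h" "nzd (adj L f) h" "nzd (adj L g) h" by auto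
  have hR: "h \<in> R" using h M_sub by auto
  obtain h' where h': "h' \<in> M" "nzd (adj L f) h'" "depth_ge r (adj (adj L f) h')"
    using Suc.prems by auto
  have "depth_ge r (adj (adj L f) h)"
    using Suc.IH[of "adj L f" h' h] h h' idl_adj[OF L fg(1)] by blast
  then have "depth_ge r (adj (adj L h) f)" by (simp add: adj_commute)
  then have "depth_ge r (adj (adj L h) g)"
    using Suc.IH[of "adj L h" f g] idl_adj[OF L hR] nzd_adj_swap[OF L _ _ hR] fg h Suc.prems by blast
  then have "depth_ge r (adj (adj L g) h)" by (simp add: adj_commute)
  then show ?case using h by auto
qed

lemma depth_ge_adj:
  "idl L \<Longrightarrow> depth_ge (Suc r) L \<Longrightarrow> f \<in> M \<Longrightarrow> nzd L f \<Longrightarrow> depth_ge r (adj L f)"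
  using depth_ge_adj_cong by auto

lemma depth_ge_Suc: "depth_ge (Suc r) L \<Longrightarrow> depth_ge r L"
proof (induction r arbitrary: L)
  case 0
  then show ?case using subset_trans[OF adj_upper] by fastforce
qed auto

lemma depth_ge_mono: "depth_ge r L \<Longrightarrow> q \<le> r \<Longrightarrow> depth_ge q L"
  by (induction r) (auto simp: le_Suc_eq simp del: depth_ge.simps(2) dest: depth_ge_Suc)

text \<open>The depth lemma for \<open>0 \<rightarrow> R/(L : u) \<rightarrow> R/L \<rightarrow> R/(L, u) \<rightarrow> 0\<close>.\<close>

lemma depth_ge_colon_adj:
  assumes "idl L" "u \<in> R" "depth_ge r (colon L u)" "depth_ge r (adj L u)"
  shows "depth_ge r L"
  using assms
proof (induction r arbitrary: L)
  case 0
  then show ?case using subset_trans[OF adj_upper] by simp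
next
  case (Suc r)
  note L = \<open>idl L\<close> and u = \<open>u \<in> R\<close>
  have cu: "idl (colon L u)" "idl (adj L u)" using idl_colon idl_adj L u by auto
  have "\<exists>h\<in>M. \<forall>K\<in>{colon L u, adj L u}. nzd K h"
    using Suc.prems cu depth_ge_torsion_free M_sub M_closed by (intro common_nzd) blast+
  then obtain h where h: "h \<in> M" "nzd (colon L u) h" "nzd (adj L u) h" by auto
  have hR: "h \<in> R" using h M_sub by auto
  \<comment> \<open>A class killed by \<open>h\<close> vanishes modulo \<open>(L, u)\<close>, and
    the remaining cofactor \<open>w\<close> of \<open>u\<close> is killed by \<open>h\<close> modulo
    \<open>L : u\<close>.\<close>
  have hL: "nzd L h" unfolding nzd_def
  proof (intro ballI impI)
    fix z assume z: "z \<in> R" "h * z \<in> L"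
    then have "z \<in> adj L u" using h subsetD[OF adj_upper, of "h * z" L u] by (auto simp: nzd_def)
    then obtain l w where w: "z = l + u * w" "l \<in> L" "w \<in> R" by (auto simp: adj_def)
    have "(h * w) * u = h * z - h * l" by (simp add: w algebra_simps)
    also have "\<dots> \<in> L" using L z w hR by (auto intro!: idl_diff idl_mult)
    finally have "w \<in> colon L u" using h hR w by (auto simp: nzd_def colon_mem mult_mem)
    then show "z \<in> L" using w L by (auto simp: colon_mem mult.commute intro!: idl_add)
  qed
  \<comment> \<open>Regularity of \<open>h\<close> modulo \<open>(L, u)\<close> makes the colon by
    \<open>u\<close> commute with adjoining \<open>h\<close>, so the exact sequence survives
    division by \<open>h\<close>.\<close>
  have col: "colon (adj L h) u = adj (colon L u) h"
  proof
    show "adj (colon L u) h \<subseteq> colon (adj L h) u"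
    proof
      fix p assume "p \<in> adj (colon L u) h"
      then obtain c r where p: "p = c + h * r" "c \<in> R" "c * u \<in> L" "r \<in> R"
        by (auto simp: adj_def colon_mem)
      have "p * u = c * u + h * (r * u)" by (simp add: p algebra_simps)
      then have "p * u \<in> adj L h" unfolding adj_def using p u mult_mem by blast
      then show "p \<in> colon (adj L h) u" using p hR by (auto simp: colon_mem mems)
    qed
    show "colon (adj L h) u \<subseteq> adj (colon L u) h"
    proof
      fix p assume "p \<in> colon (adj L h) u"
      then obtain l r where p: "p \<in> R" "p * u = l + h * r" "l \<in> L" "r \<in> R"
        by (auto simp: adj_def colon_mem)
      have "h * r = - l + u * p" using p by (simp add: algebra_simps)
      moreover have "- l \<in> L" using p idl_diff[OF L idl_zero[OF L], of l] by simp
      ultimately have "h * r \<in> adj L u" unfolding adj_def using p by blast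
      then have "r \<in> adj L u" using h p by (auto simp: nzd_def)
      then obtain k s where r: "r = k + u * s" "k \<in> L" "s \<in> R" by (auto simp: adj_def)
      have "(p - h * s) * u = l + h * k" using p by (simp add: r algebra_simps)
      also have "\<dots> \<in> L" using p r L hR by (auto intro!: idl_add idl_mult)
      finally have "p - h * s \<in> colon L u" using p r hR by (auto simp: colon_mem mems)
      then show "p \<in> adj (colon L u) h" unfolding adj_def using r
        by (intro CollectI exI[of _ "p - h * s"] exI[of _ s]) auto
    qed
  qed
  have "depth_ge r (colon (adj L h) u)"
    unfolding col using depth_ge_adj[OF cu(1)] Suc.prems h by blast
  moreover have "depth_ge r (adj (adj L h) u)"
    unfolding adj_commute[of L h u] using depth_ge_adj[OF cu(2)] Suc.prems h by blast
  ultimately have "depth_ge r (adj L h)" using Suc.IH[of "adj L h"] idl_adj[OF L hR] u by blast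
  then show ?case using h hL by auto
qed

end

section \<open>Exponent vectors and sums of monomials\<close>

abbreviation "lookup \<equiv> Poly_Mapping.lookup"
abbreviation "keys \<equiv> Poly_Mapping.keys"

lemma poly_mapping_sum_singles: "p = (\<Sum>u\<in>keys p. Poly_Mapping.single u (Poly_Mapping.lookup p u))"
proof (rule poly_mapping_eqI)
  fix v
  have "(\<Sum>u\<in>keys p. lookup (Poly_Mapping.single u (lookup p u)) v)
      = (\<Sum>u\<in>keys p. if u = v then lookup p v else 0)"
    by (intro sum.cong) (auto simp: lookup_single)
  then show "lookup p v = lookup (\<Sum>u\<in>keys p. Poly_Mapping.single u (lookup p u)) v"
    by (simp add: lookup_sum in_keys_iff)
qed

lemma poly_mapping_induct [case_names single add]:
  fixes p :: "'a \<Rightarrow>\<^sub>0 'b::comm_monoid_add"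
  assumes "\<And>u c. P (Poly_Mapping.single u c)" "\<And>p q. P p \<Longrightarrow> P q \<Longrightarrow> P (p + q)"
  shows "P p"
proof -
  have "P (\<Sum>u\<in>A. Poly_Mapping.single u (lookup p u))" if "finite A" for A
    using that
  proof (induction A)
    case empty
    then show ?case using assms(1)[of _ 0] by simp
  qed (use assms in simp)
  then show ?thesis using poly_mapping_sum_singles[of p] by (metis finite_keys)
qed

lemma lookup_single_mult_add:
  fixes p :: "'k::field mpoly"
  shows "lookup (Poly_Mapping.single w c * p) (w + u) = c * lookup p u"
  by (induction p rule: poly_mapping_induct)
     (auto simp: mult_single lookup_single lookup_add distrib_left when_def)

lemma keys_single_mult:
  fixes p :: "'k::field mpoly"
  shows "keys (Poly_Mapping.single w c * p) \<subseteq> (+) w ` keys p"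
  using keys_mult[of "Poly_Mapping.single w c" p] by (auto split: if_splits)

lemma keys_add_nat: "keys (u + v) = keys u \<union> keys (v :: monom)"
  by (auto simp: in_keys_iff lookup_add)

lemma monom_keys_empty: "keys u = {} \<longleftrightarrow> u = (0 :: monom)"
  by (auto simp: poly_mapping_eq_iff fun_eq_iff in_keys_iff)

lemma monom_diff_add:
  fixes u v :: monom
  assumes "\<And>x. lookup u x \<le> lookup v x"
  shows "u + (v - u) = v"
  by (rule poly_mapping_eqI) (simp add: lookup_add lookup_minus assms)

section \<open>Noetherianity\<close>

lemma mono_subseq_nat:
  fixes f :: "nat \<Rightarrow> nat"
  shows "\<exists>\<phi> :: nat \<Rightarrow> nat. strict_mono \<phi> \<and> (\<forall>i j. i \<le> j \<longrightarrow> f (\<phi> i) \<le> f (\<phi> j))"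
proof -
  have ex: "\<exists>m\<ge>k. \<forall>l\<ge>k. f m \<le> f l" for k
    using ex_has_least_nat[of "\<lambda>m. k \<le> m" k f] by auto
  have "\<exists>\<phi>. \<forall>i. (\<forall>l\<ge>\<phi> i. f (\<phi> i) \<le> f l) \<and> \<phi> i < \<phi> (Suc i)"
  proof (rule dependent_nat_choice)
    show "\<exists>m. \<forall>l\<ge>m. f m \<le> f l" using ex[of 0] by auto
    show "\<exists>m. (\<forall>l\<ge>m. f m \<le> f l) \<and> k < m" for k
      using ex[of "Suc k"] by (metis Suc_le_lessD order_trans)
  qed
  then obtain \<phi> where \<phi>: "\<And>i l. l \<ge> \<phi> i \<Longrightarrow> f (\<phi> i) \<le> f l" "\<And>i. \<phi> i < \<phi> (Suc i)" by blast
  then have "strict_mono \<phi>" by (simp add: strict_mono_Suc_iff)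
  then show ?thesis using \<phi> by (intro exI[of _ \<phi>] conjI allI impI) (auto simp: strict_mono_less_eq)
qed

lemma dickson_subseq:
  fixes u :: "nat \<Rightarrow> monom"
  assumes "finite V"
  shows "\<exists>\<phi> :: nat \<Rightarrow> nat. strict_mono \<phi> \<and> (\<forall>x\<in>V. \<forall>i j. i \<le> j \<longrightarrow> lookup (u (\<phi> i)) x \<le> lookup (u (\<phi> j)) x)"
  using assms
proof (induction V)
  case empty
  then show ?case by (intro exI[of _ id]) (auto simp: strict_mono_def)
next
  case (insert x V)
  then obtain \<phi> :: "nat \<Rightarrow> nat" where \<phi>: "strict_mono \<phi>"
    "\<And>y i j. y \<in> V \<Longrightarrow> i \<le> j \<Longrightarrow> lookup (u (\<phi> i)) y \<le> lookup (u (\<phi> j)) y" by blast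
  obtain \<psi> :: "nat \<Rightarrow> nat" where \<psi>: "strict_mono \<psi>"
    "\<And>i j. i \<le> j \<Longrightarrow> lookup (u (\<phi> (\<psi> i))) x \<le> lookup (u (\<phi> (\<psi> j))) x"
    using mono_subseq_nat[of "\<lambda>i. lookup (u (\<phi> i)) x"] by blast
  have "strict_mono (\<phi> \<circ> \<psi>)" using \<phi>(1) \<psi>(1) by (rule strict_mono_o)
  moreover have "lookup (u ((\<phi> \<circ> \<psi>) i)) y \<le> lookup (u ((\<phi> \<circ> \<psi>) j)) y"
    if "y \<in> insert x V" "i \<le> j" for y i j
    using that \<phi>(2)[of y "\<psi> i" "\<psi> j"] \<psi> by (auto simp: strict_mono_less_eq)
  ultimately show ?case by blast
qed

lemma dickson:
  fixes u :: "nat \<Rightarrow> monom"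
  assumes "finite V" "\<And>i. keys (u i) \<subseteq> V"
  shows "\<exists>i j. i < j \<and> (\<forall>x. lookup (u i) x \<le> lookup (u j) x)"
proof -
  obtain \<phi> :: "nat \<Rightarrow> nat" where \<phi>: "strict_mono \<phi>"
    "\<And>x i j. x \<in> V \<Longrightarrow> i \<le> j \<Longrightarrow> lookup (u (\<phi> i)) x \<le> lookup (u (\<phi> j)) x"
    using dickson_subseq[OF assms(1), of u] by meson
  have "lookup (u (\<phi> 0)) x \<le> lookup (u (\<phi> 1)) x" for x
  proof (cases "x \<in> V")
    case False
    then have "lookup (u (\<phi> 0)) x = 0" using assms(2)[of "\<phi> 0"] by (auto simp: in_keys_iff)
    then show ?thesis by simp
  qed (use \<phi>(2) in simp)
  moreover have "\<phi> 0 < \<phi> 1" using \<phi>(1) by (simp add: strict_mono_def)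
  ultimately show ?thesis by blast
qed

text \<open>The order of \<open>monom\<close> is lexicographic, the smallest index deciding. Being
  linear and translation invariant, it is a monomial order up to well-foundedness.\<close>

lemma monom_nonneg: "0 \<le> (w :: monom)"
  unfolding not_less[symmetric] by (transfer) (auto simp: less_fun_def)

lemma monom_le: "(\<And>x. lookup u x \<le> lookup v x) \<Longrightarrow> u \<le> (v :: monom)"
  using add_left_mono[OF monom_nonneg[of "v - u"], of u] monom_diff_add[of u v] by simp

lemma monom_add_eq_0: "u + v = 0 \<longleftrightarrow> u = 0 \<and> v = (0 :: monom)"
  using keys_add_nat[of u v] by (metis Un_empty keys_zero monom_keys_empty)

text \<open>Over all variables the chain \<open>x_1 > x_2 > ...\<close> descends forever. In a
  finite set of variables Dickson's lemma finds an earlier member of the chain that divides a later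
  one, against the descent.\<close>

lemma wf_monoms:
  assumes "finite V"
  shows "wf {(u :: monom, v). keys u \<subseteq> V \<and> keys v \<subseteq> V \<and> u < v}"
  unfolding wf_iff_no_infinite_down_chain
proof
  assume "\<exists>s. \<forall>i. (s (Suc i), s i) \<in> {(u :: monom, v). keys u \<subseteq> V \<and> keys v \<subseteq> V \<and> u < v}"
  then obtain s :: "nat \<Rightarrow> monom" where s: "\<And>i. keys (s i) \<subseteq> V" "\<And>i. s (Suc i) < s i" by auto
  obtain i j where ij: "i < j" "\<And>x. lookup (s i) x \<le> lookup (s j) x"
    using dickson[of V s] s(1) assms by auto
  have "s j < s i" using \<open>i < j\<close>
  proof (induction j)
    case (Suc j)
    then show ?case using s(2)[of j] by (cases "i = j") auto
  qed simp
  moreover have "s i \<le> s j" using ij(2) by (rule monom_le)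
  ultimately show False by simp
qed

lemma subring_mpolys: "subring_carrier (mpolys V :: 'k::field mpoly set)"
proof
  show "a - b \<in> mpolys V" if "a \<in> mpolys V" "b \<in> mpolys V" for a b :: "'k mpoly"
    using add_in_mpolys[OF that(1) uminus_in_mpolys[OF that(2)]] by simp
qed (simp_all add: one_in_mpolys mult_in_mpolys)

text \<open>Absence of a constant term is easier to test than membership in the ideal generated by
  the variables; the two are identified in \<open>genideal_vars\<close>.\<close>

definition mmax :: "nat set \<Rightarrow> 'k::field mpoly set"
  where "mmax V = {p \<in> mpolys V. lookup p 0 = 0}"

lemma lookup_mult_0:
  fixes p q :: "'k::field mpoly"
  shows "lookup (p * q) 0 = lookup p 0 * lookup q 0"
proof (induction p rule: poly_mapping_induct)
  case (single u c)
  show ?case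
  proof (induction q rule: poly_mapping_induct)
    case (single v d)
    then show ?case by (auto simp: mult_single lookup_single when_def monom_add_eq_0)
  qed (simp add: distrib_left lookup_add)
qed (simp add: distrib_right lookup_add)

text \<open>In a strictly ascending chain, pick \<open>p i\<close> in \<open>F (Suc i) - F i\<close>
  with minimal leading monomial. By Dickson's lemma the leading monomial of some \<open>p i\<close>
  divides that of a \<open>p j\<close> with \<open>i < j\<close>. Cancelling it with a multiple of
  \<open>p i\<close>, which lies in \<open>F j\<close>, leaves an element of
  \<open>F (Suc j) - F j\<close> with smaller leading monomial.\<close>

lemma noetherian_mpolys:
  assumes "finite V"
  shows "noetherian_with_ideal (mpolys V) (mmax V :: 'k::field mpoly set)"
proof -
  interpret subring_carrier "mpolys V :: 'k mpoly set" by (rule subring_mpolys)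
  have "\<exists>i. \<not> F i \<subset> F (Suc i)" if F: "\<And>i::nat. idl (F i)" for F
  proof (rule ccontr)
    assume "\<nexists>i. \<not> F i \<subset> F (Suc i)"
    then have strict: "F i \<subset> F (Suc i)" for i by blast
    have mono: "F i \<subseteq> F j" if "i \<le> j" for i j
      using strict that by (intro lift_Suc_mono_le[of F, OF psubset_imp_subset])
    define lead :: "'k mpoly \<Rightarrow> monom" where "lead p = Max (keys p)" for p
    have lead_in: "lead p \<in> keys p" if "p \<noteq> 0" for p
      unfolding lead_def using that by (intro Max_in) auto
    have "\<exists>p\<in>F (Suc i) - F i. \<forall>q\<in>F (Suc i) - F i. \<not> lead q < lead p" for i
    proof -
      have keysV: "keys (lead p) \<subseteq> V" if "p \<in> F (Suc i) - F i" for p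
      proof -
        have "p \<noteq> 0" using that idl_zero[OF F] by auto
        moreover have "p \<in> mpolys V" using that idl_sub[OF F] by auto
        ultimately show ?thesis using lead_in unfolding mpolys_def by blast
      qed
      let ?W = "{(u :: monom, v). keys u \<subseteq> V \<and> keys v \<subseteq> V \<and> u < v}"
      obtain p0 where "p0 \<in> F (Suc i) - F i" using strict[of i] by blast
      with wf_inv_image[OF wf_monoms[OF assms], of lead]
      have "\<exists>p\<in>F (Suc i) - F i. \<forall>q. (q, p) \<in> inv_image ?W lead \<longrightarrow> q \<notin> F (Suc i) - F i"
        by (rule wfE_min) blast
      then obtain p where p: "p \<in> F (Suc i) - F i"
        "\<And>q. (q, p) \<in> inv_image ?W lead \<Longrightarrow> q \<notin> F (Suc i) - F i"
        by blast
      have "\<not> lead q < lead p" if "q \<in> F (Suc i) - F i" for q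
        using p(2)[of q] keysV[OF that] keysV[OF p(1)] that by (auto simp: inv_image_def)
      then show ?thesis using p(1) by blast
    qed
    then have "\<forall>i. \<exists>p. p \<in> F (Suc i) - F i \<and> (\<forall>q\<in>F (Suc i) - F i. \<not> lead q < lead p)" by blast
    from choice[OF this] obtain p where p: "\<And>i. p i \<in> F (Suc i) - F i"
      "\<And>i q. q \<in> F (Suc i) - F i \<Longrightarrow> \<not> lead q < lead (p i)" by blast
    have p0: "p i \<noteq> 0" for i using p(1)[of i] idl_zero[OF F] by auto
    have pV: "p i \<in> mpolys V" for i using p(1)[of i] idl_sub[OF F] by auto
    have keysV: "keys (lead (p i)) \<subseteq> V" for i
      using pV[of i] lead_in[OF p0[of i]] unfolding mpolys_def by blast
    obtain i j where ij: "i < j" "\<And>x. lookup (lead (p i)) x \<le> lookup (lead (p j)) x"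
      using dickson[of V "\<lambda>i. lead (p i)"] keysV assms by auto
    define w where "w = lead (p j) - lead (p i)"
    define c where "c = lookup (p j) (lead (p j)) / lookup (p i) (lead (p i))"
    have w: "lead (p j) = w + lead (p i)" unfolding w_def
      using monom_diff_add[of "lead (p i)" "lead (p j)"] ij(2) by (simp add: add.commute)
    define r where "r = Poly_Mapping.single w c * p i"
    define q where "q = p j - r"
    have "keys w \<subseteq> V" using keysV[of j] by (simp add: w keys_add_nat)
    then have "Poly_Mapping.single w c \<in> mpolys V" by (simp add: mpolys_def)
    then have "r \<in> F (Suc i)" unfolding r_def using p(1)[of i] idl_mult[OF F] by blast
    then have r: "r \<in> F j" using mono[of "Suc i" j] ij(1) by auto
    have q: "q \<in> F (Suc j) - F j"
      using p(1)[of j] r mono[of j "Suc j"] idl_diff[OF F, of "p j" "Suc j" r] idl_add[OF F, of q j r]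
      by (auto simp: q_def)
    then have q0: "q \<noteq> 0" using idl_zero[OF F] by auto
    have lc: "lookup (p i) (lead (p i)) \<noteq> 0" using lead_in[OF p0[of i]] by (simp add: in_keys_iff)
    have "lookup r (lead (p j)) = lookup (p j) (lead (p j))"
      unfolding r_def using lc by (subst w) (simp add: lookup_single_mult_add c_def)
    then have "lead (p j) \<notin> keys q" by (simp add: q_def in_keys_iff lookup_minus)
    then have ne: "lead q \<noteq> lead (p j)" using lead_in[OF q0] by auto
    have "u \<le> lead (p j)" if "u \<in> keys q" for u
    proof -
      have "u \<in> keys (p j) \<or> u \<in> keys r"
        using that by (auto simp: q_def in_keys_iff lookup_minus)
      then show ?thesis
      proof
        assume "u \<in> keys r"
        then obtain v where v: "u = w + v" "v \<in> keys (p i)"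
          unfolding r_def using keys_single_mult by blast
        then have "v \<le> lead (p i)" by (simp add: lead_def)
        then show ?thesis using v by (simp add: w add_left_mono)
      qed (simp add: lead_def)
    qed
    then have "lead q \<le> lead (p j)" using lead_in[OF q0] by blast
    then show False using p(2)[OF q] ne by simp
  qed
  moreover have "idl (mmax V)"
    by (auto simp: idl_def mmax_def lookup_add lookup_mult_0 mems)
  ultimately show ?thesis by unfold_locales blast+
qed

section \<open>Expansion along one variable\<close>

abbreviation xpow :: "nat \<Rightarrow> nat \<Rightarrow> 'k::field mpoly"
  where "xpow x j \<equiv> of_monom (Poly_Mapping.single x j)"

text \<open>The test on \<open>lookup u x\<close> makes the coefficient free of \<open>x\<close>;
  for such \<open>u\<close> the monomial read off has degree exactly \<open>j\<close> in
  \<open>x\<close>.\<close>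

lift_definition coef :: "nat \<Rightarrow> nat \<Rightarrow> 'k::field mpoly \<Rightarrow> 'k mpoly"
  is "\<lambda>x j p u. if Poly_Mapping.lookup u x = 0 then p (u + Poly_Mapping.single x j) else 0"
proof -
  fix x j :: nat and p :: "monom \<Rightarrow> 'k" assume *: "finite {u. p u \<noteq> 0}"
  have "finite ((\<lambda>u. u + Poly_Mapping.single x j) -` {u. p u \<noteq> 0})"
    using * by (intro finite_vimageI) (auto simp: inj_def)
  then show "finite {u. (if lookup u x = 0 then p (u + Poly_Mapping.single x j) else 0) \<noteq> 0}"
    by (rule rev_finite_subset) (auto split: if_splits)
qed

lemma coef_zero [simp]: "coef x j 0 = 0"
  by (rule poly_mapping_eqI) (simp add: coef.rep_eq)

lemma coef_add: "coef x j (p + q) = coef x j p + coef x j q"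
  by (rule poly_mapping_eqI) (simp add: coef.rep_eq lookup_add)

lemma coef_diff: "coef x j (p - q) = coef x j p - coef x j q"
  by (rule poly_mapping_eqI) (simp add: coef.rep_eq lookup_minus)

lemma coef_sum: "coef x j (sum f A) = (\<Sum>a\<in>A. coef x j (f a))"
  by (induction A rule: infinite_finite_induct) (auto simp: coef_add)

lemma monom_split: "u = (u - Poly_Mapping.single x (lookup u x)) + Poly_Mapping.single x (lookup (u :: monom) x)"
  by (rule poly_mapping_eqI) (auto simp: lookup_add lookup_minus lookup_single when_def)

lemma keys_minus_single: "keys (u - Poly_Mapping.single x (lookup u x)) = keys (u :: monom) - {x}"
  by (auto simp: in_keys_iff lookup_minus lookup_single when_def split: if_splits)

lemma coef_single:
  "coef x j (Poly_Mapping.single u c) =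
    (if lookup u x = j then Poly_Mapping.single (u - Poly_Mapping.single x j) c else 0)"
proof (rule poly_mapping_eqI)
  fix v
  have "lookup v x = 0 \<and> v + Poly_Mapping.single x j = u \<longleftrightarrow> lookup u x = j \<and> u - Poly_Mapping.single x j = v"
    by (auto simp: poly_mapping_eq_iff fun_eq_iff lookup_add lookup_minus lookup_single when_def split: if_splits)
  then show "lookup (coef x j (Poly_Mapping.single u c)) v =
    lookup (if lookup u x = j then Poly_Mapping.single (u - Poly_Mapping.single x j) c else 0) v"
    by (auto simp: coef.rep_eq lookup_single when_def split: if_splits)
qed

lemma poly_mapping_sum_induct [consumes 1, case_names zero single add]:
  fixes p :: "'a \<Rightarrow>\<^sub>0 'b::comm_monoid_add"
  assumes "keys p \<subseteq> A" and "P 0"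
    "\<And>u c. u \<in> A \<Longrightarrow> P (Poly_Mapping.single u c)" "\<And>p q. P p \<Longrightarrow> P q \<Longrightarrow> P (p + q)"
  shows "P p"
proof -
  have "P (\<Sum>u\<in>B. Poly_Mapping.single u (lookup p u))" if "finite B" "B \<subseteq> A" for B
    using that by (induction B) (use assms in auto)
  then show ?thesis using poly_mapping_sum_singles[of p] assms(1) by (metis finite_keys)
qed

lemma mpolys_induct [consumes 1, case_names zero single add]:
  assumes "p \<in> mpolys V" "P 0" "\<And>u c. keys u \<subseteq> V \<Longrightarrow> P (Poly_Mapping.single u c)"
    "\<And>p q. P p \<Longrightarrow> P q \<Longrightarrow> P (p + q)"
  shows "P p"
  using assms by (intro poly_mapping_sum_induct[of p "{u. keys u \<subseteq> V}" P]) (auto simp: mpolys_def)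

lemma coef_mult:
  assumes "a \<in> mpolys V" "x \<notin> V"
  shows "coef x j (a * p) = a * coef x j p"
  using assms(1)
proof (induction a rule: mpolys_induct)
  case (single u c)
  have ux: "lookup u x = 0" using single assms(2) by (auto simp: in_keys_iff)
  show ?case
  proof (induction p rule: poly_mapping_induct)
    case (single v d)
    have "lookup v x = j \<Longrightarrow> u + v - Poly_Mapping.single x j = u + (v - Poly_Mapping.single x j)"
      using ux by (auto simp: poly_mapping_eq_iff fun_eq_iff lookup_add lookup_minus lookup_single when_def)
    then show ?case using ux by (auto simp: mult_single coef_single lookup_add)
  qed (simp add: distrib_left coef_add)
qed (simp_all add: distrib_right coef_add)

lemma coef_xpow_mult:
  "coef x i (xpow x j * p) = (if j \<le> i then coef x (i - j) p else 0)"
proof (induction p rule: poly_mapping_induct)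
  case (single u c)
  have "Poly_Mapping.single x j + u - Poly_Mapping.single x (j + k) = u - Poly_Mapping.single x k" for k
    by (auto simp: poly_mapping_eq_iff fun_eq_iff lookup_add lookup_minus lookup_single when_def)
  moreover have "j + lookup u x = i \<longleftrightarrow> j \<le> i \<and> lookup u x = i - j" by auto
  ultimately show ?case
    by (auto simp: of_monom_def mult_single coef_single lookup_add)
qed (auto simp: distrib_left coef_add)

lemma coef_mpolys:
  assumes "r \<in> mpolys V" "x \<notin> V"
  shows "coef x i r = (if i = 0 then r else 0)"
  using assms(1)
proof (induction r rule: mpolys_induct)
  case (single u c)
  then have "lookup u x = 0" using assms(2) by (auto simp: in_keys_iff)
  then show ?case by (auto simp: coef_single)
qed (auto simp: coef_add)

lemma coef_in:
  assumes "p \<in> mpolys (insert x V)"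
  shows "coef x j p \<in> mpolys V"
  unfolding mpolys_def
proof (intro CollectI ballI)
  fix u assume "u \<in> keys (coef x j p)"
  then have u: "lookup u x = 0" "u + Poly_Mapping.single x j \<in> keys p"
    by (auto simp: in_keys_iff coef.rep_eq split: if_splits)
  then have "keys (u + Poly_Mapping.single x j) \<subseteq> insert x V" using assms by (auto simp: mpolys_def)
  then show "keys u \<subseteq> V" using u(1) by (auto simp: keys_add_nat in_keys_iff)
qed

lemma coef_eqI:
  assumes "\<And>j. coef x j p = coef x j q"
  shows "p = q"
proof (rule poly_mapping_eqI)
  fix u :: monom
  let ?v = "u - Poly_Mapping.single x (lookup u x)"
  have "lookup ?v x = 0" by (simp add: lookup_minus)
  then have "lookup r u = lookup (coef x (lookup u x) r) ?v" for r
    using monom_split[of u x] by (simp add: coef.rep_eq)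
  then show "lookup p u = lookup q u" using assms by metis
qed

lemma coef_bounded: "\<exists>N. \<forall>j\<ge>N. coef x j p = 0"
proof (induction p rule: poly_mapping_induct)
  case (single u c)
  then show ?case by (intro exI[of _ "Suc (lookup u x)"]) (auto simp: coef_single)
next
  case (add p q)
  then obtain M N where "\<forall>j\<ge>M. coef x j p = 0" "\<forall>j\<ge>N. coef x j q = 0" by blast
  then show ?case by (intro exI[of _ "max M N"]) (auto simp: coef_add)
qed

lemma mpolys_mono: "V \<subseteq> W \<Longrightarrow> mpolys V \<subseteq> mpolys W"
  by (auto simp: mpolys_def)

lemma xpow_in: "x \<in> V \<Longrightarrow> xpow x j \<in> mpolys V"
  by (intro of_monom_in_mpolys) (auto split: if_splits)

lemma coef_assemble:
  assumes r: "\<And>j. r j \<in> mpolys V" and x: "x \<notin> V" and N: "\<And>j. j \<ge> N \<Longrightarrow> r j = 0"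
  shows "\<exists>b\<in>mpolys (insert x V). \<forall>j. coef x j b = r j"
proof
  let ?b = "\<Sum>j<N. xpow x j * r j"
  have "xpow x j * r j \<in> mpolys (insert x V)" for j
    using r mpolys_mono[of V "insert x V"] by (intro mult_in_mpolys xpow_in) auto
  then have "(\<Sum>j<n. xpow x j * r j) \<in> mpolys (insert x V)" for n
    by (induction n) (auto simp: zero_in_mpolys intro: add_in_mpolys)
  then show "?b \<in> mpolys (insert x V)" .
  have *: "coef x i (xpow x j * r j) = (if j = i then r i else 0)" for i j
    using coef_mpolys[OF r x] by (auto simp: coef_xpow_mult)
  show "\<forall>j. coef x j ?b = r j"
    using N by (auto simp: coef_sum * not_less)
qed

text \<open>The sum of the sets \<open>x^j F j\<close>. For an ascending sequence of ideals this is
  the ideal homogeneous in \<open>x\<close> with these coefficient ideals.\<close>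

definition graded :: "nat \<Rightarrow> nat set \<Rightarrow> (nat \<Rightarrow> 'k::field mpoly set) \<Rightarrow> 'k mpoly set"
  where "graded x V F = {p \<in> mpolys (insert x V). \<forall>j. coef x j p \<in> F j}"

lemma graded_coef: "p \<in> graded x V F \<Longrightarrow> coef x j p \<in> F j"
  by (simp add: graded_def)

abbreviation "pidl V \<equiv> subring_carrier.idl (mpolys V)"
abbreviation "padj V \<equiv> subring_carrier.adj (mpolys V)"
abbreviation "pcolon V \<equiv> subring_carrier.colon (mpolys V)"
abbreviation "pnzd V \<equiv> subring_carrier.nzd (mpolys V)"
abbreviation "ptf V \<equiv> subring_carrier.torsion_free (mpolys V)"
abbreviation "pdepth V \<equiv> noetherian_with_ideal.depth_ge (mpolys V) (mmax V)"

text \<open>\<open>F j\<close> is the ideal of coefficients of \<open>x\<^sup>j\<close>.\<close>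

locale graded_ideal =
  fixes x :: nat and V :: "nat set" and F :: "nat \<Rightarrow> 'k::field mpoly set"
  assumes finV: "finite V" and xV: "x \<notin> V"
    and idlF: "\<And>j. pidl V (F j)" and Fmono: "\<And>j. F j \<subseteq> F (Suc j)"
begin

sublocale A: noetherian_with_ideal "mpolys V :: 'k mpoly set" "mmax V"
  by (rule noetherian_mpolys[OF finV])

sublocale B: noetherian_with_ideal "mpolys (insert x V) :: 'k mpoly set" "mmax (insert x V)"
  by (rule noetherian_mpolys) (simp add: finV)

lemma V_sub: "mpolys V \<subseteq> (mpolys (insert x V) :: 'k mpoly set)"
  by (rule mpolys_mono) auto

lemma F_le: "i \<le> j \<Longrightarrow> F i \<subseteq> F j"
  using Fmono by (rule lift_Suc_mono_le)

lemma coef_mult': "a \<in> mpolys V \<Longrightarrow> coef x j (a * p) = a * coef x j p"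
  using coef_mult xV by blast

lemma decompose:
  assumes "p \<in> mpolys (insert x V)"
  shows "\<exists>q\<in>mpolys (insert x V). p = coef x 0 p + xpow x 1 * q"
proof -
  obtain N where N: "\<forall>j\<ge>N. coef x j p = 0" using coef_bounded by blast
  obtain q where q: "q \<in> mpolys (insert x V)" "\<And>j. coef x j q = coef x (Suc j) p"
    using coef_assemble[of "\<lambda>j. coef x (Suc j) p" V x N] coef_in[OF assms] xV N by auto
  have "p = coef x 0 p + xpow x 1 * q"
  proof (rule coef_eqI)
    show "coef x j p = coef x j (coef x 0 p + xpow x 1 * q)" for j
      using coef_mpolys[OF coef_in[OF assms] xV]
      by (cases j) (auto simp: coef_add coef_xpow_mult q)
  qed
  then show ?thesis using q by blast
qed

lemma idl_graded: "B.idl (graded x V F)"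
  unfolding B.idl_def
proof (intro conjI ballI)
  fix r p :: "'k mpoly" assume r: "r \<in> mpolys (insert x V)" and p: "p \<in> graded x V F"
  show "r * p \<in> graded x V F"
    using r
  proof (induction r rule: mpolys_induct)
    case zero
    then show ?case using A.idl_zero[OF idlF] by (auto simp: graded_def zero_in_mpolys)
  next
    case (single u c)
    let ?v = "u - Poly_Mapping.single x (lookup u x)"
    have "keys ?v \<subseteq> V" using single by (auto simp: keys_minus_single)
    then have v: "Poly_Mapping.single ?v c \<in> mpolys V" by (simp add: mpolys_def)
    \<comment> \<open>Splitting off the power of \<open>x\<close>: it shifts degrees upwards, and
      the shifted coefficients remain admissible because \<open>F\<close> ascends.\<close>
    have "Poly_Mapping.single u c = Poly_Mapping.single ?v c * xpow x (lookup u x)"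
      using monom_split[of u x] by (simp add: of_monom_def mult_single)
    then have "coef x j (Poly_Mapping.single u c * p) \<in> F j" for j
      using p v F_le[of "j - lookup u x" j] A.idl_zero[OF idlF]
      by (auto simp: mult.assoc coef_mult' coef_xpow_mult intro!: A.idl_mult[OF idlF] dest: graded_coef)
    moreover have "Poly_Mapping.single u c \<in> mpolys (insert x V)" using single by (simp add: mpolys_def)
    ultimately show ?case using p by (auto simp: graded_def mult_in_mpolys)
  next
    case (add a b)
    then show ?case using A.idl_add[OF idlF] by (auto simp: graded_def distrib_right coef_add add_in_mpolys)
  qed
qed (use A.idl_zero[OF idlF] A.idl_add[OF idlF] in \<open>auto simp: graded_def coef_add B.mems\<close>)

lemma graded_adj:
  assumes f: "f \<in> mpolys V"
  shows "B.adj (graded x V F) f = graded x V (\<lambda>j. A.adj (F j) f)"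
proof
  show "B.adj (graded x V F) f \<subseteq> graded x V (\<lambda>j. A.adj (F j) f)"
  proof
    fix p assume "p \<in> B.adj (graded x V F) f"
    then obtain a r where p: "p = a + f * r" "a \<in> graded x V F" "r \<in> mpolys (insert x V)"
      by (auto simp: B.adj_def)
    then have "coef x j p \<in> A.adj (F j) f" for j
      unfolding A.adj_def using f
      by (intro CollectI exI[of _ "coef x j a"] exI[of _ "coef x j r"])
        (auto simp: coef_add coef_mult' graded_coef coef_in)
    moreover have "p \<in> mpolys (insert x V)" using p f V_sub by (auto simp: graded_def intro!: B.mems)
    ultimately show "p \<in> graded x V (\<lambda>j. A.adj (F j) f)" by (simp add: graded_def)
  qed
  show "graded x V (\<lambda>j. A.adj (F j) f) \<subseteq> B.adj (graded x V F) f"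
  proof
    fix p assume p: "p \<in> graded x V (\<lambda>j. A.adj (F j) f)"
    \<comment> \<open>Taking \<open>r = 0\<close> at vanishing coefficients keeps almost all choices
      zero, so that they assemble to one polynomial.\<close>
    have "\<exists>r\<in>mpolys V. coef x j p - f * r \<in> F j \<and> (coef x j p = 0 \<longrightarrow> r = 0)" for j
    proof (cases "coef x j p = 0")
      case True
      then show ?thesis using zero_in_mpolys A.idl_zero[OF idlF] by (intro bexI[of _ 0]) auto
    next
      case False
      obtain a r where "coef x j p = a + f * r" "a \<in> F j" "r \<in> mpolys V"
        using graded_coef[OF p, of j] by (auto simp: A.adj_def)
      then show ?thesis using False by (intro bexI[of _ r]) auto
    qed
    then obtain r where r: "\<And>j. r j \<in> mpolys V" "\<And>j. coef x j p - f * r j \<in> F j"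
      "\<And>j. coef x j p = 0 \<Longrightarrow> r j = 0" by metis
    obtain N where N: "\<forall>j\<ge>N. coef x j p = 0" using coef_bounded by blast
    obtain b where b: "b \<in> mpolys (insert x V)" "\<And>j. coef x j b = r j"
      using coef_assemble[of r V x N] r xV N by blast
    have "p \<in> mpolys (insert x V)" "f \<in> mpolys (insert x V)" using p f V_sub by (auto simp: graded_def)
    then have "p - f * b \<in> graded x V F"
      using f b r by (auto simp: graded_def coef_diff coef_mult' intro!: B.mems)
    then show "p \<in> B.adj (graded x V F) f"
      unfolding B.adj_def using b(1) by (intro CollectI exI[of _ "p - f * b"] exI[of _ b]) auto
  qed
qed

lemma nzd_graded:
  assumes f: "f \<in> mpolys V"
  shows "B.nzd (graded x V F) f \<longleftrightarrow> (\<forall>j. A.nzd (F j) f)"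
proof
  assume *: "B.nzd (graded x V F) f"
  show "\<forall>j. A.nzd (F j) f"
    unfolding A.nzd_def
  proof (intro allI ballI impI)
    fix j z assume z: "z \<in> mpolys V" "f * z \<in> F j"
    have c: "coef x i (xpow x j * y) = (if i = j then y else 0)" if "y \<in> mpolys V" for i y
      using coef_mpolys[OF that xV] by (auto simp: coef_xpow_mult)
    have zB: "xpow x j * z \<in> mpolys (insert x V)" "f \<in> mpolys (insert x V)"
      using z f V_sub by (auto intro!: B.mems xpow_in)
    have "f * (xpow x j * z) \<in> graded x V F"
      using z f zB A.idl_zero[OF idlF] by (auto simp: graded_def coef_mult' c intro!: B.mems)
    then have "xpow x j * z \<in> graded x V F" using * zB by (auto simp: B.nzd_def)
    from graded_coef[OF this, of j] show "z \<in> F j" using z by (simp add: c)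
  qed
next
  assume *: "\<forall>j. A.nzd (F j) f"
  then show "B.nzd (graded x V F) f"
    using f by (auto simp: B.nzd_def A.nzd_def graded_def coef_mult' coef_in)
qed

lemma mmax_coef: "p \<in> mmax (insert x V) \<longleftrightarrow> p \<in> mpolys (insert x V) \<and> coef x 0 p \<in> mmax V"
  by (auto simp: mmax_def coef_in coef.rep_eq)

lemma mmax_sub: "mmax V \<subseteq> (mmax (insert x V) :: 'k mpoly set)"
  using V_sub by (auto simp: mmax_def)

lemma graded_ideal_adj: "f \<in> mpolys V \<Longrightarrow> graded_ideal x V (\<lambda>j. A.adj (F j) f)"
proof
  show "A.adj (F j) f \<subseteq> A.adj (F (Suc j)) f" for j
    using Fmono[of j] by (auto simp: A.adj_def)
qed (simp_all add: finV xV A.idl_adj idlF)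

end

text \<open>From degree \<open>t\<close> on the quotients vanish, so finitely many remain and one
  element of \<open>mmax V\<close> is regular on all of them. Dividing by it lowers the requirement
  for the coefficient ideals and for the graded ideal alike.\<close>

lemma depth_graded_ge:
  assumes "graded_ideal x V F" "t \<ge> 1" "\<And>j. j \<ge> t \<Longrightarrow> F j = mpolys V"
    "\<And>j. j < t \<Longrightarrow> pdepth V r (F j)"
  shows "pdepth (insert x V) r (graded x V F)"
  using assms
proof (induction r arbitrary: F)
  case 0
  interpret graded_ideal x V F by fact
  have "F 0 \<subseteq> mmax V" using "0.prems" by simp
  then show ?case by (auto simp: graded_def mmax_coef)
next
  case (Suc r)
  interpret graded_ideal x V F by fact
  have "\<exists>f\<in>mmax V. \<forall>L\<in>F ` {..<t}. A.nzd L f"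
    using Suc.prems(4) A.depth_ge_torsion_free A.M_sub A.M_closed
    by (intro A.common_nzd) (auto simp: idlF simp del: A.depth_ge.simps)
  then obtain f where f: "f \<in> mmax V" "\<And>j. j < t \<Longrightarrow> A.nzd (F j) f" by blast
  have fV: "f \<in> mpolys V" using f A.M_sub by blast
  have nz: "A.nzd (F j) f" for j
    using f(2) Suc.prems(3) by (cases "j < t") (auto simp: A.nzd_def not_less)
  have "pdepth (insert x V) r (graded x V (\<lambda>j. A.adj (F j) f))"
  proof (rule Suc.IH[OF graded_ideal_adj[OF fV] Suc.prems(2)])
    show "A.adj (F j) f = mpolys V" if "t \<le> j" for j
      using Suc.prems(3)[OF that] fV A.adj_upper[of "F j" f] A.idl_sub[OF A.idl_adj[OF idlF fV]] by blast
    show "A.depth_ge r (A.adj (F j) f)" if "j < t" for j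
      using A.depth_ge_adj[OF idlF Suc.prems(4)[OF that] f(1) nz] .
  qed
  moreover have "B.nzd (graded x V F) f" using nzd_graded[OF fV] nz by blast
  moreover have "f \<in> mmax (insert x V)" using f mmax_sub by blast
  ultimately show ?case using graded_adj[OF fV] by auto
qed

context graded_ideal
begin

text \<open>The argument is the vanishing of the first Koszul cohomology in depth two: a homogeneous element
  \<open>x\<^sup>j y\<close> killed by all variables other than \<open>x\<close> gives a compatible family \<open>(x\<^sup>j y, 0, \<dots>, 0)\<close>, hence
  \<open>x\<^sup>j y = x b\<close> with \<open>b\<close> killed in the same way and of smaller degree.\<close>

lemma torsion_free_graded:
  assumes "B.depth_ge (Suc (Suc r)) (graded x V F)"
  shows "B.torsion_free (mmax V) (graded x V F)"
proof -
  let ?G = "graded x V F"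
  obtain f where f: "f \<in> mmax (insert x V)" "B.nzd ?G f" "B.depth_ge (Suc r) (B.adj ?G f)"
    using assms by auto
  have tf: "B.torsion_free (mmax (insert x V)) (B.adj ?G f)"
    using f(3) by (rule B.depth_ge_torsion_free)
  have fB: "f \<in> mpolys (insert x V)" using f B.M_sub by blast
  obtain g where g: "g \<in> mpolys (insert x V)" "f = coef x 0 f + xpow x 1 * g"
    using decompose[OF fB] by blast
  define f' where "f' = coef x 0 f"
  have f': "f' \<in> mmax V" using f(1) by (simp add: mmax_coef f'_def)
  have xB: "xpow x j \<in> mpolys (insert x V)" for j by (rule xpow_in) simp
  have toB: "a \<in> mpolys (insert x V)" if "a \<in> mmax V" for a :: "'k mpoly" using that mmax_sub B.M_sub by blast
  have "y \<in> F j" if "y \<in> mpolys V" "\<And>a. a \<in> mmax V \<Longrightarrow> a * y \<in> F j" for y j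
    using that
  proof (induction j arbitrary: y rule: less_induct)
    case (less j)
    note y = less.prems
    let ?Z = "xpow x j * y"
    have yB: "y \<in> mpolys (insert x V)" using y V_sub by blast
    have ZB: "?Z \<in> mpolys (insert x V)" using yB xB by (intro B.mems)
    have cZ: "coef x i ?Z = (if i = j then y else 0)" for i
      using coef_mpolys[OF y(1) xV] by (auto simp: coef_xpow_mult)
    have aZ: "a * ?Z \<in> ?G" if "a \<in> mmax V" for a
      using that y(2) ZB toB[OF that] A.M_sub A.idl_zero[OF idlF]
      by (auto simp: graded_def coef_mult'[OF subsetD[OF A.M_sub]] cZ intro!: B.mems)
    \<comment> \<open>\<open>f' * ?Z\<close> lies in \<open>?G\<close>, so modulo \<open>?G\<close>
      multiplication by \<open>xpow x 1 * g\<close> and by \<open>f\<close> agree on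
      \<open>?Z\<close>.\<close>
    have xg: "xpow x 1 * (g * ?Z) = f * ?Z - f' * ?Z"
    proof -
      have "f * ?Z = (f' + xpow x 1 * g) * ?Z" using g(2) by (simp add: f'_def)
      then show ?thesis by (simp add: distrib_right mult.assoc)
    qed
    \<comment> \<open>Modulo \<open>(?G, f)\<close> the class of \<open>g * ?Z\<close> is killed by
      all variables: by \<open>x\<close> thanks to \<open>xg\<close>, by the others since they kill
      \<open>?Z\<close>.\<close>
    have "g * ?Z \<in> B.adj ?G f"
    proof -
      have "a * (g * ?Z) \<in> B.adj ?G f" if a: "a \<in> mmax (insert x V)" for a
      proof -
        have aB: "a \<in> mpolys (insert x V)" using a B.M_sub by blast
        obtain a'' where a'': "a'' \<in> mpolys (insert x V)" "a = coef x 0 a + xpow x 1 * a''"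
          using decompose[OF aB] by blast
        have a': "coef x 0 a \<in> mmax V" using a by (simp add: mmax_coef)
        have "a * (g * ?Z) = coef x 0 a * (g * ?Z) + a'' * (xpow x 1 * (g * ?Z))"
          by (subst a''(2)) (simp add: algebra_simps)
        also have "coef x 0 a * (g * ?Z) + a'' * (xpow x 1 * (g * ?Z)) = (g * (coef x 0 a * ?Z) - a'' * (f' * ?Z)) + f * (a'' * ?Z)"
          unfolding xg by (simp add: algebra_simps)
        finally have "a * (g * ?Z) = (g * (coef x 0 a * ?Z) - a'' * (f' * ?Z)) + f * (a'' * ?Z)" .
        moreover have "g * (coef x 0 a * ?Z) - a'' * (f' * ?Z) \<in> ?G"
          using B.idl_diff[OF idl_graded B.idl_mult[OF idl_graded g(1) aZ[OF a']]
              B.idl_mult[OF idl_graded a''(1) aZ[OF f']]] .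
        moreover have "a'' * ?Z \<in> mpolys (insert x V)" using a''(1) ZB by (rule B.mult_mem)
        ultimately show ?thesis unfolding B.adj_def by blast
      qed
      then show ?thesis using tf g ZB by (auto simp: B.torsion_free_def B.mems)
    qed
    then obtain l b where lb: "g * ?Z = l + f * b" "l \<in> ?G" "b \<in> mpolys (insert x V)"
      by (auto simp: B.adj_def)
    \<comment> \<open>Cancelling \<open>f\<close> shows that \<open>?Z\<close> equals
      \<open>xpow x 1 * b\<close> modulo \<open>?G\<close>. In degree \<open>j\<close> this says
      that \<open>y\<close> agrees modulo \<open>F j\<close> with the coefficient of
      \<open>b\<close> in degree \<open>j - 1\<close>, or with zero if \<open>j = 0\<close>.\<close>
    have "f * (?Z - xpow x 1 * b) = f' * ?Z + xpow x 1 * l"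
      using xg unfolding lb(1) by (simp add: algebra_simps)
    also have "\<dots> \<in> ?G" by (rule B.idl_add[OF idl_graded aZ[OF f'] B.idl_mult[OF idl_graded xB lb(2)]])
    finally have "f * (?Z - xpow x 1 * b) \<in> ?G" .
    moreover have "?Z - xpow x 1 * b \<in> mpolys (insert x V)" by (rule B.diff_mem[OF ZB B.mult_mem[OF xB lb(3)]])
    ultimately have "?Z - xpow x 1 * b \<in> ?G" using f(2) unfolding B.nzd_def by blast
    then have "coef x j (?Z - xpow x 1 * b) \<in> F j" by (rule graded_coef)
    then have yb: "y - (if 1 \<le> j then coef x (j - 1) b else 0) \<in> F j"
      unfolding coef_diff cZ coef_xpow_mult[of x j 1 b] by simp
    \<comment> \<open>\<open>b\<close> is again killed by \<open>mmax V\<close> modulo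
      \<open>?G\<close>, which feeds the induction in degree \<open>j - 1\<close>.\<close>
    have ab: "a * coef x i b \<in> F i" if a: "a \<in> mmax V" for a i
    proof -
      have "f * (a * b) = g * (a * ?Z) - a * l" using lb(1) by (simp add: algebra_simps)
      also have "\<dots> \<in> ?G" by (rule B.idl_diff[OF idl_graded B.idl_mult[OF idl_graded g(1) aZ[OF a]]
            B.idl_mult[OF idl_graded toB[OF a] lb(2)]])
      finally have "a * b \<in> ?G" using f(2) toB[OF a] lb by (auto simp: B.nzd_def B.mems)
      then have "coef x i (a * b) \<in> F i" by (rule graded_coef)
      then show ?thesis using coef_mult'[OF subsetD[OF A.M_sub a]] by simp
    qed
    show ?case
    proof (cases j)
      case 0
      then show ?thesis using yb by simp
    next
      case (Suc i)
      then have "coef x i b \<in> F j"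
        using less.IH[of i "coef x i b"] coef_in[OF lb(3)] ab Fmono[of i] by blast
      then show ?thesis using A.idl_add[OF idlF yb, of "coef x i b"] Suc by simp
    qed
  qed
  then show ?thesis
    by (auto simp: B.torsion_free_def graded_def coef_in coef_mult'[OF subsetD[OF A.M_sub]])
qed

end

text \<open>While the depth is at least two, \<open>torsion_free_graded\<close> and prime avoidance
  give a regular element in \<open>mmax V\<close>, and dividing by it acts on each
  \<open>F j\<close>. At depth one only the properness of \<open>F j\<close> is left, whence the
  loss of one.\<close>

lemma depth_graded_le:
  assumes "graded_ideal x V F" "\<And>j. F j \<subseteq> mmax V"
    "pdepth (insert x V) (Suc r) (graded x V F)"
  shows "pdepth V r (F j)"
  using assms
proof (induction r arbitrary: F)
  case 0
  interpret graded_ideal x V F by fact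
  show ?case using "0.prems" by simp
next
  case (Suc r)
  interpret graded_ideal x V F by fact
  have "\<exists>f\<in>mmax V. \<forall>L\<in>{graded x V F}. B.nzd L f"
    using torsion_free_graded[OF Suc.prems(3)] A.M_sub V_sub A.M_closed
    by (intro B.common_nzd) (auto simp: idl_graded)
  then obtain f where f: "f \<in> mmax V" "B.nzd (graded x V F) f" by blast
  have fV: "f \<in> mpolys V" using f A.M_sub by blast
  have fB: "f \<in> mmax (insert x V)" using f mmax_sub by blast
  have nz: "A.nzd (F j) f" for j using nzd_graded[OF fV] f by blast
  have "pdepth V r (A.adj (F j) f)"
  proof (rule Suc.IH[OF graded_ideal_adj[OF fV]])
    show "A.adj (F j) f \<subseteq> mmax V" for j
      using A.adj_least[OF A.M] Suc.prems(2) f by blast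
    show "B.depth_ge (Suc r) (graded x V (\<lambda>j. A.adj (F j) f))"
      using B.depth_ge_adj[OF idl_graded Suc.prems(3) fB f(2)] by (simp add: graded_adj[OF fV])
  qed
  then show ?case using nz f by auto
qed

section \<open>Depth of quotients in terms of ideals\<close>

context noetherian_with_ideal
begin

text \<open>The head is adjoined last, matching \<open>list_smult\<close>; since adjunctions
  commute, the order does not matter.\<close>

primrec idl_list :: "'a set \<Rightarrow> 'a list \<Rightarrow> 'a set"
  where
    "idl_list L [] = L"
  | "idl_list L (f # fs) = adj (idl_list L fs) f"

lemma idl_list_Cons': "idl_list L (f # fs) = idl_list (adj L f) fs"
proof (induction fs)
  case (Cons g gs)
  have "idl_list L (f # g # gs) = adj (idl_list L (f # gs)) g" by (simp add: adj_commute)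
  then show ?case using Cons by simp
qed simp

lemma idl_idl_list: "idl L \<Longrightarrow> set fs \<subseteq> R \<Longrightarrow> idl (idl_list L fs)"
  by (induction fs) (auto intro: idl_adj)

lemma idl_list_upper: "L \<subseteq> idl_list L fs"
  by (induction fs) (use adj_upper in fastforce)+

lemma idl_list_least: "idl K \<Longrightarrow> L \<subseteq> K \<Longrightarrow> set fs \<subseteq> K \<Longrightarrow> idl_list L fs \<subseteq> K"
  by (induction fs) (auto intro: adj_least[THEN subsetD])

lemma depth_ge_iff_list:
  "depth_ge r L \<longleftrightarrow> L \<subseteq> M \<and> (\<exists>fs. length fs = r \<and> set fs \<subseteq> M \<and>
     (\<forall>i<length fs. nzd (idl_list L (take i fs)) (fs ! i)))"
proof (induction r arbitrary: L)
  case (Suc r)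
  have step: "(\<forall>i<length (f # fs). nzd (idl_list L (take i (f # fs))) ((f # fs) ! i)) \<longleftrightarrow>
    nzd L f \<and> (\<forall>i<length fs. nzd (idl_list (adj L f) (take i fs)) (fs ! i))" for f fs
    by (simp add: All_less_Suc2 del: idl_list.simps(2) add: idl_list_Cons')
  have adj: "adj L f \<subseteq> M \<longleftrightarrow> L \<subseteq> M" if "f \<in> M" for f
    using that adj_least[OF M] adj_upper[of L f] by blast
  show ?case (is "_ \<longleftrightarrow> ?R")
  proof
    assume "depth_ge (Suc r) L"
    then obtain f where f: "f \<in> M" "nzd L f" "depth_ge r (adj L f)" by auto
    then obtain fs where "length fs = r" "set fs \<subseteq> M" "L \<subseteq> M"
      "\<forall>i<length fs. nzd (idl_list (adj L f) (take i fs)) (fs ! i)"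
      using Suc.IH[of "adj L f"] adj by blast
    then show ?R using f step[of f fs] by (intro conjI exI[of _ "f # fs"]) auto
  next
    assume ?R
    then obtain gs where gs: "length gs = Suc r" "set gs \<subseteq> M" "L \<subseteq> M"
      "\<forall>i<length gs. nzd (idl_list L (take i gs)) (gs ! i)" by blast
    then obtain f fs where "gs = f # fs" "length fs = r" by (auto simp: length_Suc_conv)
    then show "depth_ge (Suc r) L" using gs step[of f fs] Suc.IH[of "adj L f"] adj by auto
  qed
qed auto

end

lemma pidl_ideal:
  assumes "pidl V L"
  shows "ideal L (mpoly_ring V :: 'k::field mpoly ring)"
proof -
  interpret subring_carrier "mpolys V :: 'k mpoly set" by (rule subring_mpolys)
  interpret R: cring "mpoly_ring V :: 'k mpoly ring" by (rule cring_mpoly_ring)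
  have inv: "\<ominus>\<^bsub>mpoly_ring V\<^esub> a = - a" if "a \<in> mpolys V" for a :: "'k mpoly"
    using that by (intro R.add.inv_equality[simplified a_inv_def[symmetric]]) (auto simp: uminus_mem)
  show ?thesis
  proof (rule idealI)
    show "subgroup L (add_monoid (mpoly_ring V))"
    proof (rule R.add.subgroupI)
      show "\<ominus>\<^bsub>mpoly_ring V\<^esub> a \<in> L" if "a \<in> L" for a
        using inv[of a] that assms idl_sub[OF assms that] idl_diff[OF assms idl_zero[OF assms] that]
        by simp
    qed (use assms in \<open>auto simp: idl_def\<close>)
  qed (use assms in \<open>auto simp: R.ring_axioms intro: idl_mult idl_mult_right\<close>)
qed

locale poly_quotient =
  fixes V :: "nat set" and L :: "'k::field mpoly set"
  assumes pidl: "pidl V L"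
begin

sublocale subring_carrier "mpolys V :: 'k mpoly set" by (rule subring_mpolys)
sublocale ideal L "mpoly_ring V :: 'k mpoly ring" by (rule pidl_ideal[OF pidl])

abbreviation cs :: "'k mpoly \<Rightarrow> 'k mpoly set"
  where "cs c \<equiv> L +>\<^bsub>mpoly_ring V\<^esub> c"

lemma cs_def: "cs c = {l + c | l. l \<in> L}"
  by (auto simp: a_r_coset_def')

lemma cs_eq_iff: "c \<in> mpolys V \<Longrightarrow> d \<in> mpolys V \<Longrightarrow> cs c = cs d \<longleftrightarrow> c - d \<in> L"
proof -
  assume cd: "c \<in> mpolys V" "d \<in> mpolys V"
  show ?thesis
  proof
    assume "cs c = cs d"
    moreover have "c \<in> cs c" using idl_zero[OF pidl] by (force simp: cs_def)
    ultimately show "c - d \<in> L" by (auto simp: cs_def)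
  next
    assume *: "c - d \<in> L"
    have "l + c \<in> cs d" if "l \<in> L" for l
      using idl_add[OF pidl that *] by (force simp: cs_def intro: exI[of _ "l + (c - d)"])
    moreover have "l + d \<in> cs c" if "l \<in> L" for l
      using idl_diff[OF pidl that *] by (force simp: cs_def intro: exI[of _ "l - (c - d)"])
    ultimately show "cs c = cs d" by (auto simp: cs_def)
  qed
qed

lemma carrier_quot: "carrier (mpoly_ring V Quot L) = cs ` mpolys V"
  by (auto simp: FactRing_def A_RCOSETS_def')

lemma add_quot: "c \<in> mpolys V \<Longrightarrow> d \<in> mpolys V \<Longrightarrow> cs c \<oplus>\<^bsub>mpoly_ring V Quot L\<^esub> cs d = cs (c + d)"
  using a_rcos_sum[of c d] by (simp add: FactRing_def)

lemma zero_quot: "\<zero>\<^bsub>mpoly_ring V Quot L\<^esub> = cs 0"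
  by (auto simp: FactRing_def cs_def)

lemma smult_quot: "r \<in> mpolys V \<Longrightarrow> c \<in> mpolys V \<Longrightarrow> r \<odot>\<^bsub>quot_module (mpoly_ring V) L\<^esub> cs c = cs (r * c)"
  using quot_module_smult_coset[OF cring_mpoly_ring, of r c] by simp

lemma cs_image_mem: "idl K \<Longrightarrow> L \<subseteq> K \<Longrightarrow> c \<in> mpolys V \<Longrightarrow> cs c \<in> cs ` K \<longleftrightarrow> c \<in> K"
proof
  assume K: "idl K" "L \<subseteq> K" "c \<in> mpolys V" and "cs c \<in> cs ` K"
  then obtain k where k: "k \<in> K" "cs c = cs k" by auto
  then have "c - k \<in> L" using cs_eq_iff[OF K(3) idl_sub[OF K(1) k(1)]] by simp
  then have "c - k \<in> K" using K(2) by (rule rev_subsetD)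
  then show "c \<in> K" using idl_add[OF K(1) _ k(1), of "c - k"] by simp
qed auto

end

text \<open>For sequences in \<open>mmax V\<close> the quotient never vanishes, as \<open>1\<close>
  stays outside the ideal, so regularity reduces to the \<open>nzd\<close> conditions. A supremum
  that reaches \<open>r\<close> is witnessed by some sequence of length at least \<open>r\<close>,
  which may be truncated.\<close>

lemma depth_quot_ge_iff:
  assumes V: "finite V" and L: "pidl V L" "L \<subseteq> (mmax V :: 'k::field mpoly set)"
    and mm: "genideal (mpoly_ring V) (mvar ` V) = (mmax V :: 'k mpoly set)"
  shows "enat r \<le> depth_quot V L \<longleftrightarrow> pdepth V r L"
proof -
  interpret noetherian_with_ideal "mpolys V :: 'k mpoly set" "mmax V" by (rule noetherian_mpolys[OF V])
  interpret poly_quotient V L by unfold_locales (rule L)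
  let ?M = "quot_module (mpoly_ring V) L"
  have list: "list_smult ?M fs = cs ` idl_list L fs" if "set fs \<subseteq> mpolys V" for fs
    using that
  proof (induction fs)
    case Nil
    have "cs c = cs 0" if "c \<in> L" for c using that cs_eq_iff idl_sub[OF pidl] zero_mem by simp
    then have "cs ` L = (\<lambda>_. cs 0) ` L" by (intro image_cong) simp_all
    also have "\<dots> = {cs 0}" using image_constant[OF idl_zero[OF pidl]] .
    finally show ?case by (simp add: zero_quot)
  next
    case (Cons f fs)
    have "y \<in> mpolys V" if "y \<in> idl_list L fs" for y
      using idl_sub[OF idl_idl_list[OF pidl] that] Cons by simp
    then have "f \<odot>\<^bsub>?M\<^esub> cs x \<oplus>\<^bsub>?M\<^esub> cs y = cs (f * x + y)" if "x \<in> mpolys V" "y \<in> idl_list L fs" for x y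
      using that Cons.prems by (simp del: quot_module_simps(4) add: smult_quot add_quot mems)
    then have eq: "f \<odot>\<^bsub>?M\<^esub> cs x \<oplus>\<^bsub>?M\<^esub> cs y = cs (y + f * x)" if "x \<in> mpolys V" "y \<in> idl_list L fs" for x y
      using that by (simp add: add.commute)
    have "list_smult ?M (f # fs) = {f \<odot>\<^bsub>?M\<^esub> cs x \<oplus>\<^bsub>?M\<^esub> cs y | x y. x \<in> mpolys V \<and> y \<in> idl_list L fs}"
      using Cons by (auto simp del: quot_module_simps(2,4) simp: carrier_quot)
    also have "\<dots> = {cs (y + f * x) | x y. x \<in> mpolys V \<and> y \<in> idl_list L fs}"
      using eq by (metis (no_types, lifting))
    also have "\<dots> = cs ` idl_list L (f # fs)" by (auto simp: adj_def)
    finally show ?case .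
  qed
  have reg: "regular_sequence ?M fs \<longleftrightarrow> (\<forall>i<length fs. nzd (idl_list L (take i fs)) (fs ! i))"
    if fs: "set fs \<subseteq> mmax V" for fs
  proof -
    have fsV: "set fs \<subseteq> mpolys V" using fs M_sub by blast
    then have fi: "fs ! i \<in> mpolys V" if "i < length fs" for i using that nth_mem by blast
    have tk: "set (take i fs) \<subseteq> mpolys V" for i using fsV set_take_subset[of i fs] by blast
    have sub: "idl_list L fs \<subseteq> mmax V" by (rule idl_list_least[OF M L(2) fs])
    have "1 \<in> (mpolys V :: 'k mpoly set)" "1 \<notin> (mmax V :: 'k mpoly set)"
      by (simp_all add: one_in_mpolys mmax_def)
    then have "list_smult ?M fs \<noteq> carrier ?M"
      using list[OF fsV] cs_image_mem[OF idl_idl_list[OF pidl fsV] idl_list_upper, of 1] sub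
      by (auto simp: carrier_quot)
    moreover have "(\<forall>x\<in>carrier ?M. fs ! i \<odot>\<^bsub>?M\<^esub> x \<in> list_smult ?M (take i fs) \<longrightarrow> x \<in> list_smult ?M (take i fs))
      \<longleftrightarrow> nzd (idl_list L (take i fs)) (fs ! i)" if "i < length fs" for i
      using fi[OF that] cs_image_mem[OF idl_idl_list[OF pidl tk] idl_list_upper]
      by (auto simp del: quot_module_simps(4) simp: list[OF tk] carrier_quot smult_quot nzd_def mems)
    ultimately show ?thesis unfolding regular_sequence_def by blast
  qed
  define A where "A = {fs. set fs \<subseteq> mmax V \<and> regular_sequence ?M fs}"
  have d: "depth_quot V L = (SUP fs\<in>A. enat (length fs))"
    by (simp add: depth_quot_def module_depth_def mm A_def)
  have iff: "pdepth V r L \<longleftrightarrow> (\<exists>fs\<in>A. length fs = r)" for r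
    unfolding depth_ge_iff_list A_def using reg L(2) by blast
  show ?thesis
  proof
    assume "pdepth V r L"
    then obtain fs where "fs \<in> A" "length fs = r" using iff by blast
    then show "enat r \<le> depth_quot V L" unfolding d by (metis SUP_upper)
  next
    assume *: "enat r \<le> depth_quot V L"
    show "pdepth V r L"
    proof (cases r)
      case 0
      then show ?thesis using L by simp
    next
      case (Suc q)
      then have "enat q < depth_quot V L" using * by (metis Suc_ile_eq)
      then obtain fs where "fs \<in> A" "q < length fs" unfolding d less_SUP_iff by auto
      then show ?thesis using iff[of "length fs"] depth_ge_mono[of "length fs" L r] Suc by auto
    qed
  qed
qed

section \<open>Monomial ideals\<close>

text \<open>A monomial ideal is given by a predicate on all exponent vectors, so that one
  \<open>P\<close> can be read over different sets of variables. Coefficient ideals and free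
  variables rely on this.\<close>

definition mspan :: "nat set \<Rightarrow> (monom \<Rightarrow> bool) \<Rightarrow> 'k::field mpoly set"
  where "mspan V P = {p \<in> mpolys V. \<forall>u\<in>keys p. P u}"

definition upset :: "(monom \<Rightarrow> bool) \<Rightarrow> bool"
  where "upset P \<longleftrightarrow> (\<forall>u w. P u \<longrightarrow> P (u + w))"

definition generated :: "monom set \<Rightarrow> monom \<Rightarrow> bool"
  where "generated G u \<longleftrightarrow> (\<exists>g\<in>G. \<exists>w. u = g + w)"

definition psum :: "(monom \<Rightarrow> bool) \<Rightarrow> (monom \<Rightarrow> bool) \<Rightarrow> monom \<Rightarrow> bool"
  where "psum P Q u \<longleftrightarrow> (\<exists>a b. u = a + b \<and> P a \<and> Q b)"

primrec ppow :: "(monom \<Rightarrow> bool) \<Rightarrow> nat \<Rightarrow> monom \<Rightarrow> bool"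
  where
    "ppow P 0 = (\<lambda>_. True)"
  | "ppow P (Suc t) = psum (ppow P t) P"

lemma upset_add: "upset P \<Longrightarrow> P u \<Longrightarrow> P (u + w)"
  by (simp add: upset_def)

lemma upset_generated: "upset (generated G)"
  unfolding upset_def generated_def by (metis add.assoc)

lemma generated_self: "g \<in> G \<Longrightarrow> generated G g"
  unfolding generated_def by (intro bexI[of _ g] exI[of _ 0]) simp_all

lemma upset_psum: "upset Q \<Longrightarrow> upset (psum P Q)"
  unfolding upset_def psum_def by (metis add.assoc)

lemma upset_ppow: "upset P \<Longrightarrow> upset (ppow P t)"
  by (cases t) (auto simp: upset_psum, simp add: upset_def)

lemma upset_shift: "upset P \<Longrightarrow> upset (\<lambda>u. P (u + c))"
  unfolding upset_def by (metis add.commute add.left_commute)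

lemma upset_or_lookup: "upset P \<Longrightarrow> upset (\<lambda>u. P u \<or> t \<le> lookup u x)"
  unfolding upset_def by (auto simp: lookup_add)

lemma mspan_cong: "(\<And>u. keys u \<subseteq> V \<Longrightarrow> P u \<longleftrightarrow> Q u) \<Longrightarrow> mspan V P = mspan V Q"
  by (auto simp: mspan_def mpolys_def)

lemma mspan_mono: "(\<And>u. P u \<Longrightarrow> Q u) \<Longrightarrow> mspan V P \<subseteq> mspan V Q"
  by (auto simp: mspan_def)

lemma mspan_eq_mpolys: "(\<And>u. keys u \<subseteq> V \<Longrightarrow> P u) \<Longrightarrow> mspan V P = mpolys V"
  by (auto simp: mspan_def mpolys_def)

lemma single_in_mspan: "keys u \<subseteq> V \<Longrightarrow> P u \<Longrightarrow> Poly_Mapping.single u c \<in> mspan V P"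
  by (auto simp: mspan_def mpolys_def)

lemma of_monom_in_mspan_iff: "of_monom u \<in> (mspan V P :: 'k::field mpoly set) \<longleftrightarrow> keys u \<subseteq> V \<and> P u"
  by (auto simp: mspan_def mpolys_def of_monom_def)

lemma mspan_induct [consumes 1, case_names zero single add]:
  assumes "p \<in> mspan V P" "Q 0" "\<And>u c. keys u \<subseteq> V \<Longrightarrow> P u \<Longrightarrow> Q (Poly_Mapping.single u c)"
    "\<And>p q. Q p \<Longrightarrow> Q q \<Longrightarrow> Q (p + q)"
  shows "Q p"
  using assms by (intro poly_mapping_sum_induct[of p "{u. keys u \<subseteq> V \<and> P u}" Q]) (auto simp: mspan_def mpolys_def)

lemma add_in_mspan:
  assumes "p \<in> mspan V P" "q \<in> mspan V P"
  shows "p + q \<in> mspan V P"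
  using assms Poly_Mapping.keys_add[of p q] by (auto simp: mspan_def add_in_mpolys)

lemma pidl_mspan:
  assumes "upset P"
  shows "pidl V (mspan V P :: 'k::field mpoly set)"
  unfolding subring_carrier.idl_def[OF subring_mpolys]
proof (intro conjI ballI)
  fix r p :: "'k mpoly" assume r: "r \<in> mpolys V" and p: "p \<in> mspan V P"
  have "P u" if u: "u \<in> keys (r * p)" for u
  proof -
    obtain a b where "u = a + b" "b \<in> keys p" using keys_mult[of r p] u by blast
    then show ?thesis using p upset_add[OF assms, of b a] by (auto simp: mspan_def add.commute)
  qed
  then show "r * p \<in> mspan V P" using r p by (auto simp: mspan_def mult_in_mpolys)
next
  show "mspan V P \<subseteq> (mpolys V :: 'k mpoly set)" "0 \<in> (mspan V P :: 'k mpoly set)"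
    by (simp_all add: mspan_def zero_in_mpolys)
qed (rule add_in_mspan)

lemma mspan_sub_mmax: "\<not> P 0 \<Longrightarrow> mspan V P \<subseteq> mmax V"
  by (auto simp: mspan_def mmax_def in_keys_iff)

lemma of_monom_mult: "of_monom a * of_monom b = of_monom (a + b)"
  by (simp add: of_monom_def mult_single)

lemma of_monom_0: "of_monom 0 = 1"
  by (simp add: of_monom_def)

lemma prod_mvar: "(\<Prod>j\<in>A. mvar (f j)) = of_monom (\<Sum>j\<in>A. Poly_Mapping.single (f j) 1)"
  by (induction A rule: infinite_finite_induct) (simp_all add: of_monom_0 mvar_def of_monom_mult)

lemma mvar_power: "mvar x ^ t = xpow x t"
  by (induction t) (simp_all add: of_monom_0 mvar_def of_monom_mult single_add[symmetric])

lemma genideal_monoms: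
  assumes "\<And>g. g \<in> G \<Longrightarrow> keys g \<subseteq> V"
  shows "genideal (mpoly_ring V) (of_monom ` G) = (mspan V (generated G) :: 'k::field mpoly set)"
proof -
  interpret R: cring "mpoly_ring V :: 'k mpoly ring" by (rule cring_mpoly_ring)
  have sub: "of_monom ` G \<subseteq> carrier (mpoly_ring V :: 'k mpoly ring)"
    using assms by (auto intro: of_monom_in_mpolys)
  interpret I: ideal "genideal (mpoly_ring V) (of_monom ` G :: 'k mpoly set)" "mpoly_ring V :: 'k mpoly ring"
    by (rule R.genideal_ideal[OF sub])
  show ?thesis
  proof
    show "genideal (mpoly_ring V) (of_monom ` G) \<subseteq> (mspan V (generated G) :: 'k mpoly set)"
    proof (rule R.genideal_minimal)
      show "of_monom ` G \<subseteq> (mspan V (generated G) :: 'k mpoly set)"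
        using assms generated_self by (auto simp: of_monom_in_mspan_iff)
    qed (rule pidl_ideal[OF pidl_mspan[OF upset_generated]])
    show "(mspan V (generated G) :: 'k mpoly set) \<subseteq> genideal (mpoly_ring V) (of_monom ` G)"
    proof
      fix p :: "'k mpoly" assume "p \<in> mspan V (generated G)"
      then show "p \<in> genideal (mpoly_ring V) (of_monom ` G)"
      proof (induction p rule: mspan_induct)
        case zero
        show ?case using I.zero_closed by simp
      next
        case (single u c)
        then obtain g w where g: "g \<in> G" "u = g + w" by (auto simp: generated_def)
        then have "Poly_Mapping.single w c \<in> mpolys V" using single by (auto simp: mpolys_def keys_add_nat)
        moreover have "of_monom g \<in> genideal (mpoly_ring V) (of_monom ` G :: 'k mpoly set)"
          using R.genideal_self[OF sub] g by blast
        ultimately have "Poly_Mapping.single w c * of_monom g \<in> genideal (mpoly_ring V) (of_monom ` G)"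
          using I.I_l_closed[of "of_monom g" "Poly_Mapping.single w c"] by simp
        then show ?case using g by (simp add: of_monom_def mult_single add.commute)
      next
        case (add p q)
        then show ?case using I.a_closed[of p q] by simp
      qed
    qed
  qed
qed

lemma genideal_vars: "genideal (mpoly_ring V) (mvar ` V) = (mmax V :: 'k::field mpoly set)"
proof -
  let ?G = "(\<lambda>i. Poly_Mapping.single i 1) ` V :: monom set"
  have "mvar ` V = (of_monom ` ?G :: 'k mpoly set)" by (auto simp: mvar_def)
  moreover have "genideal (mpoly_ring V) (of_monom ` ?G) = (mspan V (generated ?G) :: 'k mpoly set)"
    by (rule genideal_monoms) auto
  moreover have "mspan V (generated ?G) = (mspan V (\<lambda>u. u \<noteq> 0) :: 'k mpoly set)"
  proof (rule mspan_cong)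
    fix u :: monom assume u: "keys u \<subseteq> V"
    show "generated ?G u \<longleftrightarrow> u \<noteq> 0"
    proof
      assume "generated ?G u"
      then obtain i w where "u = Poly_Mapping.single i 1 + w" by (auto simp: generated_def)
      then have "lookup u i \<noteq> 0" by (simp add: lookup_add)
      then show "u \<noteq> 0" by auto
    next
      assume "u \<noteq> 0"
      then obtain i where i: "i \<in> keys u" using monom_keys_empty by blast
      then have "u = Poly_Mapping.single i 1 + (u - Poly_Mapping.single i 1)"
        by (intro monom_diff_add[symmetric]) (auto simp: lookup_single when_def in_keys_iff)
      then show "generated ?G u" using i u by (auto simp: generated_def)
    qed
  qed
  moreover have "mspan V (\<lambda>u. u \<noteq> 0) = (mmax V :: 'k mpoly set)"
    by (auto simp: mspan_def mmax_def in_keys_iff)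
  ultimately show ?thesis by simp
qed

lemma ideal_prod_mspan:
  "ideal_prod (mpoly_ring V) (mspan V P) (mspan V Q) = (mspan V (psum P Q) :: 'k::field mpoly set)"
proof
  show "ideal_prod (mpoly_ring V) (mspan V P) (mspan V Q) \<subseteq> (mspan V (psum P Q) :: 'k mpoly set)"
  proof
    fix s :: "'k mpoly" assume "s \<in> ideal_prod (mpoly_ring V) (mspan V P) (mspan V Q)"
    then show "s \<in> mspan V (psum P Q)"
    proof (induction s rule: ideal_prod.induct)
      case (prod i j)
      have "psum P Q u" if u: "u \<in> keys (i * j)" for u
      proof -
        obtain a b where "u = a + b" "a \<in> keys i" "b \<in> keys j" using keys_mult[of i j] u by blast
        then show ?thesis using prod by (auto simp: mspan_def psum_def)
      qed
      then show ?case using prod by (auto simp: mspan_def mult_in_mpolys)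
    qed (simp add: add_in_mspan)
  qed
  show "(mspan V (psum P Q) :: 'k mpoly set) \<subseteq> ideal_prod (mpoly_ring V) (mspan V P) (mspan V Q)"
  proof
    have mono: "Poly_Mapping.single u c \<in> ideal_prod (mpoly_ring V) (mspan V P) (mspan V Q)"
      if u: "keys u \<subseteq> V" "psum P Q u" for u and c :: 'k
    proof -
      obtain a b where ab: "u = a + b" "P a" "Q b" using u by (auto simp: psum_def)
      then have "Poly_Mapping.single a c \<in> mspan V P" "Poly_Mapping.single b 1 \<in> (mspan V Q :: 'k mpoly set)"
        using u by (auto intro!: single_in_mspan simp: keys_add_nat)
      from ideal_prod.prod[OF this, of "mpoly_ring V"] show ?thesis by (simp add: mult_single ab)
    qed
    fix p :: "'k mpoly" assume p: "p \<in> mspan V (psum P Q)"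
    show "p \<in> ideal_prod (mpoly_ring V) (mspan V P) (mspan V Q)"
    proof (cases "p = 0")
      case True
      show ?thesis
        using True ideal_prod.prod[of 0 "mspan V P" 0 "mspan V Q" "mpoly_ring V"]
        by (simp add: mspan_def zero_in_mpolys)
    next
      case False
      have "(\<Sum>u\<in>B. Poly_Mapping.single u (lookup p u)) \<in> ideal_prod (mpoly_ring V) (mspan V P) (mspan V Q)"
        if "finite B" "B \<noteq> {}" "B \<subseteq> keys p" for B
        using that
      proof (induction B rule: finite_ne_induct)
        case (singleton u)
        then have "Poly_Mapping.single u (lookup p u) \<in> ideal_prod (mpoly_ring V) (mspan V P) (mspan V Q)"
          using p by (intro mono) (auto simp: mspan_def mpolys_def)
        then show ?case by simp
      next
        case (insert u B)
        then have "Poly_Mapping.single u (lookup p u) \<in> ideal_prod (mpoly_ring V) (mspan V P) (mspan V Q)"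
          using p by (intro mono) (auto simp: mspan_def mpolys_def)
        from ideal_prod.sum[OF this, of "\<Sum>u\<in>B. Poly_Mapping.single u (lookup p u)"] insert
        show ?case by auto
      qed
      from this[of "keys p"] show ?thesis using False poly_mapping_sum_singles[of p] by simp
    qed
  qed
qed

lemma ideal_pow_mspan:
  assumes "upset P"
  shows "mspan V P [^]\<^bsub>ideals_set (mpoly_ring V)\<^esub> (t::nat) = (mspan V (ppow P t) :: 'k::field mpoly set)"
proof -
  interpret R: cring "mpoly_ring V :: 'k mpoly ring" by (rule cring_mpoly_ring)
  interpret I: comm_monoid "ideals_set (mpoly_ring V :: 'k mpoly ring)"
    by (rule R.ideals_set_is_comm_monoid)
  show ?thesis
  proof (induction t)
    case 0
    show ?case unfolding I.nat_pow_0 by (simp add: ideals_set_def mspan_eq_mpolys)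
  next
    case (Suc t)
    then show ?case unfolding I.nat_pow_Suc by (simp add: ideals_set_def ideal_prod_mspan)
  qed
qed

lemma keys_mult_of_monom:
  fixes p :: "'k::field mpoly"
  shows "keys (p * of_monom w) = (+) w ` keys p"
proof
  show "keys (p * of_monom w) \<subseteq> (+) w ` keys p"
    using keys_single_mult[of w 1 p] by (simp add: of_monom_def mult.commute)
  show "(+) w ` keys p \<subseteq> keys (p * of_monom w)"
    using lookup_single_mult_add[of w 1 p] by (auto simp: in_keys_iff of_monom_def mult.commute)
qed

lemma ideal_colon_mspan:
  assumes "x \<in> V"
  shows "ideal_colon (mpoly_ring V) (mspan V P) (xpow x t) =
    (mspan V (\<lambda>u. P (u + Poly_Mapping.single x t)) :: 'k::field mpoly set)"
  using mult_in_mpolys[OF _ xpow_in[OF assms]]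
  by (auto simp: ideal_colon_def mspan_def keys_mult_of_monom add.commute)

lemma pcolon_eq: "pcolon V L f = ideal_colon (mpoly_ring V) L f"
  by (simp add: ideal_colon_def subring_carrier.colon_def[OF subring_mpolys])

lemma adj_mspan:
  assumes "x \<in> V" "upset P"
  shows "padj V (mspan V P) (xpow x t) = (mspan V (\<lambda>u. P u \<or> t \<le> lookup u x) :: 'k::field mpoly set)"
proof -
  interpret subring_carrier "mpolys V :: 'k mpoly set" by (rule subring_mpolys)
  have fx: "(xpow x t :: 'k mpoly) \<in> mpolys V" by (rule xpow_in[OF assms(1)])
  have idl: "idl (mspan V (\<lambda>u. P u \<or> t \<le> lookup u x) :: 'k mpoly set)"
    by (rule pidl_mspan[OF upset_or_lookup[OF assms(2)]])
  have idl': "idl (adj (mspan V P) (xpow x t) :: 'k mpoly set)"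
    by (rule idl_adj[OF pidl_mspan[OF assms(2)] fx])
  show ?thesis
  proof
    show "adj (mspan V P) (xpow x t) \<subseteq> (mspan V (\<lambda>u. P u \<or> t \<le> lookup u x) :: 'k mpoly set)"
      by (rule adj_least[OF idl]) (use assms in \<open>auto simp: of_monom_in_mspan_iff intro: mspan_mono[THEN subsetD] split: if_splits\<close>)
    show "(mspan V (\<lambda>u. P u \<or> t \<le> lookup u x) :: 'k mpoly set) \<subseteq> adj (mspan V P) (xpow x t)"
    proof
      fix p :: "'k mpoly" assume "p \<in> mspan V (\<lambda>u. P u \<or> t \<le> lookup u x)"
      then show "p \<in> adj (mspan V P) (xpow x t)"
      proof (induction p rule: mspan_induct)
        case (single u c)
        show ?case
        proof (cases "P u")
          case True
          then show ?thesis using single adj_upper[of "mspan V P"] single_in_mspan[of u V P c] by blast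
        next
          case False
          then have "u = Poly_Mapping.single x t + (u - Poly_Mapping.single x t)"
            using single by (intro monom_diff_add[symmetric]) (auto simp: lookup_single when_def)
          then have "Poly_Mapping.single u c = Poly_Mapping.single (u - Poly_Mapping.single x t) c * xpow x t"
            by (simp add: of_monom_def mult_single add.commute)
          moreover have "keys (u - Poly_Mapping.single x t) \<subseteq> V"
            using single by (auto simp: in_keys_iff lookup_minus)
          then have "Poly_Mapping.single (u - Poly_Mapping.single x t) c \<in> mpolys V" by (simp add: mpolys_def)
          ultimately show ?thesis
            using idl_mult[OF idl' _ adj_mem[OF pidl_mspan[OF assms(2)] fx]] by simp
        qed
      qed (use idl' in \<open>auto intro: idl_zero idl_add\<close>)
    qed
  qed
qed

lemma sum_principal_eq_adj:
  assumes "f \<in> mpolys V"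
  shows "L <+>\<^bsub>mpoly_ring V\<^esub> PIdl\<^bsub>mpoly_ring V\<^esub> f = (padj V L f :: 'k::field mpoly set)"
  unfolding set_add_def' cgenideal_def subring_carrier.adj_def[OF subring_mpolys]
  by (auto simp: mult.commute)

lemma mspan_graded:
  assumes "x \<notin> V" "upset P"
  shows "(mspan (insert x V) P :: 'k::field mpoly set) =
    graded x V (\<lambda>j. mspan V (\<lambda>v. P (v + Poly_Mapping.single x j)))"
proof
  show "(mspan (insert x V) P :: 'k mpoly set) \<subseteq> graded x V (\<lambda>j. mspan V (\<lambda>v. P (v + Poly_Mapping.single x j)))"
    by (auto simp: mspan_def graded_def coef_in in_keys_iff coef.rep_eq split: if_splits)
  show "graded x V (\<lambda>j. mspan V (\<lambda>v. P (v + Poly_Mapping.single x j))) \<subseteq> (mspan (insert x V) P :: 'k mpoly set)"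
  proof
    fix p :: "'k mpoly" assume p: "p \<in> graded x V (\<lambda>j. mspan V (\<lambda>v. P (v + Poly_Mapping.single x j)))"
    have "P u" if u: "u \<in> keys p" for u
    proof -
      let ?v = "u - Poly_Mapping.single x (lookup u x)"
      have "lookup (coef x (lookup u x) p) ?v = lookup p u"
        using monom_split[of u x] by (simp add: coef.rep_eq lookup_minus)
      then have "?v \<in> keys (coef x (lookup u x) p)" using u by (simp add: in_keys_iff)
      then have "P (?v + Poly_Mapping.single x (lookup u x))"
        using graded_coef[OF p, of "lookup u x"] unfolding mspan_def by blast
      then show ?thesis using monom_split[of u x] by simp
    qed
    then show "p \<in> mspan (insert x V) P" using p by (simp add: mspan_def graded_def)
  qed
qed

lemma graded_ideal_mspan:
  assumes "finite V" "x \<notin> V" "upset P"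
  shows "graded_ideal x V (\<lambda>j. mspan V (\<lambda>v. P (v + Poly_Mapping.single x j)) :: 'k::field mpoly set)"
proof
  show "mspan V (\<lambda>v. P (v + Poly_Mapping.single x j)) \<subseteq> (mspan V (\<lambda>v. P (v + Poly_Mapping.single x (Suc j))) :: 'k mpoly set)" for j
  proof (rule mspan_mono)
    fix v assume "P (v + Poly_Mapping.single x j)"
    from upset_add[OF assms(3) this, of "Poly_Mapping.single x 1"]
    show "P (v + Poly_Mapping.single x (Suc j))" by (simp add: add.assoc single_add[symmetric])
  qed
qed (use assms in \<open>simp_all add: pidl_mspan upset_shift\<close>)

text \<open>Adding \<open>x^t\<close> leaves the coefficient ideals in degrees below
  \<open>t\<close> unchanged and turns those from \<open>t\<close> on into the whole ring.\<close>

lemma depth_mspan_truncate: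
  assumes "finite V" "x \<notin> V" "upset P" "t \<ge> 1"
    "\<And>j. j < t \<Longrightarrow> pdepth V r (mspan V (\<lambda>v. P (v + Poly_Mapping.single x j)) :: 'k::field mpoly set)"
  shows "pdepth (insert x V) r (mspan (insert x V) (\<lambda>u. P u \<or> t \<le> lookup u x) :: 'k mpoly set)"
proof -
  let ?Q = "\<lambda>u. P u \<or> t \<le> lookup u x"
  have up: "upset ?Q" by (rule upset_or_lookup[OF assms(3)])
  have lk: "lookup v x = 0" if "keys v \<subseteq> V" for v :: monom using that assms(2) by (auto simp: in_keys_iff)
  show ?thesis
    unfolding mspan_graded[OF assms(2) up]
  proof (rule depth_graded_ge[OF graded_ideal_mspan[OF assms(1,2) up] assms(4)])
    show "mspan V (\<lambda>v. ?Q (v + Poly_Mapping.single x j)) = mpolys V" if "t \<le> j" for j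
      using that by (intro mspan_eq_mpolys) (simp add: lookup_add)
    show "pdepth V r (mspan V (\<lambda>v. ?Q (v + Poly_Mapping.single x j)) :: 'k mpoly set)" if "j < t" for j
    proof -
      have "mspan V (\<lambda>v. ?Q (v + Poly_Mapping.single x j)) = (mspan V (\<lambda>v. P (v + Poly_Mapping.single x j)) :: 'k mpoly set)"
        using that lk by (intro mspan_cong) (auto simp: lookup_add)
      then show ?thesis using assms(5)[OF that] by simp
    qed
  qed
qed

text \<open>Excluding the pure powers of \<open>x\<close> from \<open>P\<close> makes every
  coefficient ideal proper, as \<open>depth_graded_le\<close> requires.\<close>

lemma depth_mspan_component:
  assumes "finite V" "x \<notin> V" "upset P" "\<And>j. \<not> P (Poly_Mapping.single x j)"
    "pdepth (insert x V) (Suc r) (mspan (insert x V) P :: 'k::field mpoly set)"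
  shows "pdepth V r (mspan V (\<lambda>v. P (v + Poly_Mapping.single x j)) :: 'k mpoly set)"
proof (rule depth_graded_le[OF graded_ideal_mspan[OF assms(1-3)]])
  show "mspan V (\<lambda>v. P (v + Poly_Mapping.single x j)) \<subseteq> (mmax V :: 'k mpoly set)" for j
    using assms(4) by (intro mspan_sub_mmax) simp
  show "pdepth (insert x V) (Suc r) (graded x V (\<lambda>j. mspan V (\<lambda>v. P (v + Poly_Mapping.single x j))) :: 'k mpoly set)"
    using assms(5) unfolding mspan_graded[OF assms(2,3)] .
qed

lemma depth_mspan_split:
  assumes "finite V" "x \<in> V" "upset P"
    "pdepth V r (mspan V (\<lambda>u. P (u + Poly_Mapping.single x t)) :: 'k::field mpoly set)"
    "pdepth V r (mspan V (\<lambda>u. P u \<or> t \<le> lookup u x) :: 'k mpoly set)"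
  shows "pdepth V r (mspan V P :: 'k mpoly set)"
  using noetherian_with_ideal.depth_ge_colon_adj[OF noetherian_mpolys[OF assms(1)] pidl_mspan[OF assms(3)]
      xpow_in[OF assms(2)], of r t] assms
  by (simp add: adj_mspan pcolon_eq ideal_colon_mspan)

lemma depth_quot_mspan_ge_iff:
  assumes "finite V" "upset P" "\<not> P 0"
  shows "enat r \<le> depth_quot V (mspan V P :: 'k::field mpoly set) \<longleftrightarrow> pdepth V r (mspan V P :: 'k mpoly set)"
  using assms by (intro depth_quot_ge_iff pidl_mspan mspan_sub_mmax genideal_vars)

section \<open>Stanley decompositions as partitions of monomials\<close>

definition block :: "monom \<times> nat set \<Rightarrow> monom set"
  where "block d = {fst d + w | w. keys w \<subseteq> snd d}"

definition partition :: "nat set \<Rightarrow> (monom \<Rightarrow> bool) \<Rightarrow> (monom \<times> nat set) set \<Rightarrow> bool"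
  where "partition V P D \<longleftrightarrow> finite D \<and> (\<forall>(u, Z)\<in>D. keys u \<subseteq> V \<and> Z \<subseteq> V) \<and>
    (\<forall>d\<in>D. \<forall>v\<in>block d. \<not> P v) \<and> (\<forall>v. keys v \<subseteq> V \<and> \<not> P v \<longrightarrow> (\<exists>!d. d \<in> D \<and> v \<in> block d))"

lift_definition restrict_keys :: "'a set \<Rightarrow> ('a \<Rightarrow>\<^sub>0 'b::zero) \<Rightarrow> 'a \<Rightarrow>\<^sub>0 'b"
  is "\<lambda>B p u. if u \<in> B then p u else 0"
  by (rule rev_finite_subset) auto

lemma keys_restrict_keys: "keys (restrict_keys B p) = keys p \<inter> B"
  by (auto simp: in_keys_iff restrict_keys.rep_eq split: if_splits)

lemma block_keys: "keys (fst d) \<subseteq> V \<Longrightarrow> snd d \<subseteq> V \<Longrightarrow> v \<in> block d \<Longrightarrow> keys v \<subseteq> V"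
  by (fastforce simp: block_def keys_add_nat)

lemma monom_multiples:
  "{of_monom u * q | q. q \<in> mpolys Z} = {p :: 'k::field mpoly. keys p \<subseteq> block (u, Z)}"
proof
  have "keys (of_monom u * q) \<subseteq> block (u, Z)" if "q \<in> mpolys Z" for q :: "'k mpoly"
  proof -
    have "keys (of_monom u * q) = (+) u ` keys q" using keys_mult_of_monom[of q u] by (simp add: mult.commute)
    then show ?thesis using that by (auto simp: block_def mpolys_def)
  qed
  then show "{of_monom u * q | q. q \<in> mpolys Z} \<subseteq> {p :: 'k mpoly. keys p \<subseteq> block (u, Z)}" by blast
  show "{p :: 'k mpoly. keys p \<subseteq> block (u, Z)} \<subseteq> {of_monom u * q | q. q \<in> mpolys Z}"
  proof
    fix p :: "'k mpoly" assume "p \<in> {p. keys p \<subseteq> block (u, Z)}"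
    then have "keys p \<subseteq> block (u, Z)" by simp
    then have "\<exists>q\<in>mpolys Z. p = of_monom u * q"
    proof (induction p rule: poly_mapping_sum_induct)
      case zero
      show ?case by (intro bexI[of _ 0]) (auto simp: zero_in_mpolys)
    next
      case (single v c)
      then obtain w where "v = u + w" "keys w \<subseteq> Z" by (auto simp: block_def)
      then show ?case
        by (intro bexI[of _ "Poly_Mapping.single w c"]) (auto simp: of_monom_def mult_single mpolys_def)
    next
      case (add p q)
      then obtain p' q' where "p' \<in> mpolys Z" "q' \<in> mpolys Z" "p = of_monom u * p'" "q = of_monom u * q'" by blast
      then show ?case by (intro bexI[of _ "p' + q'"]) (auto simp: distrib_left add_in_mpolys)
    qed
    then show "p \<in> {of_monom u * q | q. q \<in> mpolys Z}" by blast
  qed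
qed

lemma stanley_space_eq:
  "stanley_space V L d = (\<lambda>p. L +>\<^bsub>mpoly_ring V\<^esub> p) ` {p :: 'k::field mpoly. keys p \<subseteq> block d}"
proof -
  have "stanley_space V L d = (\<lambda>p. L +>\<^bsub>mpoly_ring V\<^esub> p) ` {of_monom (fst d) * q | q. q \<in> mpolys (snd d)}"
    by (auto simp: stanley_space_def split: prod.split)
  then show ?thesis unfolding monom_multiples by simp
qed

lemma stanley_independent_iff:
  assumes "keys u \<subseteq> V" "Z \<subseteq> V"
  shows "(\<forall>q\<in>mpolys Z. of_monom u * q \<in> (mspan V P :: 'k::field mpoly set) \<longrightarrow> q = 0) \<longleftrightarrow>
    (\<forall>v\<in>block (u, Z). \<not> P v)"
proof
  assume *: "\<forall>q\<in>mpolys Z. of_monom u * q \<in> (mspan V P :: 'k mpoly set) \<longrightarrow> q = 0"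
  show "\<forall>v\<in>block (u, Z). \<not> P v"
  proof (intro ballI notI)
    fix v assume v: "v \<in> block (u, Z)" "P v"
    then obtain w where w: "v = u + w" "keys w \<subseteq> Z" by (auto simp: block_def)
    have "of_monom u * of_monom w \<in> (mspan V P :: 'k mpoly set)"
      using v w assms by (auto simp: of_monom_mult of_monom_in_mspan_iff keys_add_nat)
    moreover have "(of_monom w :: 'k mpoly) \<in> mpolys Z" by (rule of_monom_in_mpolys[OF w(2)])
    ultimately have "(of_monom w :: 'k mpoly) = 0" using * by blast
    then have "lookup (of_monom w :: 'k mpoly) w = 0" by simp
    then show False by (simp add: of_monom_def)
  qed
next
  assume *: "\<forall>v\<in>block (u, Z). \<not> P v"
  show "\<forall>q\<in>mpolys Z. of_monom u * q \<in> (mspan V P :: 'k mpoly set) \<longrightarrow> q = 0"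
  proof (intro ballI impI)
    fix q :: "'k mpoly" assume q: "q \<in> mpolys Z" "of_monom u * q \<in> mspan V P"
    have "of_monom u * q \<in> {of_monom u * q | q. q \<in> mpolys Z}" using q(1) by blast
    then have "keys (of_monom u * q) \<subseteq> block (u, Z)" unfolding monom_multiples by simp
    then have "keys (of_monom u * q) = {}" using * q(2) unfolding mspan_def by blast
    then have "keys q = {}" using keys_mult_of_monom[of q u] by (simp add: mult.commute)
    then show "q = 0" by (metis poly_mapping_eqI in_keys_iff empty_iff lookup_zero)
  qed
qed

lemma (in subring_carrier) sum_mem: "(\<And>d. d \<in> A \<Longrightarrow> g d \<in> R) \<Longrightarrow> sum g A \<in> R"
  by (induction A rule: infinite_finite_induct) (auto simp: mems)

context poly_quotient
begin

lemma finsum_quot: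
  assumes "finite A" "\<And>d. d \<in> A \<Longrightarrow> g d \<in> mpolys V"
  shows "finsum (mpoly_ring V Quot L) (\<lambda>d. cs (g d)) A = cs (\<Sum>d\<in>A. g d)"
proof -
  interpret Q: ring "mpoly_ring V Quot L" by (rule quotient_is_ring)
  show ?thesis
    using assms
  proof (induction A)
    case empty
    show ?case using zero_quot by simp
  next
    case (insert d A)
    then have "finsum (mpoly_ring V Quot L) (\<lambda>d. cs (g d)) (insert d A) =
        cs (g d) \<oplus>\<^bsub>mpoly_ring V Quot L\<^esub> finsum (mpoly_ring V Quot L) (\<lambda>d. cs (g d)) A"
      by (intro Q.finsum_insert) (auto simp: carrier_quot)
    then show ?case using insert sum_mem[of A g] by (simp add: add_quot)
  qed
qed

end

lemma sum_if_unique: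
  assumes "finite D" "d \<in> D" "\<And>e. e \<in> D \<Longrightarrow> e \<noteq> d \<Longrightarrow> f e = 0"
  shows "sum f D = (f d :: 'b::comm_monoid_add)"
  using assms sum.remove[of D d f] by simp

text \<open>Modulo a monomial ideal a class is determined by its coefficients at the monomials
  outside \<open>P\<close>. That every class is a sum from the Stanley spaces then means that the
  blocks cover these monomials, and uniqueness of the summands means that the blocks are
  disjoint.\<close>

lemma stanley_decomp_iff_partition:
  fixes D :: "(monom \<times> nat set) set"
  assumes up: "upset P"
  shows "stanley_decomp V (mspan V P :: 'k::field mpoly set) D \<longleftrightarrow> partition V P D"
proof -
  let ?L = "mspan V P :: 'k mpoly set"
  interpret poly_quotient V ?L by unfold_locales (rule pidl_mspan[OF up])
  let ?Q = "mpoly_ring V Quot ?L"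
  define pre where "pre \<longleftrightarrow> finite D \<and> (\<forall>(u, Z)\<in>D. keys u \<subseteq> V \<and> Z \<subseteq> V) \<and> (\<forall>d\<in>D. \<forall>v\<in>block d. \<not> P v)"
  have main: "(\<forall>C\<in>carrier ?Q. \<exists>!s. s \<in> (\<Pi>\<^sub>E d\<in>D. stanley_space V ?L d) \<and> C = finsum ?Q s D) \<longleftrightarrow>
    (\<forall>v. keys v \<subseteq> V \<and> \<not> P v \<longrightarrow> (\<exists>!d. d \<in> D \<and> v \<in> block d))" (is "?U \<longleftrightarrow> ?E") if pre
  proof -
    interpret Q: ring ?Q by (rule quotient_is_ring)
    have fin: "finite D" and kV: "\<And>d. d \<in> D \<Longrightarrow> keys (fst d) \<subseteq> V" "\<And>d. d \<in> D \<Longrightarrow> snd d \<subseteq> V"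
      and nP: "\<And>d v. d \<in> D \<Longrightarrow> v \<in> block d \<Longrightarrow> \<not> P v"
      using that unfolding pre_def case_prod_beta by blast+
    have bV: "p \<in> mpolys V" if "d \<in> D" "keys p \<subseteq> block d" for d and p :: "'k mpoly"
      using that block_keys[OF kV(1)[OF that(1)] kV(2)[OF that(1)]] by (auto simp: mpolys_def)
    have sumV: "sum g D \<in> mpolys V" if "\<And>d. d \<in> D \<Longrightarrow> keys (g d) \<subseteq> block d" for g :: "_ \<Rightarrow> 'k mpoly"
      using that bV by (intro sum_mem) blast
    have fs: "finsum ?Q (\<lambda>d\<in>D. cs (g d)) D = cs (\<Sum>d\<in>D. g d)"
      if g: "\<And>d. d \<in> D \<Longrightarrow> keys (g d) \<subseteq> block d" for g
    proof -
      have "finsum ?Q (\<lambda>d\<in>D. cs (g d)) D = finsum ?Q (\<lambda>d. cs (g d)) D"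
        using bV g by (intro Q.finsum_cong') (auto simp: carrier_quot)
      then show ?thesis using finsum_quot[OF fin bV] g by simp
    qed
    have inPi: "(\<lambda>d\<in>D. cs (g d)) \<in> (\<Pi>\<^sub>E d\<in>D. stanley_space V ?L d)"
      if "\<And>d. d \<in> D \<Longrightarrow> keys (g d) \<subseteq> block d" for g
      using that by (auto simp: stanley_space_eq)
    have fromPi: "\<exists>g. (\<forall>d\<in>D. keys (g d) \<subseteq> block d) \<and> s = (\<lambda>d\<in>D. cs (g d))"
      if s: "s \<in> (\<Pi>\<^sub>E d\<in>D. stanley_space V ?L d)" for s
    proof -
      have "\<forall>d\<in>D. \<exists>p. keys p \<subseteq> block d \<and> s d = cs p"
      proof
        fix d assume "d \<in> D"
        then have "s d \<in> stanley_space V ?L d" using s by (rule PiE_mem[rotated])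
        then show "\<exists>p. keys p \<subseteq> block d \<and> s d = cs p" by (auto simp: stanley_space_eq)
      qed
      from bchoice[OF this] obtain g where g: "\<forall>d\<in>D. keys (g d) \<subseteq> block d \<and> s d = cs (g d)" by blast
      have "s = (\<lambda>d\<in>D. cs (g d))"
        using g s by (intro extensionalityI[of s D]) (auto simp: PiE_def)
      then show ?thesis using g by blast
    qed
    have lookup_eq: "lookup p v = lookup q v" if "cs p = cs q" "p \<in> mpolys V" "q \<in> mpolys V" "\<not> P v"
      for p q :: "'k mpoly" and v
    proof -
      have "p - q \<in> ?L" using that cs_eq_iff by blast
      then have "v \<notin> keys (p - q)" using that(4) by (auto simp: mspan_def)
      then show ?thesis by (simp add: in_keys_iff lookup_minus)
    qed
    have mV: "(of_monom v :: 'k mpoly) \<in> mpolys V" if "keys v \<subseteq> V" for v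
      using that by (rule of_monom_in_mpolys)
    show ?thesis
    proof
      assume E: ?E
      have disj: "d = e" if "d \<in> D" "e \<in> D" "v \<in> block d" "v \<in> block e" for d e v
      proof -
        have "keys v \<subseteq> V" "\<not> P v" using that block_keys[OF kV] nP by blast+
        then show ?thesis using E that by blast
      qed
      have lk: "lookup (sum g D) v = lookup (g d) v"
        if "d \<in> D" "v \<in> block d" "\<And>d. d \<in> D \<Longrightarrow> keys (g d) \<subseteq> block d" for g :: "_ \<Rightarrow> 'k mpoly" and d v
      proof -
        have "lookup (g e) v = 0" if "e \<in> D" "e \<noteq> d" for e
        proof (rule ccontr)
          assume "lookup (g e) v \<noteq> 0"
          then have "v \<in> block e" using \<open>e \<in> D\<close> \<open>\<And>d. d \<in> D \<Longrightarrow> keys (g d) \<subseteq> block d\<close>[of e] by (auto simp: in_keys_iff)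
          then show False using disj[OF \<open>d \<in> D\<close> \<open>e \<in> D\<close> \<open>v \<in> block d\<close>] that by simp
        qed
        then show ?thesis unfolding lookup_sum using fin that(1) by (intro sum_if_unique) auto
      qed
      show ?U
      proof
        fix C assume "C \<in> carrier ?Q"
        then obtain p where p: "p \<in> mpolys V" "C = cs p" by (auto simp: carrier_quot)
        define g where "g d = restrict_keys (block d) p" for d
        have g: "keys (g d) \<subseteq> block d" for d by (simp add: g_def keys_restrict_keys)
        have "P v" if v: "v \<in> keys (p - sum g D)" for v
        proof (rule ccontr)
          assume "\<not> P v"
          moreover have "p - sum g D \<in> mpolys V" using p sumV[OF g] by (intro mems)
          then have "keys v \<subseteq> V" using v by (auto simp: mpolys_def)
          ultimately obtain d where d: "d \<in> D" "v \<in> block d" using E by blast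
          then have "lookup (sum g D) v = lookup p v"
            using lk[OF d g] by (simp add: g_def restrict_keys.rep_eq)
          then show False using v by (simp add: in_keys_iff lookup_minus)
        qed
        then have "p - sum g D \<in> ?L" using p sumV[OF g] by (auto simp: mspan_def intro: mems)
        then have "C = finsum ?Q (\<lambda>d\<in>D. cs (g d)) D"
          using fs[OF g] p cs_eq_iff[OF p(1) sumV[OF g]] by simp
        moreover have "s = s'"
          if s: "s \<in> (\<Pi>\<^sub>E d\<in>D. stanley_space V ?L d)" "s' \<in> (\<Pi>\<^sub>E d\<in>D. stanley_space V ?L d)"
            "finsum ?Q s D = finsum ?Q s' D" for s s'
        proof -
          obtain h h' where h: "\<forall>d\<in>D. keys (h d) \<subseteq> block d" "s = (\<lambda>d\<in>D. cs (h d))"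
            "\<forall>d\<in>D. keys (h' d) \<subseteq> block d" "s' = (\<lambda>d\<in>D. cs (h' d))"
            using fromPi[OF s(1)] fromPi[OF s(2)] by blast
          then have eq: "cs (sum h D) = cs (sum h' D)" using fs[of h] fs[of h'] s(3) by simp
          have "h d = h' d" if d: "d \<in> D" for d
          proof (rule poly_mapping_eqI)
            fix v
            show "lookup (h d) v = lookup (h' d) v"
            proof (cases "v \<in> block d")
              case True
              then have "\<not> P v" using nP d by blast
              then have "lookup (sum h D) v = lookup (sum h' D) v"
                using lookup_eq[OF eq] sumV h by blast
              then show ?thesis using lk[OF d True] h by simp
            next
              case False
              then have "v \<notin> keys (h d)" "v \<notin> keys (h' d)" using h d by blast+
              then show ?thesis by (simp add: in_keys_iff)
            qed
          qed
          then show ?thesis using h by (auto intro!: restrict_ext)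
        qed
        ultimately show "\<exists>!s. s \<in> (\<Pi>\<^sub>E d\<in>D. stanley_space V ?L d) \<and> C = finsum ?Q s D"
          using inPi[OF g] by (intro ex1I[of _ "\<lambda>d\<in>D. cs (g d)"]) auto
      qed
    next
      assume U: ?U
      show ?E
      proof (intro allI impI)
        fix v assume v: "keys v \<subseteq> V \<and> \<not> P v"
        let ?m = "of_monom v :: 'k mpoly"
        have "cs ?m \<in> carrier ?Q" using mV v by (auto simp: carrier_quot)
        then have ex1: "\<exists>!s. s \<in> (\<Pi>\<^sub>E d\<in>D. stanley_space V ?L d) \<and> cs ?m = finsum ?Q s D" using U by (rule bspec[rotated])
        from ex1_implies_ex[OF this]
        obtain s where s: "s \<in> (\<Pi>\<^sub>E d\<in>D. stanley_space V ?L d)" "cs ?m = finsum ?Q s D"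
          by (elim exE conjE)
        obtain g where g: "\<forall>d\<in>D. keys (g d) \<subseteq> block d" "s = (\<lambda>d\<in>D. cs (g d))" using fromPi[OF s(1)] by blast
        have "cs ?m = cs (sum g D)" using s(2) g fs[of g] by simp
        then have "lookup (sum g D) v = lookup ?m v"
          using lookup_eq[of ?m "sum g D" v] mV v sumV[of g] g by simp
        then have "(\<Sum>d\<in>D. lookup (g d) v) \<noteq> 0" by (simp add: lookup_sum of_monom_def)
        then obtain d where "d \<in> D" "lookup (g d) v \<noteq> 0" by (meson sum.not_neutral_contains_not_neutral)
        moreover from this have "v \<in> keys (g d)" by (simp add: in_keys_iff)
        ultimately have d: "d \<in> D" "v \<in> block d" using g(1) by blast+
        have "e = d" if e: "e \<in> D" "v \<in> block e" for e
        proof (rule ccontr)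
          assume ne: "e \<noteq> d"
          \<comment> \<open>If \<open>v\<close> lay in two blocks, its class could be placed
            entirely in either summand, which gives two decompositions.\<close>
          define h where "h e' = (\<lambda>d. if d = e' then ?m else 0)" for e' :: "monom \<times> nat set"
          have h: "keys (h e' d') \<subseteq> block d'" if "v \<in> block e'" for e' d'
            using that by (auto simp: h_def of_monom_def)
          have "sum (h e') D = ?m" if "e' \<in> D" for e' using fin that by (simp add: h_def)
          then have "cs ?m = finsum ?Q (\<lambda>d'\<in>D. cs (h e' d')) D" if "e' \<in> D" "v \<in> block e'" for e'
            using that fs[OF h] by simp
          then have sol: "(\<lambda>d'\<in>D. cs (h e' d')) \<in> (\<Pi>\<^sub>E d\<in>D. stanley_space V ?L d) \<and>
              cs ?m = finsum ?Q (\<lambda>d'\<in>D. cs (h e' d')) D" if "e' \<in> D" "v \<in> block e'" for e'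
            using that inPi[OF h[OF that(2)]] by simp
          have "(\<lambda>d'\<in>D. cs (h d d')) = (\<lambda>d'\<in>D. cs (h e d'))"
            using the1_equality[OF ex1, OF sol[OF d]] the1_equality[OF ex1, OF sol[OF e]] by simp
          from fun_cong[OF this, of d] have "cs (h d d) = cs (h e d)" using d(1) by simp
          then have "cs ?m = cs 0" using ne by (simp add: h_def)
          then have "lookup ?m v = lookup 0 v" using lookup_eq[of ?m 0 v, OF _ mV zero_mem] v by simp
          then show False by (simp add: of_monom_def)
        qed
        then show "\<exists>!d. d \<in> D \<and> v \<in> block d" using d by blast
      qed
    qed
  qed
  have sd: "stanley_decomp V ?L D \<longleftrightarrow>
      pre \<and> (\<forall>C\<in>carrier ?Q. \<exists>!s. s \<in> (\<Pi>\<^sub>E d\<in>D. stanley_space V ?L d) \<and> C = finsum ?Q s D)"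
  proof -
    have "(\<forall>(u, Z)\<in>D. keys u \<subseteq> V \<and> Z \<subseteq> V \<and> (\<forall>q\<in>mpolys Z. of_monom u * q \<in> ?L \<longrightarrow> q = 0)) \<longleftrightarrow>
      (\<forall>(u, Z)\<in>D. keys u \<subseteq> V \<and> Z \<subseteq> V \<and> (\<forall>v\<in>block (u, Z). \<not> P v))"
      by (intro ball_cong refl) (simp add: case_prod_beta stanley_independent_iff cong: conj_cong)
    moreover have "\<dots> \<longleftrightarrow> (\<forall>(u, Z)\<in>D. keys u \<subseteq> V \<and> Z \<subseteq> V) \<and> (\<forall>d\<in>D. \<forall>v\<in>block d. \<not> P v)"
      by (simp add: case_prod_beta ball_conj_distrib conj_assoc)
    ultimately show ?thesis unfolding stanley_decomp_def pre_def by (simp only: conj_assoc)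
  qed
  have pt: "partition V P D \<longleftrightarrow> pre \<and> (\<forall>v. keys v \<subseteq> V \<and> \<not> P v \<longrightarrow> (\<exists>!d. d \<in> D \<and> v \<in> block d))"
    unfolding partition_def pre_def by (simp only: conj_assoc)
  show ?thesis
  proof (cases pre)
    case True
    show ?thesis unfolding sd pt main[OF True] ..
  next
    case False
    then show ?thesis unfolding sd pt by (simp only: simp_thms)
  qed
qed

text \<open>Restricted to positive bounds: these force some decomposition to exist, whereas
  \<open>0\<close> bounds even an empty supremum.\<close>

lemma sdepth_quot_mspan_ge_iff:
  assumes "upset P"
  shows "enat (Suc r) \<le> sdepth_quot V (mspan V P :: 'k::field mpoly set) \<longleftrightarrow>
    (\<exists>D. partition V P D \<and> (\<forall>d\<in>D. Suc r \<le> card (snd d)))"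
proof -
  have inf: "enat (Suc r) \<le> (INF (u, Z)\<in>D. enat (card Z)) \<longleftrightarrow> (\<forall>d\<in>D. Suc r \<le> card (snd d))"
    for D :: "(monom \<times> nat set) set"
    by (auto simp: le_INF_iff)
  have "enat (Suc r) \<le> sdepth_quot V (mspan V P :: 'k mpoly set) \<longleftrightarrow>
     (\<exists>D. partition V P D \<and> enat (Suc r) \<le> (INF (u, Z)\<in>D. enat (card Z)))"
    unfolding Suc_ile_eq sdepth_quot_def less_SUP_iff stanley_decomp_iff_partition[OF assms] by blast
  then show ?thesis unfolding inf .
qed

definition shift_pair :: "monom \<Rightarrow> monom \<times> nat set \<Rightarrow> monom \<times> nat set"
  where "shift_pair c d = (fst d + c, snd d)"

lemma block_shift: "block (shift_pair c d) = (\<lambda>v. v + c) ` block d"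
  by (auto simp: block_def shift_pair_def image_iff ac_simps) (metis add.commute add.left_commute)

lemma partition_keys: "partition V P D \<Longrightarrow> d \<in> D \<Longrightarrow> v \<in> block d \<Longrightarrow> keys v \<subseteq> V"
  using block_keys[of d V v] unfolding partition_def by fastforce

lemma partition_not: "partition V P D \<Longrightarrow> d \<in> D \<Longrightarrow> v \<in> block d \<Longrightarrow> \<not> P v"
  unfolding partition_def by blast

lemma partition_unique: "partition V P D \<Longrightarrow> d \<in> D \<Longrightarrow> e \<in> D \<Longrightarrow> v \<in> block d \<Longrightarrow> v \<in> block e \<Longrightarrow> d = e"
  using partition_keys partition_not unfolding partition_def by blast

lemma partition_cover: "partition V P D \<Longrightarrow> keys v \<subseteq> V \<Longrightarrow> \<not> P v \<Longrightarrow> \<exists>d\<in>D. v \<in> block d"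
  unfolding partition_def by blast

lemma partitionI:
  assumes "finite D" "\<And>d. d \<in> D \<Longrightarrow> keys (fst d) \<subseteq> V \<and> snd d \<subseteq> V"
    "\<And>d v. d \<in> D \<Longrightarrow> v \<in> block d \<Longrightarrow> \<not> P v"
    "\<And>v. keys v \<subseteq> V \<Longrightarrow> \<not> P v \<Longrightarrow> \<exists>d\<in>D. v \<in> block d"
    "\<And>d e v. d \<in> D \<Longrightarrow> e \<in> D \<Longrightarrow> v \<in> block d \<Longrightarrow> v \<in> block e \<Longrightarrow> d = e"
  shows "partition V P D"
  unfolding partition_def case_prod_beta
proof (intro conjI allI impI)
  show "\<forall>d\<in>D. keys (fst d) \<subseteq> V \<and> snd d \<subseteq> V" using assms(2) by blast
  show "\<forall>d\<in>D. \<forall>v\<in>block d. \<not> P v" using assms(3) by blast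
  show "\<exists>!d. d \<in> D \<and> v \<in> block d" if v: "keys v \<subseteq> V \<and> \<not> P v" for v
  proof -
    obtain d where "d \<in> D" "v \<in> block d" using assms(4) v by blast
    then show ?thesis by (intro ex1I[of _ d]) (blast intro: assms(5))+
  qed
qed (rule assms(1))

lemma partition_finite: "partition V P D \<Longrightarrow> finite D"
  by (simp add: partition_def)

lemma partition_in: "partition V P D \<Longrightarrow> d \<in> D \<Longrightarrow> keys (fst d) \<subseteq> V \<and> snd d \<subseteq> V"
  unfolding partition_def by fastforce

lemma partition_none:
  assumes "\<And>v. keys v \<subseteq> V \<Longrightarrow> \<not> P v"
  shows "partition V P {(0, V)}"
  by (rule partitionI) (use assms in \<open>auto simp: block_def\<close>)

text \<open>The monomials outside \<open>P\<close> of degree \<open>j < t\<close> in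
  \<open>x\<close> are the translates by \<open>x^j\<close> of those outside the coefficient ideal
  of degree \<open>j\<close>.\<close>

lemma partition_truncate:
  assumes x: "x \<notin> V" and D: "\<And>j. j < t \<Longrightarrow> partition V (\<lambda>v. P (v + Poly_Mapping.single x j)) (D j)"
  shows "partition (insert x V) (\<lambda>u. P u \<or> t \<le> lookup u x)
    (\<Union>j<t. shift_pair (Poly_Mapping.single x j) ` D j)"
proof (rule partitionI)
  have lk: "lookup v x = 0" if "d \<in> D j" "j < t" "v \<in> block d" for j d v
    using partition_keys[OF D[OF that(2)] that(1,3)] x by (auto simp: in_keys_iff)
  have ex: "\<exists>j e w. j < t \<and> e \<in> D j \<and> w \<in> block e \<and> v = w + Poly_Mapping.single x j \<and>
      d = shift_pair (Poly_Mapping.single x j) e"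
    if d: "d \<in> (\<Union>j<t. shift_pair (Poly_Mapping.single x j) ` D j)" "v \<in> block d" for d v
  proof -
    obtain j e where e: "j < t" "e \<in> D j" "d = shift_pair (Poly_Mapping.single x j) e" using d(1) by blast
    then obtain w where "w \<in> block e" "v = w + Poly_Mapping.single x j" using d(2) by (auto simp: block_shift)
    then show ?thesis using e by blast
  qed
  show "finite (\<Union>j<t. shift_pair (Poly_Mapping.single x j) ` D j)"
    using partition_finite[OF D] by auto
  show "keys (fst d) \<subseteq> insert x V \<and> snd d \<subseteq> insert x V"
    if "d \<in> (\<Union>j<t. shift_pair (Poly_Mapping.single x j) ` D j)" for d
    using that partition_in[OF D] by (fastforce simp: shift_pair_def keys_add_nat split: if_splits)
  show "\<not> (P v \<or> t \<le> lookup v x)"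
    if dv: "d \<in> (\<Union>j<t. shift_pair (Poly_Mapping.single x j) ` D j)" "v \<in> block d" for d v
  proof -
    obtain j e w where e: "j < t" "e \<in> D j" "w \<in> block e" "v = w + Poly_Mapping.single x j"
      using ex[OF dv] by blast
    then show ?thesis using partition_not[OF D[OF e(1)] e(2,3)] lk[OF e(2,1,3)] by (simp add: lookup_add)
  qed
  show "\<exists>d\<in>\<Union>j<t. shift_pair (Poly_Mapping.single x j) ` D j. v \<in> block d"
    if v: "keys v \<subseteq> insert x V" "\<not> (P v \<or> t \<le> lookup v x)" for v
  proof -
    let ?j = "lookup v x" and ?w = "v - Poly_Mapping.single x (lookup v x)"
    have w: "v = ?w + Poly_Mapping.single x ?j" by (rule monom_split)
    have "keys ?w \<subseteq> V" using v by (auto simp: keys_minus_single)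
    moreover have "\<not> P (?w + Poly_Mapping.single x ?j)" using v w by simp
    moreover have j: "?j < t" using v by simp
    ultimately obtain d where d: "d \<in> D ?j" "?w \<in> block d" using partition_cover[OF D] by blast
    then have "v \<in> block (shift_pair (Poly_Mapping.single x ?j) d)" using w by (auto simp: block_shift)
    then show ?thesis using d j by blast
  qed
  show "d = e" if de: "d \<in> (\<Union>j<t. shift_pair (Poly_Mapping.single x j) ` D j)"
    "e \<in> (\<Union>j<t. shift_pair (Poly_Mapping.single x j) ` D j)" "v \<in> block d" "v \<in> block e" for d e v
  proof -
    obtain j d' w where d: "j < t" "d' \<in> D j" "w \<in> block d'" "v = w + Poly_Mapping.single x j"
      "d = shift_pair (Poly_Mapping.single x j) d'"
      using ex[OF de(1,3)] by blast
    obtain i e' z where e: "i < t" "e' \<in> D i" "z \<in> block e'" "v = z + Poly_Mapping.single x i"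
      "e = shift_pair (Poly_Mapping.single x i) e'"
      using ex[OF de(2,4)] by blast
    have "lookup v x = j" "lookup v x = i"
      using lk[OF d(2,1,3)] lk[OF e(2,1,3)] by (simp add: d(4) lookup_add, simp add: e(4) lookup_add)
    then have "i = j" "w = z" using d e by auto
    then have "d' = e'" using partition_unique[OF D[OF d(1)] d(2) _ d(3)] e by blast
    then show ?thesis using d e \<open>i = j\<close> by simp
  qed
qed

text \<open>Among the monomials outside \<open>P\<close>, the translate of \<open>D1\<close>
  accounts for those divisible by \<open>x^t\<close> and \<open>D2\<close> for the others.\<close>

lemma partition_split:
  assumes x: "x \<in> V" and D1: "partition V (\<lambda>u. P (u + Poly_Mapping.single x t)) D1"
    and D2: "partition V (\<lambda>u. P u \<or> t \<le> lookup u x) D2"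
  shows "partition V P (shift_pair (Poly_Mapping.single x t) ` D1 \<union> D2)"
proof (rule partitionI)
  let ?D = "shift_pair (Poly_Mapping.single x t) ` D1 \<union> D2"
  have lt: "lookup v x < t" if "d \<in> D2" "v \<in> block d" for d v using partition_not[OF D2 that] by simp
  have ge: "lookup v x \<ge> t" if "d \<in> D1" "v \<in> block (shift_pair (Poly_Mapping.single x t) d)" for d v
    using that by (auto simp: block_shift lookup_add)
  show "finite ?D" using partition_finite[OF D1] partition_finite[OF D2] by simp
  show "keys (fst d) \<subseteq> V \<and> snd d \<subseteq> V" if "d \<in> ?D" for d
    using that partition_in[OF D1] partition_in[OF D2] x
    by (fastforce simp: shift_pair_def keys_add_nat split: if_splits)
  show "\<not> P v" if dv: "d \<in> ?D" "v \<in> block d" for d v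
    using dv(1)
  proof
    assume "d \<in> D2"
    then show ?thesis using partition_not[OF D2 _ dv(2)] by blast
  next
    assume "d \<in> shift_pair (Poly_Mapping.single x t) ` D1"
    then obtain e w where "e \<in> D1" "w \<in> block e" "v = w + Poly_Mapping.single x t"
      using dv(2) block_shift by blast
    then show ?thesis using partition_not[OF D1] by blast
  qed
  show "\<exists>d\<in>?D. v \<in> block d" if v: "keys v \<subseteq> V" "\<not> P v" for v
  proof (cases "t \<le> lookup v x")
    case True
    let ?w = "v - Poly_Mapping.single x t"
    have w: "v = ?w + Poly_Mapping.single x t"
      using True by (subst add.commute, intro monom_diff_add[symmetric]) (auto simp: lookup_single when_def)
    have "keys ?w \<subseteq> V" using v by (auto simp: in_keys_iff lookup_minus)
    moreover have "\<not> P (?w + Poly_Mapping.single x t)" using v w by simp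
    ultimately obtain d where "d \<in> D1" "?w \<in> block d" using partition_cover[OF D1] by blast
    then show ?thesis using w by (intro bexI[of _ "shift_pair (Poly_Mapping.single x t) d"]) (auto simp: block_shift)
  next
    case False
    then show ?thesis using partition_cover[OF D2] v by blast
  qed
  show "d = e" if de: "d \<in> ?D" "e \<in> ?D" "v \<in> block d" "v \<in> block e" for d e v
  proof (cases "t \<le> lookup v x")
    case True
    then have "d \<notin> D2" "e \<notin> D2" using lt[of d v] lt[of e v] de(3,4) by (meson leD)+
    then obtain d' e' where d': "d' \<in> D1" "d = shift_pair (Poly_Mapping.single x t) d'"
      and e': "e' \<in> D1" "e = shift_pair (Poly_Mapping.single x t) e'" using de(1,2) by blast
    obtain w where "v = w + Poly_Mapping.single x t" "w \<in> block d'" "w \<in> block e'"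
      using de(3,4) unfolding d' e' block_shift by auto
    then show ?thesis using partition_unique[OF D1 d'(1) e'(1)] d' e' by blast
  next
    case False
    then have "d \<in> D2" "e \<in> D2" using ge de by blast+
    then show ?thesis using partition_unique[OF D2 _ _ de(3,4)] by blast
  qed
qed

lemma partition_free:
  assumes x: "x \<notin> V" and D: "partition V P D"
    and P: "\<And>v j. P (v + Poly_Mapping.single x j) \<longleftrightarrow> P v"
  shows "partition (insert x V) P ((\<lambda>d. (fst d, insert x (snd d))) ` D)"
proof (rule partitionI)
  let ?f = "\<lambda>d. (fst d, insert x (snd d)) :: monom \<times> nat set"
  have blk: "v \<in> block (?f d) \<longleftrightarrow> v - Poly_Mapping.single x (lookup v x) \<in> block d" if d: "d \<in> D" for d v
  proof -
    let ?w = "v - Poly_Mapping.single x (lookup v x)"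
    have fd: "lookup (fst d) x = 0" using partition_in[OF D d] x by (auto simp: in_keys_iff)
    show ?thesis
    proof
      assume "v \<in> block (?f d)"
      then obtain z where z: "v = fst d + z" "keys z \<subseteq> insert x (snd d)" by (auto simp: block_def)
      let ?z = "z - Poly_Mapping.single x (lookup z x)"
      have "?w = fst d + ?z"
        using fd z by (auto simp: poly_mapping_eq_iff fun_eq_iff lookup_add lookup_minus lookup_single when_def)
      moreover have "keys ?z \<subseteq> snd d" using z by (auto simp: keys_minus_single)
      ultimately show "?w \<in> block d" by (auto simp: block_def)
    next
      assume "?w \<in> block d"
      then obtain z where z: "?w = fst d + z" "keys z \<subseteq> snd d" by (auto simp: block_def)
      have "v = fst d + (z + Poly_Mapping.single x (lookup v x))"
        using monom_split[of v x] z by (simp add: add.assoc)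
      moreover have "keys (z + Poly_Mapping.single x (lookup v x)) \<subseteq> insert x (snd d)"
        using z by (auto simp: keys_add_nat split: if_splits)
      ultimately show "v \<in> block (?f d)" unfolding block_def by auto
    qed
  qed
  have Pw: "P (v - Poly_Mapping.single x (lookup v x)) \<longleftrightarrow> P v" for v
    using P[of "v - Poly_Mapping.single x (lookup v x)" "lookup v x"] monom_split[of v x] by simp
  show "finite (?f ` D)" using partition_finite[OF D] by simp
  show "keys (fst d) \<subseteq> insert x V \<and> snd d \<subseteq> insert x V" if "d \<in> ?f ` D" for d
    using that partition_in[OF D] by fastforce
  show "\<not> P v" if "d \<in> ?f ` D" "v \<in> block d" for d v
    using that blk partition_not[OF D] Pw[of v] by auto
  show "\<exists>d\<in>?f ` D. v \<in> block d" if v: "keys v \<subseteq> insert x V" "\<not> P v" for v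
  proof -
    let ?w = "v - Poly_Mapping.single x (lookup v x)"
    have "keys ?w \<subseteq> V" using v by (auto simp: keys_minus_single)
    then obtain d where "d \<in> D" "?w \<in> block d" using partition_cover[OF D, of ?w] v Pw[of v] by blast
    then show ?thesis using blk by blast
  qed
  show "d = e" if de: "d \<in> ?f ` D" "e \<in> ?f ` D" "v \<in> block d" "v \<in> block e" for d e v
  proof -
    obtain d' e' where "d' \<in> D" "e' \<in> D" "d = ?f d'" "e = ?f e'" using de by blast
    then show ?thesis using de blk partition_unique[OF D] by metis
  qed
qed

section \<open>A common recursion for depth and Stanley depth\<close>

lemma partition_cong:
  assumes "\<And>v. keys v \<subseteq> V \<Longrightarrow> P v \<longleftrightarrow> Q v" "partition V P D"
  shows "partition V Q D"
proof (rule partitionI)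
  show "\<not> Q v" if "d \<in> D" "v \<in> block d" for d v
    using assms(1) partition_keys[OF assms(2) that] partition_not[OF assms(2) that] by blast
  show "\<exists>d\<in>D. v \<in> block d" if "keys v \<subseteq> V" "\<not> Q v" for v
    using assms(1) partition_cover[OF assms(2) that(1)] that by blast
qed (fact partition_finite[OF assms(2)] partition_in[OF assms(2)] partition_unique[OF assms(2)])+

text \<open>The variable \<open>x\<close> is regular modulo such an ideal, and adjoining it leaves a
  single proper coefficient ideal at most, that of degree \<open>0\<close>.\<close>

lemma depth_mspan_free:
  assumes V: "finite V" "x \<notin> V" and up: "upset P"
    and P: "\<And>v j. P (v + Poly_Mapping.single x j) \<longleftrightarrow> P v"
    and d: "pdepth V r (mspan V P :: 'k::field mpoly set)"
  shows "pdepth (insert x V) (Suc r) (mspan (insert x V) P :: 'k mpoly set)"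
proof -
  interpret noetherian_with_ideal "mpolys (insert x V) :: 'k mpoly set" "mmax (insert x V)"
    by (rule noetherian_mpolys) (simp add: V)
  let ?x = "xpow x 1 :: 'k mpoly"
  have "nzd (mspan (insert x V) P) ?x"
    unfolding nzd_def
  proof (intro ballI impI)
    fix z :: "'k mpoly" assume z: "z \<in> mpolys (insert x V)" "?x * z \<in> mspan (insert x V) P"
    have "P u" if "u \<in> keys z" for u
    proof -
      have "Poly_Mapping.single x 1 + u \<in> keys (?x * z)"
        using that keys_mult_of_monom[of z "Poly_Mapping.single x 1"] by (simp add: mult.commute)
      then have "P (Poly_Mapping.single x 1 + u)" using z(2) unfolding mspan_def by blast
      then show ?thesis using P[of u 1] by (simp add: add.commute)
    qed
    then show "z \<in> mspan (insert x V) P" using z(1) by (simp add: mspan_def)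
  qed
  moreover have "?x \<in> mmax (insert x V)"
    using xpow_in[of x "insert x V" 1] by (auto simp: mmax_def of_monom_def lookup_single when_def dest: arg_cong[of _ _ "\<lambda>u. lookup u x"])
  moreover have "depth_ge r (adj (mspan (insert x V) P) ?x)"
    using depth_mspan_truncate[OF V up, of 1 r] d P by (subst adj_mspan) (auto simp: up)
  ultimately show ?thesis by auto
qed

text \<open>The first alternative is the zero module, which both recursions may ignore.\<close>

definition depths_ge :: "'k::field itself \<Rightarrow> nat set \<Rightarrow> (monom \<Rightarrow> bool) \<Rightarrow> nat \<Rightarrow> bool"
  where "depths_ge _ V P r \<longleftrightarrow> P 0 \<or>
    (pdepth V r (mspan V P :: 'k mpoly set) \<and> (\<exists>D. partition V P D \<and> (\<forall>d\<in>D. r \<le> card (snd d))))"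

lemma depths_ge_cong:
  assumes "\<And>v. keys v \<subseteq> V \<Longrightarrow> P v \<longleftrightarrow> Q v" "depths_ge TYPE('k::field) V P r"
  shows "depths_ge TYPE('k) V Q r"
proof -
  have "mspan V P = (mspan V Q :: 'k mpoly set)" using assms(1) by (rule mspan_cong)
  moreover have "P 0 \<longleftrightarrow> Q 0" using assms(1)[of 0] by simp
  ultimately show ?thesis
    using assms(2) partition_cong[of V P Q, OF assms(1)] unfolding depths_ge_def by auto
qed

lemma depths_ge_mono:
  assumes "finite V" "depths_ge TYPE('k::field) V P r" "q \<le> r"
  shows "depths_ge TYPE('k) V P q"
  using assms noetherian_with_ideal.depth_ge_mono[OF noetherian_mpolys[OF assms(1)], of r "mspan V P :: 'k mpoly set" q]
  unfolding depths_ge_def by (meson order_trans)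

lemma depths_ge_free:
  assumes V: "finite V" "x \<notin> V" and up: "upset P"
    and P: "\<And>v j. P (v + Poly_Mapping.single x j) \<longleftrightarrow> P v"
    and b: "depths_ge TYPE('k::field) V P r"
  shows "depths_ge TYPE('k) (insert x V) P (Suc r)"
proof (cases "P 0")
  case False
  then obtain D where D: "pdepth V r (mspan V P :: 'k mpoly set)" "partition V P D" "\<forall>d\<in>D. r \<le> card (snd d)"
    using b by (auto simp: depths_ge_def)
  let ?D = "(\<lambda>d. (fst d, insert x (snd d))) ` D"
  have "Suc r \<le> card (snd e)" if e: "e \<in> ?D" for e
  proof -
    obtain d where d: "d \<in> D" "e = (fst d, insert x (snd d))" using e by (elim imageE)
    then have "snd d \<subseteq> V" using partition_in[OF D(2)] by blast
    then have "finite (snd d)" "x \<notin> snd d" using V finite_subset by blast+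
    then show ?thesis using d D(3) by simp
  qed
  then show ?thesis
    using depth_mspan_free[OF V up P D(1)] partition_free[OF V(2) D(2) P] unfolding depths_ge_def by blast
qed (simp add: depths_ge_def)

lemma depths_ge_free_set:
  assumes "finite W" "finite V" "V \<inter> W = {}" "upset P"
    "\<And>x v j. x \<in> W \<Longrightarrow> P (v + Poly_Mapping.single x j) \<longleftrightarrow> P v" "depths_ge TYPE('k::field) V P r"
  shows "depths_ge TYPE('k) (V \<union> W) P (r + card W)"
  using assms
proof (induction W)
  case (insert x W)
  have "depths_ge TYPE('k) (V \<union> W) P (r + card W)" using insert by auto
  then have "depths_ge TYPE('k) (insert x (V \<union> W)) P (Suc (r + card W))"
    using insert.prems insert.hyps by (intro depths_ge_free) auto
  then show ?case using insert.hyps by simp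
qed simp

lemma depths_ge_none:
  assumes "finite V" "\<And>v. keys v \<subseteq> V \<Longrightarrow> \<not> P v" "r \<le> card V"
  shows "depths_ge TYPE('k::field) V P r"
proof -
  let ?F = "\<lambda>_::monom. False"
  have up: "upset ?F" by (simp add: upset_def)
  have "pdepth {} 0 (mspan {} ?F :: 'k mpoly set)"
    unfolding noetherian_with_ideal.depth_ge.simps(1)[OF noetherian_mpolys[OF finite.emptyI]]
    by (rule mspan_sub_mmax) simp
  then have "depths_ge TYPE('k) {} ?F 0"
    using partition_none[of "{}" ?F] unfolding depths_ge_def by (auto intro: exI[of _ "{(0, {})}"])
  then have "depths_ge TYPE('k) ({} \<union> V) ?F (0 + card V)" using assms(1) up by (intro depths_ge_free_set) auto
  then have "depths_ge TYPE('k) V P (card V)" using assms(2) by (intro depths_ge_cong[of V ?F P]) auto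
  then show ?thesis using depths_ge_mono assms by blast
qed

lemma depths_ge_pivot:
  assumes V: "finite V" "x \<notin> V" and up: "upset P"
    and b1: "depths_ge TYPE('k::field) (insert x V) (\<lambda>u. P (u + Poly_Mapping.single x 1)) r"
    and b2: "depths_ge TYPE('k) V P r"
  shows "depths_ge TYPE('k) (insert x V) P r"
proof (cases "P 0")
  case P0: False
  let ?Q = "\<lambda>u. P u \<or> 1 \<le> lookup u x"
  obtain D where D: "pdepth V r (mspan V P :: 'k mpoly set)" "partition V P D" "\<forall>d\<in>D. r \<le> card (snd d)"
    using b2 P0 by (auto simp: depths_ge_def)
  have d2: "pdepth (insert x V) r (mspan (insert x V) ?Q :: 'k mpoly set)"
    using D(1) by (intro depth_mspan_truncate[OF V up]) auto
  have "partition (insert x V) ?Q (\<Union>j<1. shift_pair (Poly_Mapping.single x j) ` D)"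
    using D(2) by (intro partition_truncate[OF V(2)]) simp
  then obtain D2 where p2: "partition (insert x V) ?Q D2" and c2: "\<forall>d\<in>D2. r \<le> card (snd d)"
    using D(3) by (fastforce simp: shift_pair_def)
  show ?thesis
  proof (cases "P (Poly_Mapping.single x 1)")
    \<comment> \<open>Here \<open>x\<close> lies in the ideal, so \<open>b1\<close> concerns the
      zero module and carries no information, but adjoining \<open>x\<close> changes
      nothing.\<close>
    case True
    have "P u" if "1 \<le> lookup u x" for u
    proof -
      have "u = Poly_Mapping.single x 1 + (u - Poly_Mapping.single x 1)"
        using that by (intro monom_diff_add[symmetric]) (auto simp: lookup_single when_def)
      then show ?thesis using upset_add[OF up True] by metis
    qed
    then have "?Q = P" by auto
    then show ?thesis using d2 p2 c2 unfolding depths_ge_def by auto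
  next
    case False
    then obtain D1 where D1: "pdepth (insert x V) r (mspan (insert x V) (\<lambda>u. P (u + Poly_Mapping.single x 1)) :: 'k mpoly set)"
      "partition (insert x V) (\<lambda>u. P (u + Poly_Mapping.single x 1)) D1" "\<forall>d\<in>D1. r \<le> card (snd d)"
      using b1 by (auto simp: depths_ge_def)
    have "pdepth (insert x V) r (mspan (insert x V) P :: 'k mpoly set)"
      using depth_mspan_split[OF _ _ up D1(1) d2] V by simp
    moreover have "partition (insert x V) P (shift_pair (Poly_Mapping.single x 1) ` D1 \<union> D2)"
      using partition_split[OF _ D1(2) p2] by simp
    moreover have "\<forall>d\<in>shift_pair (Poly_Mapping.single x 1) ` D1 \<union> D2. r \<le> card (snd d)"
      using c2 D1(3) by (auto simp: shift_pair_def)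
    ultimately show ?thesis unfolding depths_ge_def by blast
  qed
qed (simp add: depths_ge_def)

section \<open>Powers of path ideals\<close>

definition interval :: "nat \<Rightarrow> nat \<Rightarrow> monom"
  where "interval a b = (\<Sum>i\<in>{a..<b}. Poly_Mapping.single i 1)"

lemma lookup_interval: "lookup (interval a b) x = (if a \<le> x \<and> x < b then 1 else 0)"
  by (simp add: interval_def lookup_sum lookup_single when_def)

lemma interval_eq_sum: "(\<Sum>j<m. Poly_Mapping.single (i + j) 1) = interval i (i + m)"
  unfolding interval_def using sum.shift_bounds_nat_ivl[of "\<lambda>k. Poly_Mapping.single k (1::nat)" 0 i m]
  by (simp add: atLeast0LessThan add.commute)

lemma interval_Suc: "a \<le> b \<Longrightarrow> interval a b + Poly_Mapping.single b 1 = interval a (Suc b)"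
  by (simp add: interval_def)

lemma interval_Suc_left: "a < b \<Longrightarrow> Poly_Mapping.single a 1 + interval (Suc a) b = interval a b"
  by (simp add: interval_def sum.atLeast_Suc_lessThan)

text \<open>The exponent of \<open>x\<close> in the product of the paths whose initial vertices are
  listed in \<open>is\<close>.\<close>

definition covering :: "nat \<Rightarrow> nat list \<Rightarrow> nat \<Rightarrow> nat"
  where "covering m is x = length (filter (\<lambda>i. i \<le> x \<and> x < i + m) is)"

text \<open>The \<open>t\<close>-th power of the \<open>m\<close>-path ideal of the path on \<open>{1, \<dots>, n}\<close>, a product of \<open>t\<close> generators
  being given by the list of the initial vertices.\<close>

definition path_pow :: "nat \<Rightarrow> nat \<Rightarrow> nat \<Rightarrow> monom \<Rightarrow> bool"
  where "path_pow m n t u \<longleftrightarrow> (\<exists>is. length is = t \<and> (\<forall>i\<in>set is. 1 \<le> i \<and> i + m \<le> n + 1) \<and>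
    (\<forall>x. covering m is x \<le> lookup u x))"

lemma covering_Nil [simp]: "covering m [] x = 0"
  by (simp add: covering_def)

lemma covering_Cons: "covering m (i # is) x = (if i \<le> x \<and> x < i + m then 1 else 0) + covering m is x"
  by (simp add: covering_def)

lemma covering_remove1:
  "i \<in> set is \<Longrightarrow> covering m is x = (if i \<le> x \<and> x < i + m then 1 else 0) + covering m (remove1 i is) x"
  by (induction "is") (auto simp: covering_Cons)

lemma covering_pos: "i \<in> set is \<Longrightarrow> i \<le> x \<Longrightarrow> x < i + m \<Longrightarrow> 1 \<le> covering m is x"
  using covering_remove1[of i "is" m x] by simp

lemma covering_zero: "(\<And>i. i \<in> set is \<Longrightarrow> \<not> (i \<le> x \<and> x < i + m)) \<Longrightarrow> covering m is x = 0"
  by (induction "is") (auto simp: covering_Cons)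

lemma upset_path_pow: "upset (path_pow m n t)"
  unfolding upset_def path_pow_def by (auto simp: lookup_add intro!: trans_le_add1)

lemma path_pow_0 [simp]: "path_pow m n 0 u"
  by (simp add: path_pow_def)

lemma ppow_line:
  "ppow (generated {interval i (i + m) | i. 1 \<le> i \<and> i + m \<le> n + 1}) t = path_pow m n t"
proof (induction t)
  case 0
  show ?case by (auto simp: fun_eq_iff)
next
  case (Suc t)
  have "psum (path_pow m n t) (generated {interval i (i + m) | i. 1 \<le> i \<and> i + m \<le> n + 1}) u \<longleftrightarrow>
    path_pow m n (Suc t) u" for u
  proof
    assume "psum (path_pow m n t) (generated {interval i (i + m) | i. 1 \<le> i \<and> i + m \<le> n + 1}) u"
    then obtain a i w where u: "u = a + (interval i (i + m) + w)" "path_pow m n t a" "1 \<le> i" "i + m \<le> n + 1"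
      by (auto simp: psum_def generated_def)
    then obtain "is" where "length is = t" "\<forall>i\<in>set is. 1 \<le> i \<and> i + m \<le> n + 1" "\<forall>x. covering m is x \<le> lookup a x"
      by (auto simp: path_pow_def)
    then show "path_pow m n (Suc t) u" unfolding path_pow_def using u
      by (intro exI[of _ "i # is"]) (auto simp: covering_Cons lookup_add lookup_interval intro: trans_le_add1)
  next
    assume "path_pow m n (Suc t) u"
    then obtain i "is" where ix: "length is = t" "\<forall>i\<in>set is. 1 \<le> i \<and> i + m \<le> n + 1" "1 \<le> i" "i + m \<le> n + 1"
      "\<forall>x. covering m (i # is) x \<le> lookup u x"
      by (auto simp: path_pow_def length_Suc_conv)
    have "lookup (interval i (i + m)) x + covering m is x \<le> lookup u x" for x
      using ix(5)[rule_format, of x] by (simp add: covering_Cons lookup_interval)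
    then have le: "lookup (interval i (i + m)) x \<le> lookup u x"
      "covering m is x \<le> lookup u x - lookup (interval i (i + m)) x" for x
      by (meson add_leD1, metis add.commute le_diff_conv2 add_leD1)
    have "path_pow m n t (u - interval i (i + m))"
      unfolding path_pow_def using ix le(2) by (auto simp: lookup_minus)
    moreover have "u = (u - interval i (i + m)) + interval i (i + m)"
      using monom_diff_add[OF le(1)] by (simp add: add.commute)
    moreover have "generated {interval i (i + m) | i. 1 \<le> i \<and> i + m \<le> n + 1} (interval i (i + m))"
      using ix by (intro generated_self) auto
    ultimately show "psum (path_pow m n t) (generated {interval i (i + m) | i. 1 \<le> i \<and> i + m \<le> n + 1}) u"
      unfolding psum_def by blast
  qed
  then show ?case unfolding ppow.simps Suc.IH by (intro ext)
qed

lemma path_pow_cong: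
  assumes "\<And>x. x \<le> n \<Longrightarrow> lookup u x = lookup v x"
  shows "path_pow m n t u \<longleftrightarrow> path_pow m n t v"
proof -
  have "path_pow m n t v" if "path_pow m n t u" "\<And>x. x \<le> n \<Longrightarrow> lookup u x = lookup v x" for u v
  proof -
    obtain "is" where ix: "length is = t" "\<forall>i\<in>set is. 1 \<le> i \<and> i + m \<le> n + 1" "\<forall>x. covering m is x \<le> lookup u x"
      using \<open>path_pow m n t u\<close> by (auto simp: path_pow_def)
    have "covering m is x \<le> lookup v x" for x
    proof (cases "x \<le> n")
      case True
      then show ?thesis using ix(3) that(2) by metis
    next
      case False
      then have "covering m is x = 0" using ix(2) by (intro covering_zero) fastforce
      then show ?thesis by simp
    qed
    then show ?thesis using ix by (auto simp: path_pow_def)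
  qed
  then show ?thesis using assms by metis
qed

text \<open>A generator of largest initial vertex contains every vertex of the last path that is covered at
  all by the remaining ones.\<close>

lemma path_pow_colon_last:
  assumes "m \<le> n"
  shows "path_pow m n (Suc t) (v + interval (n + 1 - m) (n + 1)) \<longleftrightarrow> path_pow m n t v"
proof
  assume "path_pow m n t v"
  then obtain "is" where "length is = t" "\<forall>i\<in>set is. 1 \<le> i \<and> i + m \<le> n + 1" "\<forall>x. covering m is x \<le> lookup v x"
    by (auto simp: path_pow_def)
  then show "path_pow m n (Suc t) (v + interval (n + 1 - m) (n + 1))"
    unfolding path_pow_def using assms
    by (intro exI[of _ "(n + 1 - m) # is"]) (auto simp: covering_Cons lookup_add lookup_interval)
next
  assume "path_pow m n (Suc t) (v + interval (n + 1 - m) (n + 1))"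
  then obtain "is" where ix: "length is = Suc t" "\<forall>i\<in>set is. 1 \<le> i \<and> i + m \<le> n + 1"
    "\<And>x. covering m is x \<le> lookup (v + interval (n + 1 - m) (n + 1)) x"
    by (auto simp: path_pow_def)
  define i where "i = Max (set is)"
  have "set is \<noteq> {}" using ix(1) by auto
  then have i: "i \<in> set is" "\<And>j. j \<in> set is \<Longrightarrow> j \<le> i" by (auto simp: i_def)
  let ?is = "remove1 i is"
  have sub: "set ?is \<subseteq> set is" by (rule set_remove1_subset)
  have "covering m ?is x \<le> lookup v x" for x
  proof (cases "n + 1 - m \<le> x \<and> x < n + 1 \<and> i + m \<le> x")
    case True
    then have "covering m ?is x = 0" using i(2) sub by (intro covering_zero) fastforce
    then show ?thesis by simp
  next
    case False
    then show ?thesis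
      using ix(3)[of x] covering_remove1[OF i(1), of m x] ix(2) i(1)
      by (fastforce simp: lookup_add lookup_interval split: if_splits)
  qed
  then show "path_pow m n t v"
    unfolding path_pow_def using ix(1,2) i(1) sub
    by (intro exI[of _ ?is]) (auto simp: length_remove1)
qed

text \<open>By \<open>n < p + m\<close> every path ending at \<open>p\<close> or later passes
  through \<open>p\<close>, so a vanishing exponent there forces all factors to end before
  \<open>p\<close>.\<close>

lemma path_pow_restrict:
  assumes "lookup v p = 0" "1 \<le> p" "p \<le> n" "n < p + m"
  shows "path_pow m n t v \<longleftrightarrow> path_pow m (p - 1) t v"
proof
  assume "path_pow m n t v"
  then obtain "is" where ix: "length is = t" "\<forall>i\<in>set is. 1 \<le> i \<and> i + m \<le> n + 1" "\<forall>x. covering m is x \<le> lookup v x"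
    by (auto simp: path_pow_def)
  have "i + m \<le> p - 1 + 1" if i: "i \<in> set is" for i
  proof (rule ccontr)
    assume "\<not> i + m \<le> p - 1 + 1"
    moreover have "i + m \<le> n + 1" using ix(2) i by blast
    ultimately have "i \<le> p \<and> p < i + m" using assms by linarith
    then have "1 \<le> covering m is p" using covering_pos[OF i] by blast
    then show False using ix(3) assms(1) by (metis not_one_le_zero le_zero_eq)
  qed
  then show "path_pow m (p - 1) t v" unfolding path_pow_def using ix by blast
next
  assume "path_pow m (p - 1) t v"
  then obtain "is" where ix: "length is = t" "\<forall>i\<in>set is. 1 \<le> i \<and> i + m \<le> p - 1 + 1" "\<forall>x. covering m is x \<le> lookup v x"
    by (auto simp: path_pow_def)
  have "\<forall>i\<in>set is. 1 \<le> i \<and> i + m \<le> n + 1" using ix(2) assms by fastforce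
  then show "path_pow m n t v" unfolding path_pow_def using ix by blast
qed

lemma path_pow_small:
  assumes "n < m" "1 \<le> t"
  shows "\<not> path_pow m n t u"
proof
  assume "path_pow m n t u"
  then obtain "is" where ix: "length is = t" "\<forall>i\<in>set is. 1 \<le> i \<and> i + m \<le> n + 1"
    by (auto simp: path_pow_def)
  then have "hd is \<in> set is" using assms by (intro hd_in_set) auto
  then show False using ix(2) assms by fastforce
qed

text \<open>Pivoting on the vertex \<open>p\<close> close to the right end leaves the path on \<open>{1, \<dots>, p - 1}\<close> and \<open>n - p\<close>
  free variables.\<close>

lemma depths_ge_path_pivot:
  assumes p: "1 \<le> p" "p \<le> n" "n < p + m" and c: "lookup c p = 0"
    and b1: "depths_ge TYPE('k::field) {1..n} (\<lambda>v. path_pow m n t (v + (c + Poly_Mapping.single p 1))) r"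
    and b2: "depths_ge TYPE('k) {1..p - 1} (\<lambda>v. path_pow m (p - 1) t (v + c)) (r - (n - p))"
  shows "depths_ge TYPE('k) {1..n} (\<lambda>v. path_pow m n t (v + c)) r"
proof -
  let ?V = "{1..p - 1} \<union> {p + 1..n}"
  have V: "{1..n} = insert p ?V" using p by auto
  have "depths_ge TYPE('k) ?V (\<lambda>v. path_pow m (p - 1) t (v + c)) (r - (n - p) + card {p + 1..n})"
  proof (rule depths_ge_free_set)
    show "path_pow m (p - 1) t (v + Poly_Mapping.single x j + c) \<longleftrightarrow> path_pow m (p - 1) t (v + c)"
      if "x \<in> {p + 1..n}" for x v j
      using that by (intro path_pow_cong) (auto simp: lookup_add lookup_single)
  qed (use b2 in \<open>auto intro: upset_shift upset_path_pow\<close>)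
  \<comment> \<open>Truncated subtraction is harmless: adding \<open>n - p\<close> back gives at
    least \<open>r\<close>.\<close>
  then have "depths_ge TYPE('k) ?V (\<lambda>v. path_pow m (p - 1) t (v + c)) r"
    by (rule depths_ge_mono[rotated]) auto
  then have "depths_ge TYPE('k) ?V (\<lambda>v. path_pow m n t (v + c)) r"
  proof (rule depths_ge_cong[rotated])
    fix v :: monom assume "keys v \<subseteq> ?V"
    moreover have "p \<notin> ?V" by auto
    ultimately have "lookup v p = 0" by (metis in_keys_iff subsetD)
    then show "path_pow m (p - 1) t (v + c) \<longleftrightarrow> path_pow m n t (v + c)"
      using path_pow_restrict[of "v + c" p n m t] p c by (simp add: lookup_add)
  qed
  moreover have "depths_ge TYPE('k) (insert p ?V) (\<lambda>v. path_pow m n t (v + Poly_Mapping.single p 1 + c)) r"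
    using b1 V by (simp add: ac_simps)
  ultimately show ?thesis
    unfolding V by (intro depths_ge_pivot[where P = "\<lambda>v. path_pow m n t (v + c)"]) (auto intro: upset_shift upset_path_pow)
qed

text \<open>The carried monomial consists of the last \<open>q\<close> vertices and grows to the
  left; the induction descends from the whole last path, where the power drops. A cut at
  \<open>n - i\<close> frees \<open>i\<close> vertices and loses the monomial, which lies to the
  right of the cut.\<close>

lemma depths_ge_path_right:
  assumes n: "m \<le> n" and q: "q \<le> m"
    and b0: "depths_ge TYPE('k::field) {1..n} (path_pow m n t) r"
    and b: "\<And>i. q \<le> i \<Longrightarrow> i < m \<Longrightarrow> depths_ge TYPE('k) {1..n - i - 1} (path_pow m (n - i - 1) (Suc t)) (r - i)"
  shows "depths_ge TYPE('k) {1..n} (\<lambda>v. path_pow m n (Suc t) (v + interval (n + 1 - q) (n + 1))) r"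
  using q b
proof (induction q rule: inc_induct)
  case base
  show ?case using b0 path_pow_colon_last[OF n] by simp
next
  case (step q)
  have "Poly_Mapping.single (n - q) 1 + interval (Suc (n - q)) (n + 1) = interval (n - q) (n + 1)"
    by (rule interval_Suc_left) simp
  then have iv: "interval (n + 1 - q) (n + 1) + Poly_Mapping.single (n - q) 1 = interval (n + 1 - Suc q) (n + 1)"
    using step n by (simp add: add.commute Suc_diff_le)
  have iv0: "lookup (interval (n + 1 - q) (n + 1)) x = 0" if "x \<le> n - q" for x
    using that step n by (auto simp: lookup_interval)
  show ?case
  proof (rule depths_ge_path_pivot[of "n - q"])
    have "depths_ge TYPE('k) {1..n - q - 1} (path_pow m (n - q - 1) (Suc t)) (r - q)"
      using step by blast
    moreover have "path_pow m (n - q - 1) (Suc t) (v + interval (n + 1 - q) (n + 1)) = path_pow m (n - q - 1) (Suc t) v" for v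
      using iv0 by (intro path_pow_cong) (auto simp: lookup_add)
    ultimately show "depths_ge TYPE('k) {1..n - q - 1} (\<lambda>v. path_pow m (n - q - 1) (Suc t) (v + interval (n + 1 - q) (n + 1))) (r - (n - (n - q)))"
      using step n by simp
    show "depths_ge TYPE('k) {1..n} (\<lambda>v. path_pow m n (Suc t)
        (v + (interval (n + 1 - q) (n + 1) + Poly_Mapping.single (n - q) 1))) r"
      unfolding iv using step by simp
  qed (use step n iv0 in auto)
qed

text \<open>The carried monomial consists of the first \<open>q\<close> vertices of the last path. A
  cut right after the first \<open>j\<close> of them frees \<open>m - 1 - j\<close> vertices and
  keeps these \<open>j\<close> as the right end of a path on \<open>n - m + j\<close> vertices, the
  situation of \<open>depths_ge_path_right\<close>.\<close>

lemma depths_ge_path_left: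
  assumes n: "m \<le> n" and q: "q \<le> m"
    and b0: "depths_ge TYPE('k::field) {1..n} (path_pow m n t) r"
    and b: "\<And>j. j < m \<Longrightarrow> depths_ge TYPE('k) {1..n - m + j}
      (\<lambda>v. path_pow m (n - m + j) (Suc t) (v + interval (n + 1 - m) (n + 1 - m + j))) (r - (m - 1 - j))"
  shows "depths_ge TYPE('k) {1..n} (\<lambda>v. path_pow m n (Suc t) (v + interval (n + 1 - m) (n + 1 - m + q))) r"
  using q
proof (induction q rule: inc_induct)
  case base
  show ?case using b0 path_pow_colon_last[OF n] n by simp
next
  case (step q)
  have iv: "interval (n + 1 - m) (n + 1 - m + q) + Poly_Mapping.single (n + 1 - m + q) 1 =
      interval (n + 1 - m) (n + 1 - m + Suc q)"
    using interval_Suc[of "n + 1 - m" "n + 1 - m + q"] by simp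
  show ?case
  proof (rule depths_ge_path_pivot[of "n + 1 - m + q"])
    show "depths_ge TYPE('k) {1..n} (\<lambda>v. path_pow m n (Suc t)
        (v + (interval (n + 1 - m) (n + 1 - m + q) + Poly_Mapping.single (n + 1 - m + q) 1))) r"
      unfolding iv by (rule step.IH)
    have e: "n + 1 - m + q - 1 = n - m + q" "n - (n + 1 - m + q) = m - 1 - q" using step n by auto
    show "depths_ge TYPE('k) {1..n + 1 - m + q - 1} (\<lambda>v. path_pow m (n + 1 - m + q - 1) (Suc t)
        (v + interval (n + 1 - m) (n + 1 - m + q))) (r - (n - (n + 1 - m + q)))"
      unfolding e using b step.hyps by blast
  qed (use step n in \<open>auto simp: lookup_interval\<close>)
qed

section \<open>The numerical recursion\<close>

text \<open>This is \<open>a\<close> minus floor and ceiling of \<open>a / k\<close>, the ceiling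
  being \<open>- ((- a) div k)\<close>; the first case of \<open>phi\<close> is its value at
  \<open>k = m + 1\<close> and \<open>a = n - t + 2\<close>.\<close>

definition psi :: "int \<Rightarrow> int \<Rightarrow> int"
  where "psi k a = a - a div k + (- a) div k"

lemma psi_eq:
  assumes "0 \<le> r" "r < k"
  shows "psi k (k * q + r) = k * q + r - 2 * q - (if r = 0 then 0 else 1)"
proof -
  have "(k * q + r) div k = q" using assms by (simp add: int_div_pos_eq)
  moreover have "(- (k * q + r)) div k = - q - (if r = 0 then 0 else 1)"
  proof (cases "r = 0")
    case False
    then show ?thesis using assms by (intro int_div_pos_eq[where r = "k - r"]) (auto simp: algebra_simps)
  next
    case True
    have "- (k * q + r) = (- q) * k" using True by (simp add: mult.commute)
    then show ?thesis using assms True by (simp only: nonzero_mult_div_cancel_right) simp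
  qed
  ultimately show ?thesis by (simp add: psi_def)
qed

text \<open>The unit gained by \<open>a\<close> is taken back by the floor when the remainder
  returns to \<open>0\<close>, and by the ceiling when it leaves \<open>0\<close>. For
  \<open>k \<ge> 2\<close> these are different steps.\<close>

lemma psi_step:
  assumes "2 \<le> k"
  shows "psi k a \<le> psi k (a + 1)" "psi k (a + 1) \<le> psi k a + 1"
proof -
  define q r where "q = a div k" and "r = a mod k"
  have a: "a = k * q + r" "0 \<le> r" "r < k" using assms by (auto simp: q_def r_def)
  have "psi k a \<le> psi k (a + 1) \<and> psi k (a + 1) \<le> psi k a + 1"
  proof (cases "r + 1 < k")
    case True
    have "psi k (k * q + (r + 1)) = k * q + (r + 1) - 2 * q - (if r + 1 = 0 then 0 else 1)"
      using a True by (intro psi_eq) auto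
    then show ?thesis using psi_eq[OF a(2,3), of q] a by (auto simp: add.assoc)
  next
    case False
    then have "a + 1 = k * (q + 1) + 0" using a by (simp add: algebra_simps)
    moreover have "psi k (k * (q + 1) + 0) = k * (q + 1) + 0 - 2 * (q + 1) - (if (0::int) = 0 then 0 else 1)"
      using assms by (intro psi_eq) auto
    ultimately have "psi k (a + 1) = a - 2 * q - 1" by simp
    moreover have "r \<noteq> 0" using False assms by auto
    ultimately show ?thesis using psi_eq[OF a(2,3), of q] a by simp
  qed
  then show "psi k a \<le> psi k (a + 1)" "psi k (a + 1) \<le> psi k a + 1" by auto
qed

lemma psi_add:
  assumes "2 \<le> k"
  shows "psi k a \<le> psi k (a + int s)" "psi k (a + int s) \<le> psi k a + int s"
proof (induction s)
  case (Suc s)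
  case 1
  show ?case using Suc(1) psi_step[OF assms, of "a + int s"] by (simp add: ac_simps)
  case 2
  show ?case using Suc(2) psi_step[OF assms, of "a + int s"] by (simp add: ac_simps)
qed auto

lemma psi_mono: "2 \<le> k \<Longrightarrow> a \<le> b \<Longrightarrow> psi k a \<le> psi k b"
  using psi_add(1)[of k a "nat (b - a)"] by simp

lemma psi_lipschitz: "2 \<le> k \<Longrightarrow> a \<le> b \<Longrightarrow> psi k b \<le> psi k a + (b - a)"
  using psi_add(2)[of k a "nat (b - a)"] by simp

lemma psi_shift: "2 \<le> k \<Longrightarrow> psi k (a + k) = psi k a + k - 2"
proof -
  assume k: "2 \<le> k"
  have "a + k = k * (a div k + 1) + a mod k" using mult_div_mod_eq[of k a] by (simp add: algebra_simps)
  moreover have "a = k * (a div k) + a mod k" by simp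
  moreover have "0 \<le> a mod k" "a mod k < k" using k by auto
  ultimately show ?thesis
    using psi_eq[of "a mod k" k "a div k + 1"] psi_eq[of "a mod k" k "a div k"] by (simp add: algebra_simps)
qed

lemma psi_small: "1 \<le> a \<Longrightarrow> a < k \<Longrightarrow> psi k a = a - 1"
  using psi_eq[of a k 0] by simp

lemma psi_self: "2 \<le> k \<Longrightarrow> psi k k = k - 2"
  using psi_eq[of 0 k 1] by simp

text \<open>The maximum replaces the case distinction of \<open>phi\<close>: \<open>psi\<close> is
  monotone and has the value \<open>m - 1\<close> at \<open>m + 1\<close>, the argument that belongs
  to \<open>t = n + 1 - m\<close>. For \<open>n < m\<close> there is no path and all
  \<open>n\<close> variables are free.\<close>

definition path_bound :: "nat \<Rightarrow> nat \<Rightarrow> nat \<Rightarrow> nat"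
  where "path_bound m n t =
    (if n < m then n else nat (max (psi (int m + 1) (int n - int t + 2)) (int m - 1)))"

lemma path_bound_ge_psi:
  assumes "1 \<le> m" "1 \<le> t"
  shows "psi (int m + 1) (int n - int t + 2) \<le> int (path_bound m n t)"
proof (cases "n < m")
  case True
  have "psi (int m + 1) (int n - int t + 2) \<le> psi (int m + 1) (int n + 1)"
    using assms by (intro psi_mono) auto
  also have "\<dots> = int n" using True by (subst psi_small) auto
  finally show ?thesis using True by (simp add: path_bound_def)
qed (auto simp: path_bound_def)

lemma path_bound_le_iff:
  "m \<le> n \<Longrightarrow> path_bound m n t \<le> b \<longleftrightarrow>
    psi (int m + 1) (int n - int t + 2) \<le> int b \<and> int m - 1 \<le> int b"
  by (auto simp: path_bound_def)

lemma path_bound_ge: "m \<le> n \<Longrightarrow> int m - 1 \<le> int (path_bound m n t)"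
  by (auto simp: path_bound_def)

text \<open>For the branch in which the first pass completes the last path and the power
  drops.\<close>

lemma path_bound_rec1:
  assumes "1 \<le> m" "m \<le> n" "1 \<le> t"
  shows "path_bound m n (Suc t) \<le> path_bound m n t"
  using assms path_bound_ge_psi[of m t n] path_bound_ge[of m n t]
    psi_mono[of "int m + 1" "int n - int (Suc t) + 2" "int n - int t + 2"]
  by (simp add: path_bound_le_iff)

text \<open>For one cut followed by a drop of the power: of the \<open>m - j\<close> vertices
  removed, \<open>m - 1 - j\<close> are free, and the smaller power makes up for the cut
  vertex.\<close>

lemma path_bound_rec2:
  assumes "1 \<le> m" "m \<le> n - m + j" "1 \<le> t" "j < m" "m \<le> n"
  shows "path_bound m n (Suc t) \<le> path_bound m (n - m + j) t + (m - 1 - j)"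
proof -
  have "psi (int m + 1) (int n - int (Suc t) + 2) \<le>
      psi (int m + 1) (int (n - m + j) - int t + 2) + (int m - 1 - int j)"
    using psi_lipschitz[of "int m + 1" "int (n - m + j) - int t + 2" "int n - int (Suc t) + 2"] assms
    by (simp add: of_nat_diff)
  then show ?thesis
    using assms path_bound_ge_psi[of m t "n - m + j"] path_bound_ge[of m "n - m + j" t]
    by (subst path_bound_le_iff) (auto simp: of_nat_diff)
qed

text \<open>For two cuts: \<open>m + 1 + (i - j)\<close> vertices are removed and all but two of
  them are free. A full period \<open>m + 1\<close> of \<open>psi\<close> costs exactly
  \<open>m - 1\<close>, and each of the \<open>i - j\<close> others at most one.\<close>

lemma path_bound_rec3:
  assumes "1 \<le> m" "m \<le> n - m + j" "1 \<le> t" "j \<le> i" "i < m" "m \<le> n"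
  shows "path_bound m n t \<le> path_bound m (n - m + j - i - 1) t + i + (m - 1 - j)"
proof -
  let ?k = "int m + 1" and ?n = "n - m + j - i - 1" and ?s = "int i - int j"
  have n': "int ?n = int n - int m + int j - int i - 1" using assms by simp
  have "psi ?k (int n - int t + 2) \<le> psi ?k (int n - int t + 2 - ?s) + ?s"
    using psi_lipschitz[of ?k "int n - int t + 2 - ?s" "int n - int t + 2"] assms by simp
  moreover have eq: "int n - int t + 2 - ?s = (int ?n - int t + 2) + ?k" using n' by simp
  have "psi ?k (int n - int t + 2 - ?s) = psi ?k (int ?n - int t + 2) + ?k - 2"
    unfolding eq using assms by (intro psi_shift) simp
  ultimately have "psi ?k (int n - int t + 2) \<le> int (path_bound m ?n t) + int i + (int m - 1 - int j)"
    using path_bound_ge_psi[of m t ?n] assms by simp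
  then show ?thesis using assms by (subst path_bound_le_iff) (auto simp: of_nat_diff)
qed

text \<open>Covers the case that the first cut leaves no path at all: then every variable except the
  cut one is free.\<close>

lemma path_bound_less:
  assumes "1 \<le> m" "1 \<le> t" "m \<le> n"
  shows "path_bound m n t \<le> n - 1"
proof -
  have "psi (int m + 1) (int n - int t + 2) \<le> psi (int m + 1) (int n + 1)"
    using assms by (intro psi_mono) auto
  also have "\<dots> \<le> psi (int m + 1) (int m + 1) + (int n - int m)"
    using psi_lipschitz[of "int m + 1" "int m + 1" "int n + 1"] assms by simp
  also have "\<dots> = int n - 1" using psi_self[of "int m + 1"] assms by simp
  finally show ?thesis using assms by (subst path_bound_le_iff) (auto simp: of_nat_diff)
qed

lemma phi_le_path_bound:
  assumes "1 \<le> m" "m \<le> n"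
  shows "nat (phi n m t) \<le> path_bound m n t"
proof -
  have "(real n - real t + 2) / (real m + 1) = of_int (int n - int t + 2) / of_int (int m + 1)" by simp
  then have "phi n m t \<le> max (psi (int m + 1) (int n - int t + 2)) (int m - 1)"
    unfolding phi_def psi_def by (simp only: floor_divide_of_int_eq ceiling_divide_eq_div) auto
  then show ?thesis using assms by (simp add: path_bound_def)
qed

lemma depths_ge_path:
  assumes m: "1 \<le> m" and t: "1 \<le> t"
  shows "depths_ge TYPE('k::field) {1..n} (path_pow m n t) (path_bound m n t)"
  using t
proof (induction t arbitrary: n)
  case (Suc t)
  \<comment> \<open>For \<open>t = 0\<close> the ideal is the unit ideal, so any bound holds and the
    recursion can start.\<close>
  have prev: "depths_ge TYPE('k) {1..n} (path_pow m n t) r" if "t \<ge> 1 \<Longrightarrow> r \<le> path_bound m n t" for n r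
  proof (cases "t = 0")
    case True
    then show ?thesis by (simp add: depths_ge_def)
  next
    case False
    then show ?thesis using Suc.IH[of n] that depths_ge_mono[of "{1..n}"] by simp
  qed
  show ?case
  proof (induction n rule: less_induct)
    case (less n)
    let ?r = "path_bound m n (Suc t)"
    show ?case
    proof (cases "n < m")
      case True
      then show ?thesis using path_pow_small by (intro depths_ge_none) (auto simp: path_bound_def)
    next
      case False
      then have n: "m \<le> n" by simp
      \<comment> \<open>The empty interval is the monomial \<open>1\<close>, with which the first
        pass begins.\<close>
      have "depths_ge TYPE('k) {1..n} (\<lambda>v. path_pow m n (Suc t) (v + interval (n + 1 - m) (n + 1 - m + 0))) ?r"
      proof (rule depths_ge_path_left[OF n])
        show "depths_ge TYPE('k) {1..n} (path_pow m n t) ?r"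
          using path_bound_rec1 m n by (intro prev) auto
        fix j assume j: "j < m"
        let ?N = "n - m + j"
        show "depths_ge TYPE('k) {1..?N} (\<lambda>v. path_pow m ?N (Suc t) (v + interval (n + 1 - m) (n + 1 - m + j))) (?r - (m - 1 - j))"
        proof (cases "?N < m")
          case True
          have "?r \<le> n - 1" using path_bound_less m n by simp
          then show ?thesis using path_pow_small[OF True] j n by (intro depths_ge_none) auto
        next
          case False
          then have N: "m \<le> ?N" by simp
          \<comment> \<open>On the shorter path the carried monomial occupies exactly the last
            \<open>j\<close> vertices.\<close>
          have "depths_ge TYPE('k) {1..?N} (\<lambda>v. path_pow m ?N (Suc t) (v + interval (?N + 1 - j) (?N + 1))) (?r - (m - 1 - j))"
          proof (rule depths_ge_path_right[OF N])
            show "depths_ge TYPE('k) {1..?N} (path_pow m ?N t) (?r - (m - 1 - j))"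
              using path_bound_rec2[OF m N _ j n] by (intro prev) (simp add: le_diff_conv)
            fix i assume i: "j \<le> i" "i < m"
            have "depths_ge TYPE('k) {1..?N - i - 1} (path_pow m (?N - i - 1) (Suc t)) (path_bound m (?N - i - 1) (Suc t))"
              using n j by (intro less.IH) arith
            moreover have "?r \<le> path_bound m (?N - i - 1) (Suc t) + i + (m - 1 - j)"
              by (rule path_bound_rec3[OF m N _ i n]) simp
            ultimately show "depths_ge TYPE('k) {1..?N - i - 1} (path_pow m (?N - i - 1) (Suc t)) (?r - (m - 1 - j) - i)"
              by (elim depths_ge_mono[rotated]) (simp_all only: finite_atLeastAtMost le_diff_conv)
          qed (use j in simp)
          moreover have "?N + 1 - j = n + 1 - m" "?N + 1 = n + 1 - m + j" using n by auto
          ultimately show ?thesis by (simp only:)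
        qed
      qed simp
      then show ?thesis by (simp add: interval_def)
    qed
  qed
qed simp

section \<open>Powers of the cycle ideal\<close>

lemma ppow_add: "ppow P s a \<Longrightarrow> ppow P t b \<Longrightarrow> upset P \<Longrightarrow> ppow P (s + t) (a + b)"
proof (induction t arbitrary: b)
  case 0
  then show ?case using upset_add[OF upset_ppow] by simp
next
  case (Suc t)
  then obtain b1 b2 where b: "b = b1 + b2" "ppow P t b1" "P b2" by (auto simp: psum_def)
  then have "ppow P (s + t) (a + b1)" using Suc by blast
  then show ?case unfolding add_Suc_right ppow.simps psum_def using b
    by (intro exI[of _ "a + b1"] exI[of _ b2]) (simp add: add.assoc)
qed

lemma ppow_mono: "ppow P t u \<Longrightarrow> (\<And>u. P u \<Longrightarrow> Q u) \<Longrightarrow> ppow Q t u"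
proof (induction t arbitrary: u)
  case (Suc t)
  then obtain a b where "u = a + b" "ppow P t a" "P b" by (auto simp: psum_def)
  then show ?case using Suc unfolding ppow.simps psum_def by blast
qed simp

lemma psum_exchange:
  assumes "psum (ppow P (Suc s)) (ppow Q k) u" "\<And>u. P u \<Longrightarrow> Q u"
  shows "psum (ppow P s) (ppow Q (Suc k)) u"
proof -
  obtain a b c where "u = (a + b) + c" "ppow P s a" "P b" "ppow Q k c"
    using assms(1) by (auto simp: psum_def)
  moreover from this have "ppow Q (Suc k) (c + b)"
    using assms(2) unfolding ppow.simps psum_def by blast
  ultimately show ?thesis
    unfolding psum_def by (intro exI[of _ a] exI[of _ "c + b"]) (simp add: ac_simps)
qed

lemma psum_exchange_le:
  assumes "psum (ppow P (t - k)) (ppow Q k) u" "k \<le> j" "j \<le> t" "\<And>u. P u \<Longrightarrow> Q u"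
  shows "psum (ppow P (t - j)) (ppow Q j) u"
  using assms(2,3)
proof (induction j rule: dec_induct)
  case (step j)
  then have "psum (ppow P (Suc (t - Suc j))) (ppow Q j) u" by (simp add: Suc_diff_Suc)
  then show ?case by (rule psum_exchange) (rule assms(4))
qed (rule assms(1))

definition drop_var :: "nat \<Rightarrow> monom \<Rightarrow> monom"
  where "drop_var x u = u - Poly_Mapping.single x (lookup u x)"

lemma drop_var_add: "drop_var x (u + v) = drop_var x u + drop_var x v"
  by (rule poly_mapping_eqI) (auto simp: drop_var_def lookup_add lookup_minus lookup_single when_def)

text \<open>Here \<open>P\<close>, \<open>Q\<close> and \<open>\<lambda>u. P (u + x)\<close> stand for an ideal \<open>J\<close>, for its part \<open>I\<close> not involving \<open>x\<close> and
  for \<open>J : x\<close>. The coefficient ideal of \<open>x\<^sup>j\<close> in \<open>J\<^sup>t\<close> is \<open>I\<^sup>t\<^sup>-\<^sup>j (J : x)\<^sup>j\<close>, because \<open>I \<subseteq> J : x\<close> absorbs the summands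
  with fewer than \<open>j\<close> factors from \<open>J : x\<close>.\<close>

lemma ppow_component:
  assumes P: "P = generated G" and Q: "upset Q" "\<And>u. Q u \<Longrightarrow> P u"
    and G: "\<And>g. g \<in> G \<Longrightarrow> (lookup g x = 0 \<and> Q g) \<or> lookup g x = 1"
    and v: "lookup v x = 0" and j: "j \<le> t"
  shows "ppow P t (v + Poly_Mapping.single x j) \<longleftrightarrow>
    psum (ppow Q (t - j)) (ppow (\<lambda>u. P (u + Poly_Mapping.single x 1)) j) v"
proof -
  let ?C = "\<lambda>u. P (u + Poly_Mapping.single x 1)"
  have upP: "upset P" unfolding P by (rule upset_generated)
  have upC: "upset ?C" by (rule upset_shift[OF upP])
  have QC: "?C u" if "Q u" for u using Q(2)[OF that] by (rule upset_add[OF upP])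
  \<comment> \<open>\<open>k\<close> counts the factors whose generator contains \<open>x\<close>;
    such a generator has degree one in \<open>x\<close>, so dropping \<open>x\<close> turns it into
    an element of \<open>J : x\<close>.\<close>
  have ex: "\<exists>k\<le>t. k \<le> lookup u x \<and> psum (ppow Q (t - k)) (ppow ?C k) (drop_var x u)" if "ppow P t u" for t u
    using that
  proof (induction t arbitrary: u)
    case 0
    show ?case by (auto simp: psum_def intro: exI[of _ 0])
  next
    case (Suc t)
    then obtain a b where ab: "u = a + b" "ppow P t a" "P b" by (auto simp: psum_def)
    obtain g w where g: "g \<in> G" "b = g + w" using ab(3) by (auto simp: P generated_def)
    obtain k where k: "k \<le> t" "k \<le> lookup a x" "psum (ppow Q (t - k)) (ppow ?C k) (drop_var x a)"
      using Suc.IH[OF ab(2)] by blast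
    then obtain c d where cd: "drop_var x a = c + d" "ppow Q (t - k) c" "ppow ?C k d" by (auto simp: psum_def)
    have u: "drop_var x u = c + d + drop_var x g + drop_var x w" by (simp add: ab g drop_var_add cd add.assoc)
    consider "lookup g x = 0" "Q g" | "lookup g x = 1" using G[OF g(1)] by auto
    then show ?case
    proof cases
      case 1
      have "drop_var x u = (c + g) + (d + drop_var x w)" using u 1 by (simp add: drop_var_def ac_simps)
      moreover have "ppow Q (Suc t - k) (c + g)" using cd 1 k(1) by (auto simp: Suc_diff_le psum_def)
      moreover have "ppow ?C k (d + drop_var x w)" using cd(3) by (rule upset_add[OF upset_ppow[OF upC]])
      ultimately have "psum (ppow Q (Suc t - k)) (ppow ?C k) (drop_var x u)" unfolding psum_def by blast
      then show ?thesis using k ab g by (intro exI[of _ k]) (auto simp: lookup_add)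
    next
      case 2
      have "g = drop_var x g + Poly_Mapping.single x 1" using monom_split[of g x] 2 by (simp add: drop_var_def)
      moreover have "P g" unfolding P using g(1) by (rule generated_self)
      ultimately have "?C (drop_var x g)" by simp
      then have "?C (drop_var x g + drop_var x w)" by (rule upset_add[OF upC])
      then have "ppow ?C (Suc k) (d + (drop_var x g + drop_var x w))" using cd(3) by (auto simp: psum_def)
      moreover have "drop_var x u = c + (d + (drop_var x g + drop_var x w))" using u by (simp add: add.assoc)
      ultimately have "psum (ppow Q (Suc t - Suc k)) (ppow ?C (Suc k)) (drop_var x u)"
        unfolding psum_def using cd(2) by auto
      then show ?thesis using k ab g 2 by (intro exI[of _ "Suc k"]) (auto simp: lookup_add)
    qed
  qed
  show ?thesis
  proof
    assume "ppow P t (v + Poly_Mapping.single x j)"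
    from ex[OF this] obtain k where k: "k \<le> t" "k \<le> lookup (v + Poly_Mapping.single x j) x"
      "psum (ppow Q (t - k)) (ppow ?C k) (drop_var x (v + Poly_Mapping.single x j))" by blast
    have "drop_var x (v + Poly_Mapping.single x j) = v" using v by (simp add: drop_var_def lookup_add)
    then have "psum (ppow Q (t - k)) (ppow ?C k) v" using k(3) by simp
    moreover have "k \<le> j" using k(2) v by (simp add: lookup_add)
    ultimately show "psum (ppow Q (t - j)) (ppow ?C j) v"
      using j QC by (rule psum_exchange_le)
  next
    assume "psum (ppow Q (t - j)) (ppow ?C j) v"
    then obtain a b where ab: "v = a + b" "ppow Q (t - j) a" "ppow ?C j b" by (auto simp: psum_def)
    \<comment> \<open>One \<open>x\<close> is handed to each of the \<open>j\<close>
      factors.\<close>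
    have "ppow P j (b + Poly_Mapping.single x j)" using ab(3)
    proof (induction j arbitrary: b)
      case (Suc j)
      then obtain c d where "b = c + d" "ppow ?C j c" "?C d" by (auto simp: psum_def)
      moreover from this have "ppow P j (c + Poly_Mapping.single x j)" using Suc.IH by blast
      moreover have "c + d + Poly_Mapping.single x (Suc j) =
          (c + Poly_Mapping.single x j) + (d + Poly_Mapping.single x 1)"
        using single_add[of x j 1] by (simp add: ac_simps)
      ultimately show ?case unfolding ppow.simps psum_def by metis
    qed simp
    then have "ppow P (t - j + j) (a + (b + Poly_Mapping.single x j))"
      using ppow_mono[OF ab(2) Q(2)] by (intro ppow_add upP)
    then show "ppow P t (v + Poly_Mapping.single x j)" using ab(1) j by (simp add: add.assoc)
  qed
qed

section \<open>Generators of the cycle ideal\<close>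

definition cycle_path :: "nat \<Rightarrow> nat \<Rightarrow> nat \<Rightarrow> monom"
  where "cycle_path n m i = (\<Sum>j<m. Poly_Mapping.single ((i + j - 1) mod n + 1) 1)"

lemma keys_cycle_path:
  assumes "1 \<le> n"
  shows "keys (cycle_path n m i) \<subseteq> {1..n}"
proof
  fix x assume "x \<in> keys (cycle_path n m i)"
  then have "(\<Sum>j<m. lookup (Poly_Mapping.single ((i + j - 1) mod n + 1) (1::nat)) x) \<noteq> 0"
    by (simp only: cycle_path_def lookup_sum in_keys_iff simp_thms)
  then obtain j where "lookup (Poly_Mapping.single ((i + j - 1) mod n + 1) (1::nat)) x \<noteq> 0"
    by (rule sum.not_neutral_contains_not_neutral)
  then have "x = (i + j - 1) mod n + 1" by (simp add: lookup_single when_def split: if_splits)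
  then show "x \<in> {1..n}" using assms by (simp add: Suc_le_eq)
qed

text \<open>Since \<open>m < n\<close>, a path meets the vertex \<open>n\<close> at most once, at
  the position \<open>j = n - i\<close>.\<close>

lemma lookup_cycle_path_last:
  assumes "m < n" "1 \<le> i" "i \<le> n"
  shows "lookup (cycle_path n m i) n = (if n < i + m then 1 else 0)"
proof -
  have "(i + j - 1) mod n + 1 = n \<longleftrightarrow> j = n - i" if "j < m" for j
  proof (cases "i + j - 1 < n")
    case True
    then show ?thesis using assms by auto
  next
    case False
    then have "(i + j - 1) mod n = i + j - 1 - n" using assms that by (subst mod_if) auto
    then show ?thesis using assms that False by auto
  qed
  then have "lookup (cycle_path n m i) n = (\<Sum>j<m. if j = n - i then 1 else 0)"
    unfolding cycle_path_def lookup_sum by (intro sum.cong) (auto simp: lookup_single when_def)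
  then show ?thesis using assms by auto
qed

lemma cycle_path_eq_interval:
  assumes "1 \<le> i" "i + m \<le> n"
  shows "cycle_path n m i = interval i (i + m)"
proof -
  have "cycle_path n m i = (\<Sum>j<m. Poly_Mapping.single (i + j) 1)"
    unfolding cycle_path_def using assms by (intro sum.cong) auto
  then show ?thesis by (simp only: interval_eq_sum)
qed

text \<open>Here \<open>m \<ge> 2\<close> enters: no generator is a power of \<open>x_n\<close>, so
  the coefficient ideals of \<open>J^t\<close> are all proper.\<close>

lemma cycle_path_other_var:
  assumes "2 \<le> m" "m < n" "1 \<le> i" "i \<le> n"
  shows "\<exists>x. x \<noteq> n \<and> lookup (cycle_path n m i) x \<noteq> 0"
proof -
  have pos: "lookup (cycle_path n m i) ((i + j - 1) mod n + 1) \<noteq> 0" if "j < m" for j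
  proof -
    let ?x = "(i + j - 1) mod n + 1"
    have "lookup (Poly_Mapping.single ?x (1::nat)) ?x \<le> lookup (cycle_path n m i) ?x"
      unfolding cycle_path_def lookup_sum
      by (rule member_le_sum[of j "{..<m}" "\<lambda>j. lookup (Poly_Mapping.single ((i + j - 1) mod n + 1) 1) ?x"])
        (use that in auto)
    then show ?thesis by (simp add: Suc_le_eq)
  qed
  show ?thesis
  proof (cases "i = n")
    case True
    then show ?thesis using pos[of 1] assms by (intro exI[of _ 1]) auto
  next
    case False
    then show ?thesis using pos[of 0] assms by (intro exI[of _ i]) auto
  qed
qed

lemma enat_le_by_approx: "(\<And>r. enat r \<le> a \<Longrightarrow> enat r \<le> b) \<Longrightarrow> a \<le> b"
proof (cases b)
  case (enat q)
  assume *: "\<And>r. enat r \<le> a \<Longrightarrow> enat r \<le> b"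
  then have "\<not> enat (Suc q) \<le> a" using enat by fastforce
  then show ?thesis using enat by (simp add: Suc_ile_eq not_less)
qed simp

theorem proposition3p3:
  fixes n m t :: nat
    and S S' :: "'k::field mpoly ring"
    and J J' I Jt Jxt :: "'k mpoly set"
    and d s :: "nat \<Rightarrow> enat"
  assumes "2 \<le> m" "m < n" "1 \<le> t"
    and "S = mpoly_ring {1..n}"
    and "S' = mpoly_ring {1..n - 1}"
    and "J = cycle_path_ideal n m"
    and "J' = ideal_colon S J (mvar n) \<inter> carrier S'"
    and "I = line_path_ideal (n - 1) m"
    and "Jt = J [^]\<^bsub>ideals_set S\<^esub> t"
    and "Jxt = Jt <+>\<^bsub>S\<^esub> PIdl\<^bsub>S\<^esub> (mvar n ^ t)"
    and "\<And>k. d k = depth_quot {1..n - 1}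
               ((I [^]\<^bsub>ideals_set S'\<^esub> (t + 1 - k)) \<cdot>\<^bsub>S'\<^esub> (J' [^]\<^bsub>ideals_set S'\<^esub> (k - 1)))"
    and "\<And>k. s k = sdepth_quot {1..n - 1}
               ((I [^]\<^bsub>ideals_set S'\<^esub> (t + 1 - k)) \<cdot>\<^bsub>S'\<^esub> (J' [^]\<^bsub>ideals_set S'\<^esub> (k - 1)))"
  shows
    "Min (insert (enat (nat (phi (n - 1) m t))) (d ` {2..t})) \<le> depth_quot {1..n} Jxt \<and>
     Min (insert (enat (nat (phi (n - 1) m t))) (s ` {2..t})) \<le> sdepth_quot {1..n} Jxt \<and>
     depth_quot {1..n} Jt \<le> depth_quot {1..n} Jxt + 1 \<and>
     (depth_quot {1..n} (ideal_colon S Jt (mvar n ^ t)) > depth_quot {1..n} Jt \<longrightarrow>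
        depth_quot {1..n} Jt \<ge> depth_quot {1..n} Jxt) \<and>
     (sdepth_quot {1..n} (ideal_colon S Jt (mvar n ^ t)) > sdepth_quot {1..n} Jt \<longrightarrow>
        sdepth_quot {1..n} Jt \<ge> sdepth_quot {1..n} Jxt)"
proof -
  define V where "V = {1..n - 1}"
  have V: "finite V" "n \<notin> V" "{1..n} = insert n V" "{1..n - 1} = V"
    using assms(1,2) by (auto simp: V_def)
  define G where "G = cycle_path n m ` {1..n}"
  define P where "P = generated G"
  define Q where "Q = generated {interval i (i + m) | i. 1 \<le> i \<and> i + m \<le> n - 1 + 1}"
  define C where "C = (\<lambda>u. P (u + Poly_Mapping.single n 1))"
  define Pt where "Pt = ppow P t"
  have upP: "upset P" and upQ: "upset Q" unfolding P_def Q_def by (rule upset_generated)+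
  have upC: "upset C" unfolding C_def by (rule upset_shift[OF upP])
  have upPt: "upset Pt" unfolding Pt_def by (rule upset_ppow[OF upP])
  have S: "S = mpoly_ring (insert n V)" and S': "S' = mpoly_ring V" using assms(4,5) V by simp_all
  have J: "J = mspan (insert n V) P"
  proof -
    have "{\<Prod>j<m. mvar ((i + j - 1) mod n + 1) | i. 1 \<le> i \<and> i \<le> n} = (of_monom ` G :: 'k mpoly set)"
    proof -
      have "{\<Prod>j<m. mvar ((i + j - 1) mod n + 1) | i. 1 \<le> i \<and> i \<le> n} =
          (\<lambda>i. of_monom (cycle_path n m i) :: 'k mpoly) ` {1..n}"
        unfolding prod_mvar cycle_path_def by auto
      then show ?thesis by (simp add: G_def image_image)
    qed
    then show ?thesis
      unfolding assms(6) cycle_path_ideal_def P_def V(3)[symmetric]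
      using genideal_monoms[of G "{1..n}"] keys_cycle_path[of n m] assms(2) by (auto simp: G_def)
  qed
  have I: "I = mspan V Q"
  proof -
    let ?G = "{interval i (i + m) | i. 1 \<le> i \<and> i + m \<le> n - 1 + 1}"
    have "1 \<le> i \<and> i \<le> n - 1 + 1 - m \<longleftrightarrow> 1 \<le> i \<and> i + m \<le> n - 1 + 1" for i by auto
    then have "{\<Prod>j<m. mvar (i + j) | i. 1 \<le> i \<and> i \<le> n - 1 + 1 - m} = (of_monom ` ?G :: 'k mpoly set)"
      unfolding prod_mvar interval_eq_sum by auto
    moreover have "keys g \<subseteq> V" if "g \<in> ?G" for g
      using that assms(2) by (auto simp: V_def in_keys_iff lookup_interval split: if_splits)
    ultimately show ?thesis
      unfolding assms(8) line_path_ideal_def Q_def V(4) using genideal_monoms[of ?G V] by simp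
  qed
  have colon: "ideal_colon (mpoly_ring (insert n V)) (mspan (insert n V) R) (mvar n ^ j) =
      (mspan (insert n V) (\<lambda>u. R (u + Poly_Mapping.single n j)) :: 'k mpoly set)" for R j
    unfolding mvar_power by (rule ideal_colon_mspan) simp
  have J': "J' = mspan V C"
    using colon[of P 1] mpolys_mono[of V "insert n V"] unfolding assms(7) S S' J C_def
    by (auto simp: mspan_def)
  have Jt: "Jt = mspan (insert n V) Pt"
    unfolding assms(9) S J Pt_def by (rule ideal_pow_mspan[OF upP])
  define T where "T = (\<lambda>u. Pt u \<or> t \<le> lookup u n)"
  have upT: "upset T" unfolding T_def by (rule upset_or_lookup[OF upPt])
  have Jxt: "Jxt = mspan (insert n V) T"
    unfolding assms(10) S Jt mvar_power T_def
    by (subst sum_principal_eq_adj) (auto intro!: xpow_in adj_mspan upPt)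
  \<comment> \<open>Over \<open>V\<close> this predicate is the coefficient ideal of degree
    \<open>j\<close> of \<open>J^t\<close>; over \<open>insert n V\<close> it is the colon by the
    \<open>j\<close>-th power of \<open>x_n\<close>. Both readings occur below.\<close>
  define F where "F j = (\<lambda>v. Pt (v + Poly_Mapping.single n j))" for j
  have upF: "upset (F j)" for j unfolding F_def by (rule upset_shift[OF upPt])
  have QP: "P u" if "Q u" for u
  proof -
    obtain i w where i: "u = interval i (i + m) + w" "1 \<le> i" "i + m \<le> n - 1 + 1"
      using \<open>Q u\<close> by (auto simp: Q_def generated_def)
    then have "interval i (i + m) \<in> G"
      using assms(1) cycle_path_eq_interval[of i m n] unfolding G_def by (intro image_eqI[of _ _ i]) auto
    then show ?thesis using i upset_add[OF upP] generated_self P_def by metis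
  qed
  have Gn: "(lookup g n = 0 \<and> Q g) \<or> lookup g n = 1" if g: "g \<in> G" for g
  proof -
    obtain i where i: "1 \<le> i" "i \<le> n" "g = cycle_path n m i" using g by (auto simp: G_def)
    show ?thesis
    proof (cases "n < i + m")
      case False
      then have "g = interval i (i + m)" using i cycle_path_eq_interval by simp
      then have "Q g" unfolding Q_def using i False by (intro generated_self) auto
      then show ?thesis using lookup_cycle_path_last[OF assms(2) i(1,2)] i(3) False by simp
    qed (use lookup_cycle_path_last[OF assms(2) i(1,2)] i(3) in simp)
  qed
  have comp: "F j v \<longleftrightarrow> psum (ppow Q (t - j)) (ppow C j) v" if "keys v \<subseteq> V" "j \<le> t" for j v
    unfolding F_def Pt_def C_def using that V(2) QP Gn
    by (intro ppow_component[OF P_def upQ]) (auto simp: in_keys_iff)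
  \<comment> \<open>With \<open>k = Suc j\<close> the products in the statement are the coefficient
    ideals, \<open>j\<close> being the number of factors from \<open>J'\<close>.\<close>
  have compI: "(I [^]\<^bsub>ideals_set S'\<^esub> (t + 1 - Suc j)) \<cdot>\<^bsub>S'\<^esub> (J' [^]\<^bsub>ideals_set S'\<^esub> (Suc j - 1)) = mspan V (F j)"
    if "j \<le> t" for j
  proof -
    have "mspan V (F j) = (mspan V (psum (ppow Q (t - j)) (ppow C j)) :: 'k mpoly set)"
      using comp that by (intro mspan_cong) blast
    then show ?thesis
      unfolding S' I J' by (simp add: ideal_pow_mspan upQ upC ideal_prod_mspan)
  qed
  have nP: "\<not> Pt (Poly_Mapping.single n j)" for j
  proof
    assume "Pt (Poly_Mapping.single n j)"
    then obtain a b where ab: "Poly_Mapping.single n j = a + b" "P b"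
      unfolding Pt_def using assms(3) by (cases t) (auto simp: psum_def)
    then obtain i w where i: "b = cycle_path n m i + w" "1 \<le> i" "i \<le> n" by (auto simp: P_def G_def generated_def)
    obtain x where x: "x \<noteq> n" "lookup (cycle_path n m i) x \<noteq> 0" using cycle_path_other_var[OF assms(1,2) i(2,3)] by blast
    have "lookup (Poly_Mapping.single n j) x = lookup a x + lookup (cycle_path n m i) x + lookup w x"
      using ab i by (simp add: lookup_add)
    then show False using x by (simp add: lookup_single)
  qed
  have nF: "\<not> F j 0" for j using nP by (simp add: F_def)
  have nT: "\<not> T 0" and nPt: "\<not> Pt 0" using nP[of 0] assms(3) by (auto simp: T_def)
  have finV: "finite (insert n V)" using V by simp
  \<comment> \<open>In degree \<open>0\<close> the coefficient ideal is \<open>I^t\<close>; this is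
    where \<open>phi\<close> stands in for \<open>d 1\<close> and \<open>s 1\<close> in the
    minima.\<close>
  have first: "depths_ge TYPE('k) V (F 0) (nat (phi (n - 1) m t))"
  proof -
    have "depths_ge TYPE('k) V (path_pow m (n - 1) t) (path_bound m (n - 1) t)"
      unfolding V_def using assms(1,3) by (intro depths_ge_path) auto
    moreover have "nat (phi (n - 1) m t) \<le> path_bound m (n - 1) t"
      using assms(1,2) by (intro phi_le_path_bound) auto
    ultimately have "depths_ge TYPE('k) V (path_pow m (n - 1) t) (nat (phi (n - 1) m t))"
      by (rule depths_ge_mono[OF V(1)])
    then show ?thesis
    proof (rule depths_ge_cong[rotated])
      fix v :: monom assume v: "keys v \<subseteq> V"
      have "F 0 v \<longleftrightarrow> psum (path_pow m (n - 1) t) (\<lambda>_. True) v"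
        using comp[OF v, of 0] ppow_line[of m "n - 1" t] by (simp add: Q_def)
      also have "\<dots> \<longleftrightarrow> path_pow m (n - 1) t v"
        using upset_add[OF upset_path_pow] unfolding psum_def by (metis add.right_neutral)
      finally show "path_pow m (n - 1) t v \<longleftrightarrow> F 0 v" by simp
    qed
  qed
  have dk: "d (Suc j) = depth_quot V (mspan V (F j) :: 'k mpoly set)"
    "s (Suc j) = sdepth_quot V (mspan V (F j) :: 'k mpoly set)" if "j < t" for j
    using assms(11,12)[of "Suc j"] compI[of j] that V by simp_all
  \<comment> \<open>Serves both (1) and (3), which differ only in where the bounds on the
    coefficient ideals come from.\<close>
  have trunc: "enat r \<le> depth_quot {1..n} Jxt"
    if "\<And>j. j < t \<Longrightarrow> pdepth V r (mspan V (F j) :: 'k mpoly set)" for r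
    unfolding V(3) Jxt depth_quot_mspan_ge_iff[OF finV upT nT] unfolding T_def
    by (rule depth_mspan_truncate[OF V(1,2) upPt assms(3) that[unfolded F_def]])
  have "Min (insert (enat (nat (phi (n - 1) m t))) (d ` {2..t})) \<le> depth_quot {1..n} Jxt"
  proof (rule enat_le_by_approx)
    fix r assume r: "enat r \<le> Min (insert (enat (nat (phi (n - 1) m t))) (d ` {2..t}))"
    have "pdepth V r (mspan V (F j) :: 'k mpoly set)" if j: "j < t" for j
    proof (cases "j = 0")
      case True
      have "r \<le> nat (phi (n - 1) m t)" using r by simp
      then have "depths_ge TYPE('k) V (F 0) r" using depths_ge_mono[OF V(1) first] by blast
      then show ?thesis using nF True by (simp add: depths_ge_def)
    next
      case False
      then have "enat r \<le> d (Suc j)" using r j by simp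
      then show ?thesis unfolding dk(1)[OF j] depth_quot_mspan_ge_iff[OF V(1) upF nF] .
    qed
    then show "enat r \<le> depth_quot {1..n} Jxt" by (rule trunc)
  qed
  moreover have "Min (insert (enat (nat (phi (n - 1) m t))) (s ` {2..t})) \<le> sdepth_quot {1..n} Jxt"
  proof (rule enat_le_by_approx)
    fix r assume r: "enat r \<le> Min (insert (enat (nat (phi (n - 1) m t))) (s ` {2..t}))"
    show "enat r \<le> sdepth_quot {1..n} Jxt"
    proof (cases r)
      case (Suc q)
      have "\<exists>D. partition V (F j) D \<and> (\<forall>e\<in>D. Suc q \<le> card (snd e))" if j: "j < t" for j
      proof (cases "j = 0")
        case True
        have "Suc q \<le> nat (phi (n - 1) m t)" using r Suc by simp
        then have "depths_ge TYPE('k) V (F 0) (Suc q)" using depths_ge_mono[OF V(1) first] by blast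
        then show ?thesis using nF True by (simp add: depths_ge_def)
      next
        case False
        then have "enat (Suc q) \<le> s (Suc j)" using r j Suc by simp
        then show ?thesis unfolding dk(2)[OF j] sdepth_quot_mspan_ge_iff[OF upF] .
      qed
      then obtain D where D: "\<And>j. j < t \<Longrightarrow> partition V (F j) (D j)"
        "\<And>j e. j < t \<Longrightarrow> e \<in> D j \<Longrightarrow> Suc q \<le> card (snd e)" by metis
      have "partition (insert n V) T (\<Union>j<t. shift_pair (Poly_Mapping.single n j) ` D j)"
        unfolding T_def using D(1) V(2) by (intro partition_truncate) (auto simp: F_def)
      moreover have "\<forall>e\<in>\<Union>j<t. shift_pair (Poly_Mapping.single n j) ` D j. Suc q \<le> card (snd e)"
        using D(2) by (fastforce simp: shift_pair_def)
      ultimately show ?thesis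
        unfolding V(3) Jxt Suc sdepth_quot_mspan_ge_iff[OF upT] by blast
    qed (simp add: zero_enat_def[symmetric])
  qed
  moreover have "depth_quot {1..n} Jt \<le> depth_quot {1..n} Jxt + 1"
  proof (rule enat_le_by_approx)
    fix r assume r: "enat r \<le> depth_quot {1..n} Jt"
    show "enat r \<le> depth_quot {1..n} Jxt + 1"
    proof (cases r)
      case (Suc q)
      have "pdepth (insert n V) (Suc q) (mspan (insert n V) Pt :: 'k mpoly set)"
        using r unfolding V(3) Jt Suc depth_quot_mspan_ge_iff[OF finV upPt nPt] .
      \<comment> \<open>Each coefficient ideal of \<open>J^t\<close> loses at most one, and in
        degrees below \<open>t\<close> these are also the coefficient ideals of
        \<open>(J^t, x_n^t)\<close>.\<close>
      from depth_mspan_component[OF V(1,2) upPt nP this]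
      have "enat q \<le> depth_quot {1..n} Jxt" by (intro trunc) (simp add: F_def)
      then have "enat q + 1 \<le> depth_quot {1..n} Jxt + 1" by (rule add_right_mono)
      then show ?thesis using Suc by (simp add: one_enat_def)
    qed (simp add: zero_enat_def[symmetric])
  qed
  moreover have "depth_quot {1..n} Jxt \<le> depth_quot {1..n} Jt"
    if "depth_quot {1..n} Jt < depth_quot {1..n} (ideal_colon S Jt (mvar n ^ t))"
  proof (rule ccontr)
    assume "\<not> depth_quot {1..n} Jxt \<le> depth_quot {1..n} Jt"
    then have lt: "depth_quot {1..n} Jt < depth_quot {1..n} Jxt" by simp
    then obtain q where q: "depth_quot {1..n} Jt = enat q" by (cases "depth_quot {1..n} Jt") auto
    \<comment> \<open>Both outer terms of the exact sequence would exceed \<open>q\<close>, and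
      hence so would the middle term.\<close>
    have "enat (Suc q) \<le> depth_quot (insert n V) (mspan (insert n V) (F t) :: 'k mpoly set)"
      using that q unfolding V(3) S Jt colon F_def by (simp add: Suc_ile_eq)
    moreover have "enat (Suc q) \<le> depth_quot (insert n V) (mspan (insert n V) T :: 'k mpoly set)"
      using lt q unfolding V(3) Jxt by (simp add: Suc_ile_eq)
    ultimately have "pdepth (insert n V) (Suc q) (mspan (insert n V) Pt :: 'k mpoly set)"
      unfolding depth_quot_mspan_ge_iff[OF finV upF nF] depth_quot_mspan_ge_iff[OF finV upT nT]
      by (intro depth_mspan_split[OF finV _ upPt, of n _ t]) (auto simp: F_def T_def)
    then have "enat (Suc q) \<le> depth_quot {1..n} Jt"
      unfolding V(3) Jt depth_quot_mspan_ge_iff[OF finV upPt nPt] .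
    then show False using q by simp
  qed
  moreover have "sdepth_quot {1..n} Jxt \<le> sdepth_quot {1..n} Jt"
    if "sdepth_quot {1..n} Jt < sdepth_quot {1..n} (ideal_colon S Jt (mvar n ^ t))"
  proof (rule ccontr)
    assume "\<not> sdepth_quot {1..n} Jxt \<le> sdepth_quot {1..n} Jt"
    then have lt: "sdepth_quot {1..n} Jt < sdepth_quot {1..n} Jxt" by simp
    then obtain q where q: "sdepth_quot {1..n} Jt = enat q" by (cases "sdepth_quot {1..n} Jt") auto
    have "enat (Suc q) \<le> sdepth_quot (insert n V) (mspan (insert n V) (F t) :: 'k mpoly set)"
      using that q unfolding V(3) S Jt colon F_def by (simp add: Suc_ile_eq)
    then obtain D1 where D1: "partition (insert n V) (F t) D1" "\<forall>e\<in>D1. Suc q \<le> card (snd e)"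
      unfolding sdepth_quot_mspan_ge_iff[OF upF] by blast
    have "enat (Suc q) \<le> sdepth_quot (insert n V) (mspan (insert n V) T :: 'k mpoly set)"
      using lt q unfolding V(3) Jxt by (simp add: Suc_ile_eq)
    then obtain D2 where D2: "partition (insert n V) T D2" "\<forall>e\<in>D2. Suc q \<le> card (snd e)"
      unfolding sdepth_quot_mspan_ge_iff[OF upT] by blast
    have "partition (insert n V) Pt (shift_pair (Poly_Mapping.single n t) ` D1 \<union> D2)"
      using D1(1) D2(1) unfolding F_def T_def by (intro partition_split) auto
    moreover have "\<forall>e\<in>shift_pair (Poly_Mapping.single n t) ` D1 \<union> D2. Suc q \<le> card (snd e)"
      using D1(2) D2(2) by (auto simp: shift_pair_def)
    ultimately have "enat (Suc q) \<le> sdepth_quot {1..n} Jt"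
      unfolding V(3) Jt sdepth_quot_mspan_ge_iff[OF upPt] by blast
    then show False using q by simp
  qed
  ultimately show ?thesis by blast
qed

end
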